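(* Let $T$ be a nontrivial tree (i.e. with at least one edge). Then $\gamma'_t(T)=\gamma'(T)$ if and only if $T\in\mathcal{T}_t$ (i.e. $T$ admits an edge labelling with labels $S$, $L_1$, $L_2$ such that the edge-labelled tree belongs to $\mathcal{T}_t$).
   Context: Two distinct edges are adjacent if they share an endpoint. For a graph $G=(V,E)$, $F\subseteq E$ is an edge dominating set if every edge in $E\setminus F$ is adjacent to at least one edge of $F$, and a total edge dominating set if every edge in $E$ is adjacent to at least one edge of $F$. $\gamma'(G)$ and $\gamma'_t(G)$ are the minimum cardinalities of an edge dominating set and of a total edge dominating set, respectively (a minimum over an empty family is $\infty$). A leaf is a vertex of degree one; a leaf edge is an edge with a leaf as an endpoint. $E(v)$ is the set of edges incident with $v$. $P_4$ denotes a path with four vertices. In an edge-labelled tree, an edge labelled $S$ (resp. $L_1$, $L_2$) is called an $S$-edge (resp. $L_1$-edge, $L_2$-edge). For an edge-labelled tree with vertex set $V$: $A_1$ is the set of vertices $v$ with exactly one $S$-edge in $E(v)$; $A_2$ is the set of vertices $v$ with at least two $S$-edges in $E(v)$; $B$ is the set of vertices $v$ such that all edges in $E(v)$ are $L_2$-edges; $C=V\setminus(A_1\cup A_2\cup B)$. Initial trees: every tree of diameter $4$, with its non-leaf edges labelled $S$, its leaf edges that are adjacent to at least two non-leaf edges labelled $L_2$, and its other leaf edges labelled $L_1$. $\mathcal{T}_t$ is the smallest family of edge-labelled trees containing all initial trees and closed under the following five operations, each building a bigger tree $T'$ from $T\in\mathcal{T}_t$ (labels of edges of $T$ are kept; $A_1,A_2,B,C$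 are taken with respect to $T$). $\mathcal{O}_1$: Let $v\in A_1\cup A_2$. Add a new vertex $u$ adjacent to $v$; label $vu$ as $L_1$ if $v\in A_1$ and as $L_2$ if $v\in A_2$. $\mathcal{O}_2$: Let $v\in A_2$. Add two new adjacent vertices $u_1,u_2$, join $v$ to $u_1$, label $vu_1$ as $S$ and $u_1u_2$ as $L_1$. $\mathcal{O}_3$: Let $v\notin A_1$ be a vertex of $T$ satisfying, in the case $v\in C$, that each $L_1$-edge in $E(v)$ is either adjacent to a leaf edge or contained in a $P_4=vwxy$ whose edges $vw,wx,xy$ are labelled $L_1,L_1,L_2$ consecutively and such that all edges in $E(x)$ except $wx$ are $L_2$-edges. Add a new path $u_1u_2u_3u_4u_5$, join $v$ to $u_2$, label $u_2u_3,u_3u_4$ as $S$ and $vu_2,u_1u_2,u_4u_5$ as $L_1$. $\mathcal{O}_4$: Let $v\in B$. Add a new path $u_1u_2u_3u_4$, join $v$ to $u_1$, label $vu_1,u_3u_4$ as $L_1$ and $u_1u_2,u_2u_3$ as $S$. $\mathcal{O}_5$: Let $v$ be any vertex of $T$. Add a new path $u_1u_2u_3u_4u_5$, join $v$ to $u_3$, label $vu_3$ as $L_2$, $u_1u_2,u_4u_5$ as $L_1$ and $u_2u_3,u_3u_4$ as $S$. *)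

theory Defs
  imports "HOL-Library.Extended_Nat"
begin

text \<open>
  A finite simple graph is given by its vertex set \<open>V\<close> and its edge set \<open>E\<close>, whose
  elements are two-element subsets of \<open>V\<close>.
\<close>

definition simple_graph :: "'a set \<Rightarrow> 'a set set \<Rightarrow> bool" where
  "simple_graph V E \<longleftrightarrow> finite V \<and> (\<forall>e\<in>E. e \<subseteq> V \<and> card e = 2)"

definition is_walk :: "'a set \<Rightarrow> 'a set set \<Rightarrow> 'a list \<Rightarrow> bool" where
  "is_walk V E p \<longleftrightarrow> p \<noteq> [] \<and> set p \<subseteq> V \<and> successively (\<lambda>x y. {x, y} \<in> E) p"

definition is_path :: "'a set \<Rightarrow> 'a set set \<Rightarrow> 'a list \<Rightarrow> bool" where
  "is_path V E p \<longleftrightarrow> is_walk V E p \<and> distinct p"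

definition is_cycle :: "'a set \<Rightarrow> 'a set set \<Rightarrow> 'a list \<Rightarrow> bool" where
  "is_cycle V E p \<longleftrightarrow> is_path V E p \<and> length p \<ge> 3 \<and> {last p, hd p} \<in> E"

definition connected_graph :: "'a set \<Rightarrow> 'a set set \<Rightarrow> bool" where
  "connected_graph V E \<longleftrightarrow>
     V \<noteq> {} \<and> (\<forall>u\<in>V. \<forall>v\<in>V. \<exists>p. is_walk V E p \<and> hd p = u \<and> last p = v)"

definition is_tree :: "'a set \<Rightarrow> 'a set set \<Rightarrow> bool" where
  "is_tree V E \<longleftrightarrow> simple_graph V E \<and> connected_graph V E \<and> (\<nexists>p. is_cycle V E p)"

definition graph_dist :: "'a set \<Rightarrow> 'a set set \<Rightarrow> 'a \<Rightarrow> 'a \<Rightarrow> nat" where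
  "graph_dist V E u v =
     (LEAST n. \<exists>p. is_walk V E p \<and> hd p = u \<and> last p = v \<and> length p = Suc n)"

text \<open>Only meaningful for nonempty finite connected graphs, where the maximum exists.\<close>

definition graph_diameter :: "'a set \<Rightarrow> 'a set set \<Rightarrow> nat" where
  "graph_diameter V E = Max {graph_dist V E u v | u v. u \<in> V \<and> v \<in> V}"

definition incident_edges :: "'a set set \<Rightarrow> 'a \<Rightarrow> 'a set set" where
  "incident_edges E v = {e \<in> E. v \<in> e}"

definition edge_adjacent :: "'a set \<Rightarrow> 'a set \<Rightarrow> bool" where
  "edge_adjacent e f \<longleftrightarrow> e \<noteq> f \<and> e \<inter> f \<noteq> {}"

definition is_leaf :: "'a set set \<Rightarrow> 'a \<Rightarrow> bool" where
  "is_leaf E v \<longleftrightarrow> card (incident_edges E v) = 1"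

definition leaf_edge :: "'a set set \<Rightarrow> 'a set \<Rightarrow> bool" where
  "leaf_edge E e \<longleftrightarrow> e \<in> E \<and> (\<exists>v\<in>e. is_leaf E v)"

definition edge_dominating_set :: "'a set set \<Rightarrow> 'a set set \<Rightarrow> bool" where
  "edge_dominating_set E F \<longleftrightarrow> F \<subseteq> E \<and> (\<forall>e\<in>E - F. \<exists>f\<in>F. edge_adjacent e f)"

definition total_edge_dominating_set :: "'a set set \<Rightarrow> 'a set set \<Rightarrow> bool" where
  "total_edge_dominating_set E F \<longleftrightarrow> F \<subseteq> E \<and> (\<forall>e\<in>E. \<exists>f\<in>F. edge_adjacent e f)"

text \<open>
  The infimum in \<^typ>\<open>enat\<close> of a nonempty set is attained, and that of the empty set is \<open>\<infinity>\<close>.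
\<close>

definition edge_domination_number :: "'a set set \<Rightarrow> enat" where
  "edge_domination_number E = (INF F \<in> {F. edge_dominating_set E F}. enat (card F))"

definition total_edge_domination_number :: "'a set set \<Rightarrow> enat" where
  "total_edge_domination_number E = (INF F \<in> {F. total_edge_dominating_set E F}. enat (card F))"

text \<open>
  An edge labelling of \<open>(V, E)\<close> is a total function on sets of vertices, of which only the values
  on \<open>E\<close> matter.
\<close>

datatype label = S | L1 | L2

type_synonym 'a labelling = "'a set \<Rightarrow> label"

definition set_A1 :: "'a set \<Rightarrow> 'a set set \<Rightarrow> 'a labelling \<Rightarrow> 'a set" where
  "set_A1 V E l = {v \<in> V. card {e \<in> incident_edges E v. l e = S} = 1}"

definition set_A2 :: "'a set \<Rightarrow> 'a set set \<Rightarrow> 'a labelling \<Rightarrow> 'a set" where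
  "set_A2 V E l = {v \<in> V. card {e \<in> incident_edges E v. l e = S} \<ge> 2}"

definition set_B :: "'a set \<Rightarrow> 'a set set \<Rightarrow> 'a labelling \<Rightarrow> 'a set" where
  "set_B V E l = {v \<in> V. \<forall>e \<in> incident_edges E v. l e = L2}"

definition set_C :: "'a set \<Rightarrow> 'a set set \<Rightarrow> 'a labelling \<Rightarrow> 'a set" where
  "set_C V E l = V - (set_A1 V E l \<union> set_A2 V E l \<union> set_B V E l)"

definition initial_labelled_tree :: "'a set \<Rightarrow> 'a set set \<Rightarrow> 'a labelling \<Rightarrow> bool" where
  "initial_labelled_tree V E l \<longleftrightarrow>
     is_tree V E \<and> graph_diameter V E = 4 \<and>
     (\<forall>e\<in>E. l e =
        (if \<not> leaf_edge E e then S
         else if card {f \<in> E. \<not> leaf_edge E f \<and> edge_adjacent e f} \<ge> 2 then L2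
         else L1))"

text \<open>The side condition of the third operation at a vertex \<open>v\<close> of \<open>C\<close>.\<close>

definition O3_condition :: "'a set \<Rightarrow> 'a set set \<Rightarrow> 'a labelling \<Rightarrow> 'a \<Rightarrow> bool" where
  "O3_condition V E l v \<longleftrightarrow>
     (\<forall>e \<in> incident_edges E v. l e = L1 \<longrightarrow>
        (\<exists>f. leaf_edge E f \<and> edge_adjacent e f) \<or>
        (\<exists>w x y. is_path V E [v, w, x, y] \<and> e \<in> {{v, w}, {w, x}, {x, y}} \<and>
           l {v, w} = L1 \<and> l {w, x} = L1 \<and> l {x, y} = L2 \<and>
           (\<forall>f \<in> incident_edges E x - {{w, x}}. l f = L2)))"

text \<open>
  The trees are not taken up to isomorphism: new vertices are arbitrary elements of the vertex type
  outside \<open>V\<close>. As every operation only adds vertices, all trees occurring in the construction of a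
  tree \<open>(V, E)\<close> are subtrees of it, so no assumption on the cardinality of the vertex type is needed.
\<close>

inductive family_Tt :: "'a set \<Rightarrow> 'a set set \<Rightarrow> 'a labelling \<Rightarrow> bool" where
  init: "initial_labelled_tree V E l \<Longrightarrow> family_Tt V E l"
| O1: "\<lbrakk>family_Tt V E l; v \<in> set_A1 V E l \<union> set_A2 V E l; u \<notin> V\<rbrakk> \<Longrightarrow>
    family_Tt (V \<union> {u}) (E \<union> {{v, u}})
      (l({v, u} := if v \<in> set_A1 V E l then L1 else L2))"
| O2: "\<lbrakk>family_Tt V E l; v \<in> set_A2 V E l; distinct [u1, u2]; {u1, u2} \<inter> V = {}\<rbrakk> \<Longrightarrow>
    family_Tt (V \<union> {u1, u2}) (E \<union> {{v, u1}, {u1, u2}})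
      (l({v, u1} := S, {u1, u2} := L1))"
| O3: "\<lbrakk>family_Tt V E l; v \<in> V; v \<notin> set_A1 V E l; v \<in> set_C V E l \<longrightarrow> O3_condition V E l v;
     distinct [u1, u2, u3, u4, u5]; {u1, u2, u3, u4, u5} \<inter> V = {}\<rbrakk> \<Longrightarrow>
    family_Tt (V \<union> {u1, u2, u3, u4, u5})
      (E \<union> {{u1, u2}, {u2, u3}, {u3, u4}, {u4, u5}, {v, u2}})
      (l({u2, u3} := S, {u3, u4} := S, {v, u2} := L1, {u1, u2} := L1, {u4, u5} := L1))"
| O4: "\<lbrakk>family_Tt V E l; v \<in> set_B V E l;
     distinct [u1, u2, u3, u4]; {u1, u2, u3, u4} \<inter> V = {}\<rbrakk> \<Longrightarrow>
    family_Tt (V \<union> {u1, u2, u3, u4})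
      (E \<union> {{u1, u2}, {u2, u3}, {u3, u4}, {v, u1}})
      (l({v, u1} := L1, {u3, u4} := L1, {u1, u2} := S, {u2, u3} := S))"
| O5: "\<lbrakk>family_Tt V E l; v \<in> V;
     distinct [u1, u2, u3, u4, u5]; {u1, u2, u3, u4, u5} \<inter> V = {}\<rbrakk> \<Longrightarrow>
    family_Tt (V \<union> {u1, u2, u3, u4, u5})
      (E \<union> {{u1, u2}, {u2, u3}, {u3, u4}, {u4, u5}, {v, u3}})
      (l({v, u3} := L2, {u1, u2} := L1, {u4, u5} := L1, {u2, u3} := S, {u3, u4} := S))"

end

theory Submission
  imports Defs
begin

text \<open>
  Call a set \<open>M\<close> of edges a strong matching if no edge of the graph meets two members of \<open>M\<close>. An
  edge dominating set needs a separate edge for each member of \<open>M\<close>, so \<open>card M\<close> is a lower bound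
  for \<open>\<gamma>'\<close>. In a forest the bound is attained (\<open>forest_strong_duality\<close>).

  Therefore, if \<open>\<gamma>'\<^sub>t = \<gamma>'\<close> in a tree, some total edge dominating set \<open>F\<close> has the size of a strong
  matching \<open>M\<close>. By counting, each edge of \<open>M\<close> is adjacent to exactly one edge of \<open>F\<close>, and every
  edge of \<open>F\<close> is adjacent to exactly one edge of \<open>M\<close> and is not in \<open>M\<close>. So \<open>F\<close> is a disjoint
  union of stars: an edge of \<open>F\<close> has one end \<open>y\<close> on \<open>M\<close>, at which there is no other edge of \<open>F\<close>, and
  at the other end there is a further edge of \<open>F\<close>, because \<open>F\<close> dominates itself. Let \<open>X\<close> be the set
  of the centres of the stars and \<open>Y\<close> the set of the outer ends of their rays. The edge of \<open>M\<close> at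
  \<open>y \<in> Y\<close> leads to a vertex outside the stars whose only neighbour in \<open>Y\<close> is \<open>y\<close>. This is the
  structure \<open>star_cover\<close>. Conversely, the edges from \<open>Y\<close> to such private neighbours form a strong
  matching of the size of \<open>F\<close>, so a star cover forces equality (\<open>tree_equal_iff_star_cover\<close>).

  It remains to compare star covers with the constructed trees. There \<open>F\<close> is the set of \<open>S\<close>-edges,
  and \<open>A\<^sub>1 = Y\<close>, \<open>A\<^sub>2 = X\<close>. Each operation adds to the star cover of the old tree
  (\<open>labelled_star_cover.extend\<close>). The only thing that can go wrong is that the new edge ends the
  privacy of the vertex \<open>v\<close> to which the new part is attached; this threatens the third operation
  alone, and its side condition says that \<open>v\<close> can be replaced by another private neighbour.

  In the other direction, a tree with a star cover is reduced until it is a path with five vertices.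
  A superfluous leaf undoes the first operation, a superfluous ray with a single leaf attached to it
  the second. If neither exists, imagine each star contracted to a point and the leaves deleted. An
  end vertex of the remaining tree is a star with two rays that is attached to the rest by a single
  edge, and removing it undoes one of the other operations, depending on where that edge starts and
  whether its other end serves as a private neighbour (\<open>constructible_if_nonempty\<close>).
\<close>

section \<open>Paths and end vertices in trees\<close>

lemma simple_graph_edge:
  assumes "simple_graph V E" "{a, b} \<in> E"
  shows "a \<noteq> b" "a \<in> V" "b \<in> V"
proof -
  have "{a, b} \<subseteq> V \<and> card {a, b} = 2" using assms unfolding simple_graph_def by blast
  then show "a \<noteq> b" "a \<in> V" "b \<in> V" by (auto simp: card_insert_if split: if_splits)
qed

lemma simple_graph_edgeE:
  assumes "simple_graph V E" "e \<in> E" "a \<in> e"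
  obtains b where "e = {a, b}"
proof -
  have "card e = 2" using assms(1,2) by (simp add: simple_graph_def)
  then obtain x y where "e = {x, y}" by (auto simp: card_2_iff)
  then have "e = {a, x} \<or> e = {a, y}" using assms(3) by blast
  then show ?thesis using that by blast
qed

lemma is_walk_Cons:
  "is_walk V E (a # b # p) \<longleftrightarrow> a \<in> V \<and> {a, b} \<in> E \<and> is_walk V E (b # p)"
  by (auto simp: is_walk_def)

lemma is_walk_single: "is_walk V E [a] \<longleftrightarrow> a \<in> V"
  by (auto simp: is_walk_def)

lemma is_path_rev: "is_path V E p \<Longrightarrow> is_path V E (rev p)"
  by (simp add: is_path_def is_walk_def successively_rev insert_commute)

text \<open>
  Otherwise \<open>r\<close> would lie on the path and close a cycle with an initial piece of it. So in a tree a
  walk that never turns back is a path.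
\<close>

lemma path_extend:
  assumes "is_tree V E" "is_path V E (a # b # p)" "{r, a} \<in> E" "r \<noteq> b"
  shows "is_path V E (r # a # b # p)"
proof -
  have sg: "simple_graph V E" using assms(1) by (simp add: is_tree_def)
  note r = simple_graph_edge[OF sg assms(3)]
  have "r \<notin> set p"
  proof
    assume "r \<in> set p"
    then obtain p1 p2 where p: "p = p1 @ r # p2" by (meson split_list)
    have "is_path V E ((a # b # p1 @ [r]) @ p2)" using assms(2) p by simp
    then have "is_path V E (a # b # p1 @ [r])"
      unfolding is_path_def is_walk_def successively_append_iff by auto
    then have "is_cycle V E (a # b # p1 @ [r])"
      using assms(3) by (simp add: is_cycle_def)
    then show False using assms(1) by (auto simp: is_tree_def)
  qed
  then show ?thesis using assms(2-4) r by (auto simp: is_path_def is_walk_Cons)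
qed

text \<open>
  By induction on the walk \<open>q\<close>: if its first edge is the first edge of the path, it is removed from
  both; otherwise it is put in front of the path, which stays a path by \<open>path_extend\<close>.
\<close>

lemma tree_path_shortest:
  assumes T: "is_tree V E"
  shows "is_walk V E q \<Longrightarrow> is_path V E p \<Longrightarrow> hd p = hd q \<Longrightarrow> last p = last q \<Longrightarrow>
    length p \<le> length q"
proof (induction q arbitrary: p)
  case Nil
  then show ?case by (simp add: is_walk_def)
next
  case (Cons a q)
  have ne: "p \<noteq> []" and d: "distinct p" using Cons.prems by (auto simp: is_path_def is_walk_def)
  show ?case
  proof (cases p)
    case (Cons a' p')
    have [simp]: "a' = a" using Cons.prems Cons by simp
    show ?thesis
    proof (cases q)
      case Nil
      then show ?thesis using Cons.prems Cons d by (cases p' rule: rev_cases) (auto split: if_splits)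
    next
      case q: (Cons b q')
      have ab: "{b, a} \<in> E" and w: "is_walk V E q"
        using Cons.prems(1) q by (auto simp: is_walk_Cons insert_commute)
      have bV: "b \<in> V" using w q by (auto simp: is_walk_def)
      show ?thesis
      proof (cases p')
        case Nil
        then show ?thesis using Cons by simp
      next
        case p': (Cons b' p'')
        show ?thesis
        proof (cases "b = b'")
          case True
          have "is_path V E p'" using Cons.prems(2) Cons p' by (auto simp: is_path_def is_walk_Cons)
          then have "length p' \<le> length q"
            using Cons.IH[OF w, of p'] Cons.prems q p' True Cons by simp
          then show ?thesis using Cons by simp
        next
          case False
          have "is_path V E (b # a # b' # p'')"
            using path_extend[OF T _ ab False] Cons.prems(2) Cons p' by simp
          then have "length (b # a # b' # p'') \<le> length q"
            using Cons.IH[OF w, of "b # a # b' # p''"] Cons.prems q p' Cons by simp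
          then show ?thesis using Cons p' by simp
        qed
      qed
    qed
  qed (simp add: ne)
qed

lemma walk_imp_path:
  "is_walk V E q \<Longrightarrow> \<exists>p. is_path V E p \<and> hd p = hd q \<and> last p = last q"
proof (induction q)
  case Nil
  then show ?case by (simp add: is_walk_def)
next
  case (Cons a q)
  show ?case
  proof (cases q)
    case Nil
    then show ?thesis using Cons.prems by (intro exI[of _ "[a]"]) (simp add: is_path_def)
  next
    case q: (Cons b q')
    then obtain p where p: "is_path V E p" "hd p = b" "last p = last q"
      using Cons by (auto simp: is_walk_Cons)
    then obtain p' where p': "p = b # p'" by (cases p) (auto simp: is_path_def is_walk_def)
    show ?thesis
    proof (cases "a \<in> set p")
      case True
      then obtain p1 p2 where s: "p = p1 @ a # p2" by (meson split_list)
      have "is_path V E (a # p2)"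
        using p(1) s by (auto simp: is_path_def is_walk_def successively_append_iff)
      then show ?thesis using p s q by (intro exI[of _ "a # p2"]) auto
    next
      case False
      then have "is_path V E (a # p)"
        using p(1) p' Cons.prems q by (auto simp: is_path_def is_walk_Cons)
      then show ?thesis using p p' q by (intro exI[of _ "a # p"]) auto
    qed
  qed
qed

lemma tree_pathE:
  assumes "is_tree V E" "u \<in> V" "v \<in> V"
  obtains p where "is_path V E p" "hd p = u" "last p = v"
proof -
  obtain q where "is_walk V E q" "hd q = u" "last q = v"
    using assms unfolding is_tree_def connected_graph_def by blast
  then show ?thesis using walk_imp_path[of V E q] that by auto
qed

lemma path_length_le:
  assumes "finite V" "is_path V E p"
  shows "length p \<le> card V"
  using assms distinct_card[of p] card_mono[of V "set p"] by (auto simp: is_path_def is_walk_def)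

text \<open>
  The first vertex of a longest path in \<open>E'\<close> has degree one in \<open>E'\<close>. The freedom to choose \<open>E'\<close> is
  what makes this useful: end vertices of subgraphs are found without speaking about the subgraphs as
  trees.
\<close>

lemma tree_subset_end_vertex:
  assumes T: "is_tree V E" and sub: "E' \<subseteq> E" and ne: "E' \<noteq> {}"
  obtains p q where "{p, q} \<in> E'" "\<And>r. {p, r} \<in> E' \<Longrightarrow> r = q"
proof -
  have sg: "simple_graph V E" using T by (simp add: is_tree_def)
  define P where "P = (\<lambda>p. is_path V E' p \<and> 2 \<le> length p)"
  have mono: "is_path V E p" if "P p" for p
    using that sub unfolding P_def is_path_def is_walk_def
    by (auto elim: successively_mono)
  obtain e where e: "e \<in> E'" using ne by auto
  then obtain a where "a \<in> e" using sg sub unfolding simple_graph_def by fastforce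
  then obtain b where ab: "e = {a, b}" using simple_graph_edgeE[OF sg] e sub by blast
  have "a \<noteq> b" "a \<in> V" "b \<in> V" using simple_graph_edge[OF sg, of a b] e ab sub by auto
  then have "P [a, b]" using e ab by (auto simp: P_def is_path_def is_walk_def)
  moreover have "\<forall>p. P p \<longrightarrow> length p < Suc (card V)"
    using mono path_length_le sg by (fastforce simp: simple_graph_def)
  ultimately obtain p where p: "P p" and max: "\<And>q. P q \<Longrightarrow> length q \<le> length p"
    using ex_has_greatest_nat[of P _ length] by (metis less_Suc_eq_le)
  obtain c d p' where pp: "p = c # d # p'"
    using p unfolding P_def by (cases p; cases "tl p") auto
  show thesis
  proof
    show "{c, d} \<in> E'" using p pp by (auto simp: P_def is_path_def is_walk_Cons)
    fix r assume r: "{c, r} \<in> E'"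
    show "r = d"
    proof (rule ccontr)
      assume "r \<noteq> d"
      then have "is_path V E (r # c # d # p')"
        using path_extend[OF T] mono[OF p] pp r sub by (metis insert_commute subsetD)
      then have "P (r # p)"
        using p pp r unfolding P_def is_path_def is_walk_Cons by (auto simp: is_walk_Cons insert_commute)
      then show False using max[of "r # p"] by simp
    qed
  qed
qed

lemma is_walk_rtranclp:
  "is_walk V E p \<Longrightarrow> (\<lambda>x y. {x, y} \<in> E)\<^sup>*\<^sup>* (hd p) (last p)"
proof (induction p rule: induct_list012)
  case (3 x y zs)
  then show ?case by (auto simp: is_walk_Cons intro: converse_rtranclp_into_rtranclp)
qed (auto simp: is_walk_def)

lemma rtranclp_is_walk:
  assumes "simple_graph V E" "(\<lambda>x y. {x, y} \<in> E)\<^sup>*\<^sup>* a b" "a \<in> V"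
  shows "\<exists>p. is_walk V E p \<and> hd p = a \<and> last p = b"
  using assms(2,3)
proof (induction rule: converse_rtranclp_induct)
  case base
  then show ?case by (intro exI[of _ "[b]"]) (simp add: is_walk_single)
next
  case (step x y)
  then obtain p where p: "is_walk V E p" "hd p = y" "last p = b"
    using simple_graph_edge[OF assms(1)] by blast
  then obtain p' where "p = y # p'" by (cases p) (auto simp: is_walk_def)
  then show ?case using p step by (intro exI[of _ "x # p"]) (auto simp: is_walk_Cons)
qed

lemma connected_graph_iff:
  assumes "simple_graph V E"
  shows "connected_graph V E \<longleftrightarrow> V \<noteq> {} \<and> (\<forall>u\<in>V. \<forall>v\<in>V. (\<lambda>x y. {x, y} \<in> E)\<^sup>*\<^sup>* u v)"
proof -
  have "(\<exists>p. is_walk V E p \<and> hd p = u \<and> last p = v) \<longleftrightarrow> (\<lambda>x y. {x, y} \<in> E)\<^sup>*\<^sup>* u v"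
    if "u \<in> V" for u v
  proof
    assume "\<exists>p. is_walk V E p \<and> hd p = u \<and> last p = v"
    then obtain p where p: "is_walk V E p" "hd p = u" "last p = v" by blast
    show "(\<lambda>x y. {x, y} \<in> E)\<^sup>*\<^sup>* u v" using is_walk_rtranclp[OF p(1)] unfolding p .
  qed (rule rtranclp_is_walk[OF assms _ that])
  then show ?thesis unfolding connected_graph_def by simp
qed

lemma tree_closed_set:
  assumes "is_tree V E" "U \<subseteq> V" "a \<in> U" "\<And>u w. u \<in> U \<Longrightarrow> {u, w} \<in> E \<Longrightarrow> w \<in> U"
  shows "U = V"
proof -
  have sg: "simple_graph V E" using assms by (simp add: is_tree_def)
  have "w \<in> U" if "(\<lambda>x y. {x, y} \<in> E)\<^sup>*\<^sup>* a w" for w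
    using that by induction (use assms in auto)
  then show ?thesis
    using assms connected_graph_iff[OF sg] unfolding is_tree_def by blast
qed

text \<open>
  If all edges that leave \<open>U\<close> lead to the single vertex \<open>v\<close>, then moving all of \<open>U\<close> to \<open>v\<close> maps walks to
  walks outside \<open>U\<close>, so deleting \<open>U\<close> keeps the graph connected.
\<close>

lemma tree_delete:
  assumes T: "is_tree V E" and v: "v \<in> V" "v \<notin> U"
    and U: "\<And>u w. u \<in> U \<Longrightarrow> {u, w} \<in> E \<Longrightarrow> w \<in> U \<or> w = v"
  shows "is_tree (V - U) {e \<in> E. e \<inter> U = {}}"
proof -
  let ?V = "V - U" and ?E = "{e \<in> E. e \<inter> U = {}}"
  have sg: "simple_graph V E" using T by (simp add: is_tree_def)
  then have sg': "simple_graph ?V ?E" by (auto simp: simple_graph_def)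
  define h where "h = (\<lambda>u. if u \<in> U then v else u)"
  have step: "h x = h y \<or> {h x, h y} \<in> ?E" if "{x, y} \<in> E" for x y
    using that U[of x y] U[of y x] v by (auto simp: h_def insert_commute)
  have reach: "(\<lambda>x y. {x, y} \<in> ?E)\<^sup>*\<^sup>* (h x) (h y)" if "(\<lambda>x y. {x, y} \<in> E)\<^sup>*\<^sup>* x y" for x y
    using that
  proof induction
    case (step y z)
    from \<open>{y, z} \<in> E\<close> consider "h y = h z" | "{h y, h z} \<in> ?E"
      using \<open>\<And>x y. {x, y} \<in> E \<Longrightarrow> h x = h y \<or> {h x, h y} \<in> ?E\<close> by blast
    then show ?case
    proof cases
      case 1
      then show ?thesis using step.IH by simp
    next
      case 2
      then show ?thesis by (rule rtranclp.rtrancl_into_rtrancl[OF step.IH])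
    qed
  qed simp
  have "connected_graph ?V ?E"
    unfolding connected_graph_iff[OF sg']
  proof (intro conjI ballI)
    show "?V \<noteq> {}" using v by auto
    fix a b assume ab: "a \<in> ?V" "b \<in> ?V"
    then have "(\<lambda>x y. {x, y} \<in> E)\<^sup>*\<^sup>* a b"
      using T connected_graph_iff[OF sg] by (auto simp: is_tree_def)
    from reach[OF this] show "(\<lambda>x y. {x, y} \<in> ?E)\<^sup>*\<^sup>* a b" using ab by (simp add: h_def)
  qed
  moreover have "is_cycle V E p" if "is_cycle ?V ?E p" for p
    using that unfolding is_cycle_def is_path_def is_walk_def
    by (auto elim: successively_mono)
  ultimately show ?thesis using sg' T unfolding is_tree_def by blast
qed

lemma is_leaf_iff:
  assumes "simple_graph V E"
  shows "is_leaf E u \<longleftrightarrow> (\<exists>v. \<forall>w. {u, w} \<in> E \<longleftrightarrow> w = v)"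
proof -
  have inc: "incident_edges E u = (\<lambda>w. {u, w}) ` {w. {u, w} \<in> E}"
  proof
    show "incident_edges E u \<subseteq> (\<lambda>w. {u, w}) ` {w. {u, w} \<in> E}"
    proof
      fix e assume "e \<in> incident_edges E u"
      then have e: "e \<in> E" "u \<in> e" by (auto simp: incident_edges_def)
      then obtain b where "e = {u, b}" by (rule simple_graph_edgeE[OF assms])
      then show "e \<in> (\<lambda>w. {u, w}) ` {w. {u, w} \<in> E}" using e by auto
    qed
  qed (auto simp: incident_edges_def)
  have "card (incident_edges E u) = card {w. {u, w} \<in> E}"
    unfolding inc by (rule card_image) (auto simp: inj_on_def doubleton_eq_iff)
  moreover have "card {w. {u, w} \<in> E} = 1 \<longleftrightarrow> (\<exists>v. \<forall>w. {u, w} \<in> E \<longleftrightarrow> w = v)"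
    by (auto simp: card_1_singleton_iff)
  ultimately show ?thesis unfolding is_leaf_def by simp
qed

section \<open>Strong matchings and star covers\<close>

definition private_nbr :: "'a set set \<Rightarrow> 'a set \<Rightarrow> 'a set \<Rightarrow> 'a \<Rightarrow> 'a \<Rightarrow> bool" where
  "private_nbr E X Y y z \<longleftrightarrow>
     z \<notin> X \<union> Y \<and> {y, z} \<in> E \<and> (\<forall>y'\<in>Y. {y', z} \<in> E \<longrightarrow> y' = y)"

text \<open>
  The edges \<open>F\<close> form disjoint stars with centres \<open>X\<close> and outer ends \<open>Y\<close>, at least two rays each, such
  that the complement of the stars' vertices is independent, \<open>Y\<close> is independent, and each element of
  \<open>Y\<close> has a private neighbour.
\<close>

locale star_cover =
  fixes E F :: "'a set set" and X Y :: "'a set"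
  assumes disjoint: "X \<inter> Y = {}"
    and stars_subset: "F \<subseteq> E"
    and star_edge: "f \<in> F \<Longrightarrow> \<exists>x\<in>X. \<exists>y\<in>Y. f = {x, y}"
    and centre: "y \<in> Y \<Longrightarrow> \<exists>!x. {x, y} \<in> F"
    and rays: "x \<in> X \<Longrightarrow> \<exists>y y'. y \<noteq> y' \<and> {x, y} \<in> F \<and> {x, y'} \<in> F"
    and cover: "{a, b} \<in> E \<Longrightarrow> a \<in> X \<or> a \<in> Y \<or> b \<in> X \<or> b \<in> Y"
    and independent: "y \<in> Y \<Longrightarrow> y' \<in> Y \<Longrightarrow> {y, y'} \<notin> E"
    and has_private: "y \<in> Y \<Longrightarrow> \<exists>z. private_nbr E X Y y z"
begin

lemma star_edge_cases:
  assumes "{a, b} \<in> F"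
  obtains "a \<in> X" "b \<in> Y" | "a \<in> Y" "b \<in> X"
proof -
  obtain x y where xy: "x \<in> X" "y \<in> Y" "{a, b} = {x, y}" using star_edge[OF assms] by blast
  then have "a = x \<and> b = y \<or> a = y \<and> b = x" by (simp add: doubleton_eq_iff)
  then show ?thesis using xy that by blast
qed

lemma centre_unique: "y \<in> Y \<Longrightarrow> {x, y} \<in> F \<Longrightarrow> {x', y} \<in> F \<Longrightarrow> x' = x"
  using centre[of y] by blast

end

definition strong_matching :: "'a set set \<Rightarrow> 'a set set \<Rightarrow> bool" where
  "strong_matching E M \<longleftrightarrow>
     M \<subseteq> E \<and> (\<forall>f\<in>E. \<forall>m\<in>M. \<forall>m'\<in>M. f \<inter> m \<noteq> {} \<longrightarrow> f \<inter> m' \<noteq> {} \<longrightarrow> m = m')"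

lemma edge_dominating_set_iff:
  assumes "simple_graph V E"
  shows "edge_dominating_set E D \<longleftrightarrow> D \<subseteq> E \<and> (\<forall>e\<in>E. \<exists>d\<in>D. e \<inter> d \<noteq> {})"
proof -
  have ne: "e \<noteq> {}" if "e \<in> E" for e using assms that by (auto simp: simple_graph_def)
  have "(\<exists>d\<in>D. e \<inter> d \<noteq> {}) \<longleftrightarrow> e \<in> D \<or> (\<exists>d\<in>D. e \<noteq> d \<and> e \<inter> d \<noteq> {})" if "e \<in> E" for e
  proof (cases "e \<in> D")
    case True
    then have "\<exists>d\<in>D. e \<inter> d \<noteq> {}" using ne[OF that] by (intro bexI[of _ e]) simp_all
    then show ?thesis using True by simp
  next
    case False
    then show ?thesis by metis
  qed
  moreover have "(\<forall>e\<in>E. e \<in> D \<or> Q e) \<longleftrightarrow> (\<forall>e\<in>E - D. Q e)" for Q by auto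
  ultimately show ?thesis by (simp add: edge_dominating_set_def edge_adjacent_def)
qed

lemma finite_edges:
  assumes "simple_graph V E"
  shows "finite E"
proof (rule finite_subset)
  show "E \<subseteq> Pow V" "finite (Pow V)" using assms by (auto simp: simple_graph_def)
qed

text \<open>
  Weak duality: a dominating edge can meet only one edge of a strong matching.
\<close>

lemma strong_matching_card_le:
  assumes sg: "simple_graph V E" and D: "edge_dominating_set E D" and M: "strong_matching E M"
  shows "card M \<le> card D"
proof -
  have "\<forall>m\<in>M. \<exists>d\<in>D. m \<inter> d \<noteq> {}"
    using D M unfolding edge_dominating_set_iff[OF sg] strong_matching_def by blast
  then obtain h where h: "\<And>m. m \<in> M \<Longrightarrow> h m \<in> D \<and> m \<inter> h m \<noteq> {}" by metis
  have DE: "D \<subseteq> E" using D by (simp add: edge_dominating_set_def)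
  have "inj_on h M"
  proof (rule inj_onI)
    fix m m' assume "m \<in> M" "m' \<in> M" "h m = h m'"
    moreover have "h m \<inter> m \<noteq> {}" "h m \<inter> m' \<noteq> {}" "h m \<in> E"
      using calculation h[of m] h[of m'] DE by auto
    ultimately show "m = m'" using M unfolding strong_matching_def by blast
  qed
  moreover have "finite D" using DE finite_edges[OF sg] finite_subset by blast
  ultimately show ?thesis using h card_inj_on_le[of h M D] by blast
qed

text \<open>
  Some vertex \<open>p\<close> has an end vertex \<open>u\<close> as a neighbour, and all its neighbours except perhaps one, \<open>g\<close>,
  are end vertices: an end vertex of the subgraph of non-leaf edges, or any neighbour of an end vertex
  if there are no non-leaf edges. The edge \<open>{p, g}\<close> dominates everything at \<open>p\<close> and \<open>g\<close>, while \<open>{p, u}\<close>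
  is far from every edge that avoids \<open>p\<close> and \<open>g\<close>. So the induction hypothesis for the edges that avoid
  \<open>p\<close> and \<open>g\<close> gains one edge on either side. The hypothesis on subsets of \<open>E\<close> expresses acyclicity in a
  form that passes to subsets.
\<close>

lemma forest_strong_duality:
  assumes "finite E"
    and "\<And>e. e \<in> E \<Longrightarrow> card e = 2"
    and "\<And>E'. E' \<subseteq> E \<Longrightarrow> E' \<noteq> {} \<Longrightarrow> \<exists>p q. {p, q} \<in> E' \<and> (\<forall>r. {p, r} \<in> E' \<longrightarrow> r = q)"
  shows "\<exists>D M. D \<subseteq> E \<and> (\<forall>e\<in>E. \<exists>d\<in>D. e \<inter> d \<noteq> {}) \<and> strong_matching E M \<and> card D = card M"
  using assms
proof (induction "card E" arbitrary: E rule: less_induct)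
  case less
  note fin = less.prems(1) and c2 = less.prems(2) and forest = less.prems(3)
  show ?case
  proof (cases "E = {}")
    case True
    then have "strong_matching E {}" by (simp add: strong_matching_def)
    then show ?thesis using True by blast
  next
    case False
    \<comment> \<open>\<open>end_nbr p u\<close>: the vertex \<open>u\<close> has degree one, and \<open>p\<close> is its neighbour.\<close>
    define end_nbr where "end_nbr = (\<lambda>p u. \<forall>w. {u, w} \<in> E \<longleftrightarrow> w = p)"
    have endD: "{u, p} \<in> E" "\<And>w. {u, w} \<in> E \<Longrightarrow> w = p" if "end_nbr p u" for p u
      using that by (auto simp: end_nbr_def)
    have "\<exists>p g u. {p, g} \<in> E \<and> end_nbr p u \<and> (\<forall>r. {p, r} \<in> E \<longrightarrow> r = g \<or> end_nbr p r)"
    proof -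
      define N where "N = {e \<in> E. \<forall>p u. e = {p, u} \<longrightarrow> \<not> end_nbr p u}"
      have N: "end_nbr a b \<or> end_nbr b a" if "{a, b} \<in> E" "{a, b} \<notin> N" for a b
        using that unfolding N_def by (auto simp: doubleton_eq_iff)
      show ?thesis
      proof (cases "N = {}")
        case True
        obtain a b where ab: "{a, b} \<in> E" "\<forall>r. {a, r} \<in> E \<longrightarrow> r = b"
          using forest[of E] False by blast
        then have e: "end_nbr b a" unfolding end_nbr_def by blast
        have "r = a \<or> end_nbr b r" if r: "{b, r} \<in> E" for r
        proof -
          consider "end_nbr b r" | "end_nbr r b" using N[OF r] True by auto
          then show ?thesis
          proof cases
            case 2
            then have "a = r" using endD(2)[of r b a] ab(1) by (simp add: insert_commute)
            then show ?thesis by simp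
          qed simp
        qed
        then show ?thesis using ab e by (metis insert_commute)
      next
        case False
        have "N \<subseteq> E" by (auto simp: N_def)
        then obtain p q where pq: "{p, q} \<in> N" "\<forall>r. {p, r} \<in> N \<longrightarrow> r = q"
          using forest False by meson
        have pqE: "{p, q} \<in> E" using pq(1) \<open>N \<subseteq> E\<close> by blast
        have "\<forall>a b. {p, q} = {a, b} \<longrightarrow> \<not> end_nbr a b"
          using pq(1) unfolding N_def by (elim CollectE conjE)
        then have np: "\<not> end_nbr q p" by (simp add: insert_commute)
        have np': "\<not> end_nbr r p" for r
        proof
          assume "end_nbr r p"
          then have "q = r" using endD(2) pqE by blast
          then show False using \<open>end_nbr r p\<close> np by simp
        qed
        have r: "r = q \<or> end_nbr p r" if "{p, r} \<in> E" for r
          using N[OF that] np' pq(2) by blast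
        obtain u where "{p, u} \<in> E" "u \<noteq> q" using np pqE by (auto simp: end_nbr_def)
        then have "end_nbr p u" using r by blast
        then show ?thesis using pqE r by blast
      qed
    qed
    then obtain p g u where pg: "{p, g} \<in> E" and u: "end_nbr p u"
      and r: "\<And>r. {p, r} \<in> E \<Longrightarrow> r = g \<or> end_nbr p r" by blast
    note up = endD[OF u]
    define E' where "E' = {e \<in> E. p \<notin> e \<and> g \<notin> e}"
    have sub: "E' \<subseteq> E" by (auto simp: E'_def)
    moreover have "{p, g} \<notin> E'" by (simp add: E'_def)
    ultimately have less': "card E' < card E"
      using pg by (intro psubset_card_mono[OF fin]) blast
    have "\<exists>D M. D \<subseteq> E' \<and> (\<forall>e\<in>E'. \<exists>d\<in>D. e \<inter> d \<noteq> {}) \<and> strong_matching E' M \<and> card D = card M"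
    proof (rule less.hyps[OF less'])
      show "finite E'" by (rule finite_subset[OF sub fin])
      show "card e = 2" if "e \<in> E'" for e using c2 sub that by blast
      show "\<exists>p q. {p, q} \<in> G \<and> (\<forall>r. {p, r} \<in> G \<longrightarrow> r = q)" if "G \<subseteq> E'" "G \<noteq> {}" for G
        using forest[OF order_trans[OF that(1) sub] that(2)] .
    qed
    then obtain D M where D: "D \<subseteq> E'" "\<forall>e\<in>E'. \<exists>d\<in>D. e \<inter> d \<noteq> {}"
      and M: "strong_matching E' M" and eq: "card D = card M" by (elim exE conjE)
    have ME: "M \<subseteq> E'" using M by (simp add: strong_matching_def)
    have dE: "\<exists>b. f = {a, b}" if f: "f \<in> E" "a \<in> f" for f a
    proof -
      obtain x y where "f = {x, y}" using c2[OF f(1)] by (auto simp: card_2_iff)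
      then have "f = {a, x} \<or> f = {a, y}" using f(2) by blast
      then show ?thesis by blast
    qed
    \<comment> \<open>An edge at \<open>p\<close> leads to \<open>g\<close> or to an end vertex, and \<open>M\<close> avoids both.\<close>
    have no_p: "f \<inter> m = {}" if f: "f \<in> E" "p \<in> f" and m: "m \<in> M" for f m
    proof -
      obtain b where b: "f = {p, b}" using dE[OF f] ..
      have mE: "m \<in> E" "p \<notin> m" "g \<notin> m" using m ME by (auto simp: E'_def)
      have "b \<notin> m"
      proof
        assume bm: "b \<in> m"
        then have "end_nbr p b" using r[of b] f b mE by auto
        moreover obtain c where "m = {b, c}" using dE[OF mE(1) bm] by blast
        ultimately show False using endD(2)[of p b c] mE by auto
      qed
      then show ?thesis using b mE by auto
    qed
    have pu: "{p, u} \<in> E" using up by (simp add: insert_commute)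
    have hit: "p \<in> f" if f: "f \<in> E" "f \<inter> {p, u} \<noteq> {}" for f
    proof (rule ccontr)
      assume "p \<notin> f"
      then have "u \<in> f" using f(2) by blast
      then obtain b where "f = {u, b}" using dE[OF f(1)] by blast
      then show False using up(2)[of b] f(1) \<open>p \<notin> f\<close> by simp
    qed
    have "strong_matching E (insert {p, u} M)"
      unfolding strong_matching_def
    proof (intro conjI ballI impI)
      show "insert {p, u} M \<subseteq> E" by (rule insert_subsetI[OF pu order_trans[OF ME sub]])
      fix f m m' assume f: "f \<in> E" and m: "m \<in> insert {p, u} M" "m' \<in> insert {p, u} M"
        and fm: "f \<inter> m \<noteq> {}" "f \<inter> m' \<noteq> {}"
      show "m = m'"
      proof (cases "p \<in> f")
        case True
        then show ?thesis using no_p[OF f True] m fm by blast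
      next
        case False
        then have mM: "m \<in> M" "m' \<in> M" using hit[OF f] m fm \<open>p \<notin> f\<close> by (metis insertE)+
        show ?thesis
        proof (cases "g \<in> f")
          case True
          then obtain s where "f = {g, s}" using dE f by blast
          then have "s \<in> m" "s \<in> m'" using fm mM ME by (auto simp: E'_def)
          then have "m \<inter> m \<noteq> {}" "m \<inter> m' \<noteq> {}" by auto
          then show ?thesis using M mM ME unfolding strong_matching_def by blast
        next
          case False
          then have "f \<in> E'" using \<open>p \<notin> f\<close> f by (simp add: E'_def)
          then show ?thesis using M mM fm unfolding strong_matching_def by blast
        qed
      qed
    qed
    moreover have "\<forall>e\<in>E. \<exists>d\<in>insert {p, g} D. e \<inter> d \<noteq> {}"
      using D(2) by (auto simp: E'_def)
    moreover have "{p, g} \<notin> D" "{p, u} \<notin> M" "finite D" "finite M"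
      using D(1) ME fin sub by (auto simp: E'_def intro: finite_subset)
    then have "card (insert {p, g} D) = card (insert {p, u} M)" using eq by simp
    ultimately show ?thesis using D(1) sub pg by (meson insert_subset order_trans)
  qed
qed

lemma edge_domination_number_eq_card:
  assumes sg: "simple_graph V E" and D: "edge_dominating_set E D" and M: "strong_matching E M"
    and eq: "card D = card M"
  shows "edge_domination_number E = enat (card M)"
  unfolding edge_domination_number_def
proof (rule antisym)
  show "(INF F\<in>{F. edge_dominating_set E F}. enat (card F)) \<le> enat (card M)"
    using D eq by (intro INF_lower2[of D]) auto
  show "enat (card M) \<le> (INF F\<in>{F. edge_dominating_set E F}. enat (card F))"
    using strong_matching_card_le[OF sg _ M] by (intro INF_greatest) auto
qed

lemma total_edge_domination_number_attained:
  assumes "total_edge_domination_number E = enat n"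
  obtains F where "total_edge_dominating_set E F" "card F = n"
proof -
  let ?A = "(\<lambda>F. enat (card F)) ` {F. total_edge_dominating_set E F}"
  have "?A \<noteq> {}"
  proof
    assume "?A = {}"
    then have "total_edge_domination_number E = \<infinity>"
      unfolding total_edge_domination_number_def by (simp only: Inf_empty top_enat_def)
    then show False using assms by simp
  qed
  then obtain k where "k \<in> ?A" by blast
  then have "Inf ?A \<in> ?A" by (rule wellorder_InfI)
  then show ?thesis using that assms unfolding total_edge_domination_number_def by auto
qed

text \<open>
  Choosing a private neighbour for each \<open>y \<in> Y\<close> yields a strong matching with as many edges as \<open>F\<close>, and
  \<open>F\<close> is a total edge dominating set because every star has a second ray.
\<close>

lemma star_cover_imp_equal:
  assumes sg: "simple_graph V E" and SC: "star_cover E F X Y"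
  shows "total_edge_domination_number E = edge_domination_number E"
proof -
  interpret star_cover E F X Y by (rule SC)
  obtain z where z: "\<And>y. y \<in> Y \<Longrightarrow> private_nbr E X Y y (z y)" using has_private by metis
  obtain c where c: "\<And>y. y \<in> Y \<Longrightarrow> {c y, y} \<in> F" using centre by metis
  have cu: "x = c y" if "y \<in> Y" "{x, y} \<in> F" for x y using centre_unique[OF that(1) c[OF that(1)] that(2)] .
  have cX: "c y \<in> X" if "y \<in> Y" for y
    using star_edge_cases[OF c[OF that]] that disjoint by blast
  have finE: "finite E" by (rule finite_edges[OF sg])
  define M where "M = (\<lambda>y. {y, z y}) ` Y"
  have zP: "z y \<notin> X" "z y \<notin> Y" "{y, z y} \<in> E" if "y \<in> Y" for y
    using z[OF that] by (auto simp: private_nbr_def)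
  have zu: "y' = y" if "y \<in> Y" "y' \<in> Y" "{y', z y} \<in> E" for y y'
    using z[OF that(1)] that by (auto simp: private_nbr_def)
  have "strong_matching E M"
    unfolding strong_matching_def
  proof (intro conjI ballI impI)
    show "M \<subseteq> E" unfolding M_def by (rule image_subsetI) (rule zP(3))
    fix f m m' assume f: "f \<in> E" and m: "m \<in> M" "m' \<in> M" and fm: "f \<inter> m \<noteq> {}" "f \<inter> m' \<noteq> {}"
    obtain y y' where y: "y \<in> Y" "m = {y, z y}" "y' \<in> Y" "m' = {y', z y'}"
      using m by (auto simp: M_def)
    obtain a where a: "a \<in> f" "a \<in> m" using fm by auto
    obtain b where b: "b \<in> f" "b \<in> m'" using fm by auto
    have "y = y'"
    proof (cases "a = b")
      case True
      then show ?thesis using a b y zP zu by (metis insertE singletonD)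
    next
      case False
      obtain d where "f = {a, d}" using simple_graph_edgeE[OF sg f a(1)] by blast
      then have ab: "{a, b} \<in> E" "{b, a} \<in> E" using b f False by (auto simp: insert_commute)
      have "\<not> (a = z y \<and> b = z y')" using cover[OF ab(1)] zP(1,2) y(1,3) by blast
      then show ?thesis using a b y ab independent zu by (metis insertE singletonD)
    qed
    then show "m = m'" using y by simp
  qed
  moreover have "card F = card M"
  proof -
    have "inj_on (\<lambda>y. {c y, y}) Y"
    proof (rule inj_onI)
      fix y y' assume y: "y \<in> Y" "y' \<in> Y" and "{c y, y} = {c y', y'}"
      then have "y = y' \<or> y = c y'" by blast
      moreover have "y \<noteq> c y'" using cX[OF y(2)] y(1) disjoint by blast
      ultimately show "y = y'" by simp
    qed
    moreover have "F = (\<lambda>y. {c y, y}) ` Y"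
    proof (intro equalityI subsetI)
      fix f assume f: "f \<in> F"
      then obtain x y where xy: "y \<in> Y" "f = {x, y}" using star_edge by blast
      then have "x = c y" using cu f by simp
      then show "f \<in> (\<lambda>y. {c y, y}) ` Y" using xy by simp
    next
      fix f assume "f \<in> (\<lambda>y. {c y, y}) ` Y"
      then show "f \<in> F" using c by (elim imageE) simp
    qed
    ultimately have "card F = card Y" by (simp add: card_image)
    moreover have "inj_on (\<lambda>y. {y, z y}) Y"
    proof (rule inj_onI)
      fix y y' assume y: "y \<in> Y" "y' \<in> Y" and "{y, z y} = {y', z y'}"
      then have "y = y' \<or> y = z y'" by blast
      then show "y = y'" using zP(2)[OF y(2)] y(1) by blast
    qed
    then have "card M = card Y" by (simp add: M_def card_image)
    ultimately show ?thesis by simp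
  qed
  moreover have "total_edge_dominating_set E F"
    unfolding total_edge_dominating_set_def edge_adjacent_def
  proof (intro conjI ballI stars_subset)
    fix e assume e: "e \<in> E"
    show "\<exists>f\<in>F. e \<noteq> f \<and> e \<inter> f \<noteq> {}"
    proof (cases "e \<in> F")
      case True
      then obtain x y where xy: "x \<in> X" "e = {x, y}" using star_edge by blast
      obtain w where w: "{x, w} \<in> F" "w \<noteq> y" using rays[OF xy(1)] by metis
      then have "e \<noteq> {x, w}" using xy(2) by (auto simp: doubleton_eq_iff)
      moreover have "e \<inter> {x, w} \<noteq> {}" using xy(2) by simp
      ultimately show ?thesis using w(1) by (intro bexI[of _ "{x, w}"] conjI)
    next
      case False
      obtain a0 b0 where ab: "e = {a0, b0}"
        using e sg unfolding simple_graph_def by (auto simp: card_2_iff)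
      then obtain a where a: "a \<in> e" "a \<in> X \<or> a \<in> Y" using cover[of a0 b0] e by blast
      have "\<exists>b. {a, b} \<in> F" using a(2) rays[of a] c[of a] by (auto simp: insert_commute)
      then obtain b where b: "{a, b} \<in> F" ..
      then have "e \<noteq> {a, b}" using False by blast
      moreover have "e \<inter> {a, b} \<noteq> {}" using a(1) by blast
      ultimately show ?thesis using b by (intro bexI[of _ "{a, b}"] conjI)
    qed
  qed
  moreover have "edge_dominating_set E G" if "total_edge_dominating_set E G" for G
    using that unfolding edge_dominating_set_def total_edge_dominating_set_def by blast
  ultimately have M: "strong_matching E M" and cardF: "card F = card M"
    and T: "total_edge_dominating_set E F"
    and TD: "\<And>G. total_edge_dominating_set E G \<Longrightarrow> edge_dominating_set E G" .
  have g: "edge_domination_number E = enat (card F)"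
    using edge_domination_number_eq_card[OF sg TD[OF T] M cardF] cardF by simp
  have low: "card F \<le> card G" if "total_edge_dominating_set E G" for G
    using strong_matching_card_le[OF sg TD[OF that] M] cardF by simp
  have "total_edge_domination_number E = enat (card F)"
    unfolding total_edge_domination_number_def
  proof (rule antisym)
    show "(INF F\<in>{F. total_edge_dominating_set E F}. enat (card F)) \<le> enat (card F)"
      using T by (intro INF_lower) auto
    show "enat (card F) \<le> (INF F\<in>{F. total_edge_dominating_set E F}. enat (card F))"
      using low by (intro INF_greatest) auto
  qed
  then show ?thesis using g by simp
qed

text \<open>
  Equality of the sizes makes the map that sends \<open>m \<in> M\<close> to an adjacent edge of \<open>F\<close> a bijection, which
  determines how \<open>F\<close> and \<open>M\<close> lie to each other: \<open>Y\<close> consists of the vertices common to both, \<open>X\<close> of the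
  other vertices of \<open>F\<close>.
\<close>

lemma tight_imp_star_cover:
  assumes sg: "simple_graph V E" and T: "total_edge_dominating_set E F"
    and M: "strong_matching E M" and eq: "card F = card M"
  shows "\<exists>X Y. star_cover E F X Y"
proof -
  have FE: "F \<subseteq> E" and dom: "\<And>e. e \<in> E \<Longrightarrow> \<exists>f\<in>F. e \<noteq> f \<and> e \<inter> f \<noteq> {}"
    using T by (auto simp: total_edge_dominating_set_def edge_adjacent_def)
  have ME: "M \<subseteq> E" and Mu: "\<And>f m m'. f \<in> E \<Longrightarrow> m \<in> M \<Longrightarrow> m' \<in> M \<Longrightarrow> f \<inter> m \<noteq> {} \<Longrightarrow> f \<inter> m' \<noteq> {} \<Longrightarrow> m = m'"
    using M unfolding strong_matching_def by blast+
  have fin: "finite F" "finite M" using finite_edges[OF sg] FE ME finite_subset by blast+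
  have "\<forall>m\<in>M. \<exists>f\<in>F. m \<noteq> f \<and> m \<inter> f \<noteq> {}" using dom ME by blast
  then obtain h where h: "\<And>m. m \<in> M \<Longrightarrow> h m \<in> F" "\<And>m. m \<in> M \<Longrightarrow> h m \<noteq> m"
    "\<And>m. m \<in> M \<Longrightarrow> h m \<inter> m \<noteq> {}" by (metis inf_commute)
  have "inj_on h M"
  proof (rule inj_onI)
    fix m m' assume "m \<in> M" "m' \<in> M" "h m = h m'"
    then show "m = m'" using Mu[of "h m" m m'] h[of m] h(3)[of m'] FE by auto
  qed
  then have "h ` M = F"
    using h(1) fin eq by (intro card_subset_eq) (auto simp: card_image)
  then have Fm: "\<exists>m\<in>M. f = h m" if "f \<in> F" for f using that by blast
  have hu: "f = h m" if fm: "f \<in> F" "m \<in> M" "f \<inter> m \<noteq> {}" for f m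
  proof -
    obtain m' where m': "m' \<in> M" "f = h m'" using Fm[OF fm(1)] by blast
    then have "m' = m" using Mu[of f m' m] h(3)[OF m'(1)] fm FE by blast
    then show ?thesis using m' by simp
  qed
  define Y where "Y = {y. \<exists>f\<in>F. \<exists>m\<in>M. y \<in> f \<and> y \<in> m}"
  define X where "X = \<Union>F - Y"
  have XY: "X \<union> Y = \<Union>F" by (auto simp: X_def Y_def)
  have sub_eq: "m = m'" if "m \<in> E" "m' \<in> E" "a \<in> m" "b \<in> m" "a \<in> m'" "b \<in> m'" "a \<noteq> b" for m m' a b
    using that by (metis simple_graph_edgeE[OF sg] insertE singletonD insert_commute)
  have MuY: "m = m'" if "y \<in> m" "y \<in> m'" "m \<in> M" "m' \<in> M" for y m m'
    using Mu[of m m m'] that ME by auto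
  have Fe: "\<exists>x\<in>X. \<exists>y\<in>Y. f = {x, y}" if f: "f \<in> F" for f
  proof -
    obtain m where m: "m \<in> M" "f = h m" using Fm[OF f] by (rule bexE)
    obtain y where y: "y \<in> f" "y \<in> m" using h(3)[OF m(1)] m(2) by auto
    then obtain x where x: "f = {y, x}" using simple_graph_edgeE[OF sg] f FE by blast
    have xy: "x \<noteq> y" using simple_graph_edge(1)[OF sg, of y x] f FE x by auto
    have "x \<notin> m" using sub_eq[of f m x y] x y m f FE ME xy h(2) by auto
    have "x \<notin> Y"
    proof
      assume "x \<in> Y"
      then obtain m' where "m' \<in> M" "x \<in> m'" by (auto simp: Y_def)
      then have "m = m'" using Mu[of f m m'] x y m f FE by auto
      then show False using \<open>x \<in> m'\<close> \<open>x \<notin> m\<close> by simp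
    qed
    then have "x \<in> X" using f x by (auto simp: X_def)
    moreover have "y \<in> Y" using y f m by (auto simp: Y_def)
    ultimately show ?thesis using x by (metis insert_commute)
  qed
  have Yu: "f = f'" if "y \<in> Y" "f \<in> F" "f' \<in> F" "y \<in> f" "y \<in> f'" for y f f'
    using that hu unfolding Y_def by (smt (verit) IntI empty_iff mem_Collect_eq)
  have priv: "\<exists>z. private_nbr E X Y y z" if y: "y \<in> Y" for y
  proof -
    obtain f m where fm: "f \<in> F" "m \<in> M" "y \<in> f" "y \<in> m" using y by (auto simp: Y_def)
    have mE: "m \<in> E" using fm ME by auto
    obtain z where z: "m = {y, z}" using simple_graph_edgeE[OF sg mE fm(4)] by blast
    have yz: "y \<noteq> z" using simple_graph_edge(1)[OF sg] mE z by blast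
    have f: "f = h m" using hu fm by blast
    have zF: "z \<notin> \<Union>F"
    proof
      assume "z \<in> \<Union>F"
      then obtain f' where f': "f' \<in> F" "z \<in> f'" by auto
      then have "f' = f" using hu[of f' m] fm z f by auto
      then show False using sub_eq[of f m y z] fm f' z yz mE FE f h(2) by auto
    qed
    have "y' = y" if y': "y' \<in> Y" "{y', z} \<in> E" for y'
    proof -
      obtain m' where m': "m' \<in> M" "y' \<in> m'" using y' by (auto simp: Y_def)
      then have "m = m'" using Mu[OF y'(2), of m m'] fm z by auto
      then show ?thesis using m' z y' zF XY by auto
    qed
    then show ?thesis using zF XY z mE unfolding private_nbr_def by blast
  qed
  have ind: "{y, y'} \<notin> E" if y: "y \<in> Y" "y' \<in> Y" for y y'
  proof
    assume e: "{y, y'} \<in> E"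
    have ne: "y \<noteq> y'" by (rule simple_graph_edge(1)[OF sg e])
    obtain f m where fm: "f \<in> F" "m \<in> M" "y \<in> f" "y \<in> m" using y by (auto simp: Y_def)
    obtain f' m' where fm': "f' \<in> F" "m' \<in> M" "y' \<in> f'" "y' \<in> m'" using y by (auto simp: Y_def)
    have "m = m'" using Mu[OF e, of m m'] fm fm' by auto
    then have "f = h m" "f' = h m" using hu fm fm' by auto
    then show False using sub_eq[of f m y y'] fm fm' \<open>m = m'\<close> ne FE ME h(2) by auto
  qed
  have "star_cover E F X Y"
  proof
    show "X \<inter> Y = {}" by (auto simp: X_def)
    show "F \<subseteq> E" by (rule FE)
    show "\<exists>x\<in>X. \<exists>y\<in>Y. f = {x, y}" if "f \<in> F" for f using Fe that .
    show "\<exists>!x. {x, y} \<in> F" if y: "y \<in> Y" for y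
    proof -
      obtain f where f: "f \<in> F" "y \<in> f" using y by (auto simp: Y_def)
      obtain x where x: "f = {y, x}" by (rule simple_graph_edgeE[OF sg subsetD[OF FE f(1)] f(2)])
      show ?thesis
      proof (rule ex1I)
        show "{x, y} \<in> F" using f x by (simp add: insert_commute)
        fix x' assume "{x', y} \<in> F"
        then have "{x', y} = f" using Yu[OF y _ f(1) _ f(2)] by blast
        then show "x' = x" using x by (auto simp: doubleton_eq_iff)
      qed
    qed
    show "\<exists>y y'. y \<noteq> y' \<and> {x, y} \<in> F \<and> {x, y'} \<in> F" if x: "x \<in> X" for x
    proof -
      obtain f where f: "f \<in> F" "x \<in> f" using x by (auto simp: X_def)
      have "x \<notin> Y" using x by (simp add: X_def)
      then obtain y where y: "f = {x, y}" "y \<in> Y" using Fe[OF f(1)] f(2) by blast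
      obtain f' where f': "f' \<in> F" "f \<noteq> f'" "f \<inter> f' \<noteq> {}" using dom[of f] f FE by blast
      then have "y \<notin> f'" using Yu[of y f f'] f y by blast
      then have xf': "x \<in> f'" using f' y by blast
      obtain y' where "f' = {x, y'}" by (rule simple_graph_edgeE[OF sg subsetD[OF FE f'(1)] xf'])
      then show ?thesis using f f' y by blast
    qed
    show "a \<in> X \<or> a \<in> Y \<or> b \<in> X \<or> b \<in> Y" if "{a, b} \<in> E" for a b using dom[OF that] XY by blast
    show "{y, y'} \<notin> E" if "y \<in> Y" "y' \<in> Y" for y y' using ind that .
    show "\<exists>z. private_nbr E X Y y z" if "y \<in> Y" for y using priv that .
  qed
  then show ?thesis by blast
qed

lemma tree_equal_iff_star_cover:
  assumes T: "is_tree V E"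
  shows "total_edge_domination_number E = edge_domination_number E \<longleftrightarrow> (\<exists>F X Y. star_cover E F X Y)"
proof -
  have sg: "simple_graph V E" using T by (simp add: is_tree_def)
  have "\<exists>F X Y. star_cover E F X Y"
    if eq: "total_edge_domination_number E = edge_domination_number E"
  proof -
  have "\<exists>D M. D \<subseteq> E \<and> (\<forall>e\<in>E. \<exists>d\<in>D. e \<inter> d \<noteq> {}) \<and> strong_matching E M \<and> card D = card M"
  proof (rule forest_strong_duality)
    show "finite E" by (rule finite_edges[OF sg])
    show "card e = 2" if "e \<in> E" for e using sg that by (auto simp: simple_graph_def)
    show "\<exists>p q. {p, q} \<in> E' \<and> (\<forall>r. {p, r} \<in> E' \<longrightarrow> r = q)" if "E' \<subseteq> E" "E' \<noteq> {}" for E'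
      using tree_subset_end_vertex[OF T that] by metis
  qed
  then obtain D M where D: "edge_dominating_set E D" and M: "strong_matching E M" and "card D = card M"
    unfolding edge_dominating_set_iff[OF sg] by blast
  then have "total_edge_domination_number E = enat (card M)"
    using eq edge_domination_number_eq_card[OF sg] by simp
  then obtain F where "total_edge_dominating_set E F" "card F = card M"
    by (rule total_edge_domination_number_attained)
  then show ?thesis using tight_imp_star_cover[OF sg _ M] by blast
  qed
  then show ?thesis using star_cover_imp_equal[OF sg] by blast
qed

section \<open>The operations preserve star covers\<close>

locale graph_star_cover = star_cover +
  fixes V :: "'a set"
  assumes simple: "simple_graph V E"
begin

lemma stars_in: "X \<subseteq> V" "Y \<subseteq> V"
proof -
  show "X \<subseteq> V"
  proof
    fix x assume "x \<in> X"
    then obtain y where "{x, y} \<in> E" using rays stars_subset by blast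
    then show "x \<in> V" using simple_graph_edge[OF simple] by blast
  qed
  show "Y \<subseteq> V"
  proof
    fix y assume "y \<in> Y"
    then obtain x where "{x, y} \<in> E" using centre stars_subset by blast
    then show "y \<in> V" using simple_graph_edge[OF simple] by blast
  qed
qed

lemma not_leaf: 
  assumes "v \<in> X \<union> Y"
  shows "\<not> is_leaf E v"
proof -
  have "\<exists>a b. a \<noteq> b \<and> {v, a} \<in> E \<and> {v, b} \<in> E"
  proof (cases "v \<in> X")
    case True
    then show ?thesis using rays[of v] stars_subset by blast
  next
    case False
    then have "v \<in> Y" using assms by blast
    then obtain x z where xz: "{x, v} \<in> F" "private_nbr E X Y v z" using centre has_private by meson
    then have "x \<in> X" using star_edge_cases[OF xz(1)] \<open>v \<in> Y\<close> disjoint by blast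
    then have "x \<noteq> z" "{v, z} \<in> E" using xz(2) by (auto simp: private_nbr_def)
    moreover have "{v, x} \<in> E" using xz(1) stars_subset by (metis insert_commute subsetD)
    ultimately show ?thesis by blast
  qed
  then show ?thesis unfolding is_leaf_iff[OF simple] by metis
qed

lemma fresh_not_edge: "u \<notin> V \<Longrightarrow> {u, w} \<notin> E" "u \<notin> V \<Longrightarrow> {w, u} \<notin> E"
  using simple_graph_edge[OF simple] by blast+

end

text \<open>
  The label of an edge outside \<open>F\<close> that joins \<open>X\<close> to \<open>Y\<close> is left open between \<open>L1\<close> and \<open>L2\<close>: the third
  operation labels such an edge \<open>L1\<close> and the fifth labels it \<open>L2\<close>.
\<close>

locale labelled_star_cover = graph_star_cover +
  fixes l :: "'a labelling"
  assumes label_S: "e \<in> E \<Longrightarrow> l e = S \<longleftrightarrow> e \<in> F"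
    and label: "e \<in> E \<Longrightarrow> e \<notin> F \<Longrightarrow> e \<inter> X = {} \<or> e \<inter> Y = {} \<Longrightarrow>
      l e = (if e \<inter> Y = {} then L2 else L1)"
begin

lemma label_L1: "e \<in> E \<Longrightarrow> e \<notin> F \<Longrightarrow> e \<inter> X = {} \<Longrightarrow> e \<inter> Y \<noteq> {} \<Longrightarrow> l e = L1"
  using label[of e] by presburger

lemma label_L2: "e \<in> E \<Longrightarrow> e \<notin> F \<Longrightarrow> e \<inter> Y = {} \<Longrightarrow> l e = L2"
  using label[of e] by presburger

lemma S_edges_at: "{e \<in> incident_edges E v. l e = S} = {f \<in> F. v \<in> f}"
proof -
  have "e \<in> incident_edges E v \<and> l e = S \<longleftrightarrow> e \<in> F \<and> v \<in> e" for e
    using label_S[of e] stars_subset unfolding incident_edges_def by auto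
  then show ?thesis by simp
qed

lemma card_S_edges_ray:
  assumes "v \<in> Y"
  shows "card {f \<in> F. v \<in> f} = 1"
proof -
  obtain x where x: "{x, v} \<in> F" using centre[OF assms] by blast
  have "f = {x, v}" if f: "f \<in> F" "v \<in> f" for f
  proof -
    obtain b where b: "f = {v, b}" by (rule simple_graph_edgeE[OF simple subsetD[OF stars_subset f(1)] f(2)])
    then have "{b, v} \<in> F" using f by (simp add: insert_commute)
    from centre_unique[OF assms x this] show ?thesis using b by (simp add: insert_commute)
  qed
  then have "{f \<in> F. v \<in> f} = {{x, v}}" using x by blast
  then show ?thesis by simp
qed

lemma card_S_edges_centre:
  assumes "v \<in> X"
  shows "2 \<le> card {f \<in> F. v \<in> f}"
proof -
  obtain y y' where y: "y \<noteq> y'" "{v, y} \<in> F" "{v, y'} \<in> F" using rays[OF assms] by blast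
  then have "{v, y} \<noteq> {v, y'}" by (auto simp: doubleton_eq_iff)
  then have "card {{v, y}, {v, y'}} = 2" by simp
  moreover have "finite {f \<in> F. v \<in> f}"
    using finite_edges[OF simple] stars_subset finite_subset by fastforce
  ultimately show ?thesis using card_mono[of "{f \<in> F. v \<in> f}" "{{v, y}, {v, y'}}"] y by simp
qed

lemma card_S_edges_other:
  assumes "v \<notin> X" "v \<notin> Y"
  shows "card {f \<in> F. v \<in> f} = 0"
proof -
  have "v \<notin> f" if "f \<in> F" for f using star_edge[OF that] assms by blast
  then have "{f \<in> F. v \<in> f} = {}" by blast
  then show ?thesis by (simp only: card.empty)
qed

lemma set_A1_eq: "set_A1 V E l = Y"
proof (rule set_eqI)
  fix v
  show "v \<in> set_A1 V E l \<longleftrightarrow> v \<in> Y"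
    using card_S_edges_ray[of v] card_S_edges_centre[of v] card_S_edges_other[of v] stars_in
    unfolding set_A1_def S_edges_at by force
qed

lemma set_A2_eq: "set_A2 V E l = X"
proof (rule set_eqI)
  fix v
  show "v \<in> set_A2 V E l \<longleftrightarrow> v \<in> X"
    using card_S_edges_ray[of v] card_S_edges_centre[of v] card_S_edges_other[of v] stars_in
    unfolding set_A2_def S_edges_at by force
qed

lemma set_B_iff:
  "v \<in> set_B V E l \<longleftrightarrow> v \<in> V \<and> v \<notin> X \<and> v \<notin> Y \<and> (\<forall>y\<in>Y. {v, y} \<notin> E)"
proof
  assume v: "v \<in> set_B V E l"
  have L2: "l e = L2" if "e \<in> E" "v \<in> e" for e
    using v that by (auto simp: set_B_def incident_edges_def)
  have vX: "v \<notin> X"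
  proof
    assume "v \<in> X"
    then obtain y where "{v, y} \<in> F" using rays by blast
    then show False using L2[of "{v, y}"] label_S[of "{v, y}"] stars_subset by auto
  qed
  moreover have "v \<notin> Y"
  proof
    assume "v \<in> Y"
    then obtain x where "{x, v} \<in> F" using centre by blast
    then show False using L2[of "{x, v}"] label_S[of "{x, v}"] stars_subset by auto
  qed
  moreover have "{v, y} \<notin> E" if "y \<in> Y" for y
  proof
    assume e: "{v, y} \<in> E"
    have "{v, y} \<inter> X = {}" "{v, y} \<inter> Y \<noteq> {}" using vX that disjoint by blast+
    moreover have lL: "l {v, y} = L2" "{v, y} \<notin> F" using L2[OF e] label_S[OF e] by auto
    ultimately have "l {v, y} = L1" using label_L1[OF e] by blast
    then show False using lL by simp
  qed
  moreover have "v \<in> V" using v by (simp add: set_B_def)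
  ultimately show "v \<in> V \<and> v \<notin> X \<and> v \<notin> Y \<and> (\<forall>y\<in>Y. {v, y} \<notin> E)" by blast
next
  assume v: "v \<in> V \<and> v \<notin> X \<and> v \<notin> Y \<and> (\<forall>y\<in>Y. {v, y} \<notin> E)"
  have "l e = L2" if e: "e \<in> E" "v \<in> e" for e
  proof -
    obtain b where b: "e = {v, b}" by (rule simple_graph_edgeE[OF simple e])
    have "e \<notin> F" using star_edge[of e] e v by blast
    moreover have "b \<notin> Y" using v b e by blast
    moreover have "e \<inter> Y = {}" using v b \<open>b \<notin> Y\<close> by blast
    ultimately show ?thesis using label[OF e(1)] by simp
  qed
  then show "v \<in> set_B V E l" using v by (simp add: set_B_def incident_edges_def)
qed

lemma set_C_iff: "v \<in> set_C V E l \<longleftrightarrow> v \<in> V \<and> v \<notin> X \<and> v \<notin> Y \<and> (\<exists>y\<in>Y. {v, y} \<in> E)"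
  unfolding set_C_def using set_A1_eq set_A2_eq set_B_iff[of v] by blast

text \<open>
  The common part of all operations: \<open>E2\<close> are the new edges, each with an end among the new vertices
  \<open>U\<close>, and \<open>F2\<close>, \<open>X2\<close>, \<open>Y2\<close> are the additions to the star cover. Everything concerns the new edges
  only, except \<open>old\<close>: the old members of \<open>Y\<close> must keep a private neighbour.
\<close>

lemma extend:
  assumes U: "finite U" "U \<inter> V = {}"
    and E2: "\<forall>e\<in>E2. card e = 2 \<and> e \<subseteq> V \<union> U \<and> e \<inter> U \<noteq> {}"
    and sub2: "F2 \<subseteq> E2" "X2 \<subseteq> U" "Y2 \<subseteq> U" "X2 \<inter> Y2 = {}"
    and star2: "\<forall>f\<in>F2. \<exists>x\<in>X \<union> X2. \<exists>y\<in>Y2. f = {x, y}"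
    and centre2: "\<forall>y\<in>Y2. \<exists>x. {x, y} \<in> F2 \<and> (\<forall>f\<in>F2. y \<in> f \<longrightarrow> f = {x, y})"
    and rays2: "\<forall>x\<in>X2. \<exists>y y'. y \<noteq> y' \<and> {x, y} \<in> F2 \<and> {x, y'} \<in> F2"
    and cover2: "\<forall>e\<in>E2. e \<inter> (X \<union> X2 \<union> Y \<union> Y2) \<noteq> {}"
    and indep2: "\<forall>e\<in>E2. \<not> e \<subseteq> Y \<union> Y2"
    and private2: "\<forall>y\<in>Y2. \<exists>z. z \<notin> X \<union> X2 \<union> Y \<union> Y2 \<and> {y, z} \<in> E2 \<and>
      (z \<in> V \<longrightarrow> (\<forall>y'\<in>Y. {z, y'} \<notin> E)) \<and> (\<forall>e\<in>E2. z \<in> e \<longrightarrow> e \<inter> (Y \<union> Y2) \<subseteq> {y})"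
    and old: "\<forall>y\<in>Y. \<exists>z. private_nbr E X Y y z \<and> (\<forall>e\<in>E2. z \<in> e \<longrightarrow> e \<inter> Y2 = {})"
    and lab: "\<forall>e\<in>E. l' e = l e"
      "\<forall>e\<in>E2. (l' e = S \<longleftrightarrow> e \<in> F2) \<and> (e \<notin> F2 \<longrightarrow> e \<inter> (X \<union> X2) = {} \<or> e \<inter> (Y \<union> Y2) = {} \<longrightarrow>
        l' e = (if e \<inter> (Y \<union> Y2) = {} then L2 else L1))"
  shows "labelled_star_cover (E \<union> E2) (F \<union> F2) (X \<union> X2) (Y \<union> Y2) (V \<union> U) l'"
proof
  have EV: "e \<subseteq> V" if "e \<in> E" for e using simple that by (simp add: simple_graph_def)
  have FV: "f \<subseteq> V" if "f \<in> F" for f using EV stars_subset that by blast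
  have old_new: "e \<notin> E2" if "e \<in> E" for e
    using E2 EV[OF that] U(2) by blast
  show "simple_graph (V \<union> U) (E \<union> E2)"
    using simple U(1) E2 unfolding simple_graph_def by blast
  show "(X \<union> X2) \<inter> (Y \<union> Y2) = {}" using disjoint stars_in sub2 U(2) by blast
  show "F \<union> F2 \<subseteq> E \<union> E2" using stars_subset sub2(1) by blast
  show "\<exists>x\<in>X \<union> X2. \<exists>y\<in>Y \<union> Y2. f = {x, y}" if "f \<in> F \<union> F2" for f
  proof (cases "f \<in> F")
    case True
    then show ?thesis using star_edge[OF True] by (metis UnI1)
  next
    case False
    then have "f \<in> F2" using that by simp
    then obtain x y where "x \<in> X \<union> X2" "y \<in> Y2" "f = {x, y}" using star2 by blast
    then show ?thesis by (metis UnI2)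
  qed
  show "\<exists>!x. {x, y} \<in> F \<union> F2" if y: "y \<in> Y \<union> Y2" for y
  proof (cases "y \<in> Y")
    case True
    then obtain x where x: "{x, y} \<in> F" using centre by blast
    have "{x', y} \<notin> F2" for x'
    proof
      assume "{x', y} \<in> F2"
      then obtain a b where "a \<in> X \<union> X2" "b \<in> Y2" "{x', y} = {a, b}" using star2 by blast
      then have "y \<in> X \<union> X2 \<union> Y2" "y = b \<or> y = a" by (auto simp: doubleton_eq_iff)
      then show False using True disjoint stars_in sub2 U(2) by blast
    qed
    then show ?thesis using x centre_unique[OF True x] by blast
  next
    case False
    then have yY2: "y \<in> Y2" using y by blast
    then obtain x where x: "{x, y} \<in> F2" "\<forall>f\<in>F2. y \<in> f \<longrightarrow> f = {x, y}" using centre2 by blast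
    have "{x', y} \<notin> F" for x' using FV[of "{x', y}"] yY2 sub2 U(2) by blast
    moreover have "x' = x" if "{x', y} \<in> F2" for x'
    proof -
      have "{x', y} = {x, y}" using x(2) that by blast
      then show ?thesis by (auto simp: doubleton_eq_iff)
    qed
    ultimately show ?thesis using x(1) by blast
  qed
  show "\<exists>y y'. y \<noteq> y' \<and> {x, y} \<in> F \<union> F2 \<and> {x, y'} \<in> F \<union> F2" if "x \<in> X \<union> X2" for x
  proof (cases "x \<in> X")
    case True
    then show ?thesis using rays[OF True] by blast
  next
    case False
    then have "x \<in> X2" using that by blast
    then show ?thesis using rays2 by blast
  qed
  show "a \<in> X \<union> X2 \<or> a \<in> Y \<union> Y2 \<or> b \<in> X \<union> X2 \<or> b \<in> Y \<union> Y2" if "{a, b} \<in> E \<union> E2" for a b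
  proof (cases "{a, b} \<in> E")
    case True
    then show ?thesis using cover[OF True] by blast
  next
    case False
    then have "{a, b} \<in> E2" using that by blast
    then have "{a, b} \<inter> (X \<union> X2 \<union> Y \<union> Y2) \<noteq> {}" using cover2 by blast
    then show ?thesis by blast
  qed
  show "{y, y'} \<notin> E \<union> E2" if y: "y \<in> Y \<union> Y2" "y' \<in> Y \<union> Y2" for y y'
  proof
    assume "{y, y'} \<in> E \<union> E2"
    moreover have "{y, y'} \<notin> E2"
    proof
      assume "{y, y'} \<in> E2"
      from bspec[OF indep2 this] show False using y by blast
    qed
    ultimately have e: "{y, y'} \<in> E" by blast
    then have "y \<in> V" "y' \<in> V" using EV by blast+
    then have "y \<in> Y" "y' \<in> Y" using y sub2 U(2) by blast+
    then show False using independent e by blast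
  qed
  show "\<exists>z. private_nbr (E \<union> E2) (X \<union> X2) (Y \<union> Y2) y z" if y: "y \<in> Y \<union> Y2" for y
  proof (cases "y \<in> Y")
    case True
    then obtain z where z: "private_nbr E X Y y z" "\<forall>e\<in>E2. z \<in> e \<longrightarrow> e \<inter> Y2 = {}" using old by blast
    then have yz: "{y, z} \<in> E" "z \<notin> X \<union> Y" and u: "\<forall>y'\<in>Y. {y', z} \<in> E \<longrightarrow> y' = y"
      by (auto simp: private_nbr_def)
    have zV: "z \<in> V" using EV[OF yz(1)] by blast
    then have "z \<notin> X \<union> X2 \<union> (Y \<union> Y2)" using yz(2) sub2 U(2) by blast
    moreover have "y' = y" if y': "y' \<in> Y \<union> Y2" "{y', z} \<in> E \<union> E2" for y'
    proof (cases "y' \<in> Y")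
      case True
      then have "{y', z} \<subseteq> V" using zV stars_in by blast
      moreover have "{y', z} \<inter> U \<noteq> {}" if "{y', z} \<in> E2" using bspec[OF E2 that] by simp
      ultimately have "{y', z} \<notin> E2" using U(2) by blast
      then show ?thesis using u True y' by blast
    next
      case False
      then have "y' \<in> Y2" using y' by blast
      then have "{y', z} \<notin> E" using EV[of "{y', z}"] sub2 U(2) by blast
      moreover have "{y', z} \<notin> E2" using z(2) \<open>y' \<in> Y2\<close> by blast
      ultimately show ?thesis using y'(2) by blast
    qed
    ultimately show ?thesis using yz(1) unfolding private_nbr_def by blast
  next
    case False
    then have yY2: "y \<in> Y2" using y by blast
    then obtain z where z: "z \<notin> X \<union> X2 \<union> Y \<union> Y2" "{y, z} \<in> E2"
      "z \<in> V \<longrightarrow> (\<forall>y'\<in>Y. {z, y'} \<notin> E)" and zu: "\<forall>e\<in>E2. z \<in> e \<longrightarrow> e \<inter> (Y \<union> Y2) \<subseteq> {y}"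
      using private2 by meson
    have "y' = y" if y': "y' \<in> Y \<union> Y2" "{y', z} \<in> E \<union> E2" for y'
    proof (cases "{y', z} \<in> E")
      case True
      then have "y' \<in> V" "z \<in> V" using EV by blast+
      then have "y' \<in> Y" using y' sub2 U(2) by blast
      moreover have "{z, y'} \<in> E" using True by (simp add: insert_commute)
      ultimately show ?thesis using z(3) \<open>z \<in> V\<close> by blast
    next
      case False
      then have "{y', z} \<in> E2" using y' by blast
      then have "{y', z} \<inter> (Y \<union> Y2) \<subseteq> {y}" using zu by blast
      then show ?thesis using y'(1) by blast
    qed
    then show ?thesis using z(1,2) unfolding private_nbr_def by blast
  qed
  show "l' e = S \<longleftrightarrow> e \<in> F \<union> F2" if e: "e \<in> E \<union> E2" for e
  proof (cases "e \<in> E")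
    case True
    have "e \<notin> F2" using old_new[OF True] sub2(1) by blast
    then show ?thesis using lab(1) label_S[OF True] True by simp
  next
    case False
    then have "e \<notin> F" "e \<in> E2" using e stars_subset by blast+
    then show ?thesis using lab(2) by simp
  qed
  show "l' e = (if e \<inter> (Y \<union> Y2) = {} then L2 else L1)"
    if e: "e \<in> E \<union> E2" "e \<notin> F \<union> F2" "e \<inter> (X \<union> X2) = {} \<or> e \<inter> (Y \<union> Y2) = {}" for e
  proof (cases "e \<in> E")
    case True
    have "e \<inter> (Y \<union> Y2) = e \<inter> Y" "e \<inter> (X \<union> X2) = e \<inter> X" using EV[OF True] sub2 U(2) by blast+
    then show ?thesis using lab(1) label[OF True] True e by simp
  next
    case False
    then have "e \<in> E2" using e by blast
    moreover have "e \<notin> F2" using e(2) by blast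
    ultimately show ?thesis using bspec[OF lab(2), of e] e(3) by presburger
  qed
qed

text \<open>
  If every new edge at a new member of \<open>Y\<close> runs inside the new part or to \<open>v\<close>, then among the old
  vertices only \<open>v\<close> loses its privacy.
\<close>

lemma old_private:
  assumes "\<And>y. y \<in> Y \<Longrightarrow> \<exists>z. private_nbr E X Y y z \<and> z \<noteq> v" "U \<inter> V = {}"
    and "\<And>e. e \<in> E2 \<Longrightarrow> e \<inter> Y2 \<noteq> {} \<Longrightarrow> e \<subseteq> insert v U"
  shows "\<forall>y\<in>Y. \<exists>z. private_nbr E X Y y z \<and> (\<forall>e\<in>E2. z \<in> e \<longrightarrow> e \<inter> Y2 = {})"
proof
  fix y assume "y \<in> Y"
  then obtain z where z: "private_nbr E X Y y z" "z \<noteq> v" using assms(1) by blast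
  then have "{y, z} \<in> E" by (simp add: private_nbr_def)
  then have "z \<in> V" using simple_graph_edge[OF simple] by blast
  then have "\<forall>e\<in>E2. z \<in> e \<longrightarrow> e \<inter> Y2 = {}" using z(2) assms(2,3) by blast
  then show "\<exists>z. private_nbr E X Y y z \<and> (\<forall>e\<in>E2. z \<in> e \<longrightarrow> e \<inter> Y2 = {})" using z(1) by blast
qed

text \<open>
  Only the case that \<open>v\<close> is the private neighbour \<open>z\<close> of \<open>y\<close> needs the side condition. A leaf edge adjacent
  to \<open>{v, y}\<close> cannot sit at \<open>v\<close>, since its leaf would have to lie on a star; so it ends in a leaf at \<open>y\<close>,
  which is private. On the path \<open>v w x t\<close> the vertex \<open>w\<close> is \<open>y\<close>, and the labels at \<open>x\<close> say that \<open>x\<close> lies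
  on no star and has no other neighbour in \<open>Y\<close>.
\<close>

lemma O3_private:
  assumes v: "v \<in> V" "v \<notin> set_A1 V E l" "v \<in> set_C V E l \<longrightarrow> O3_condition V E l v" and y: "y \<in> Y"
  shows "\<exists>z. private_nbr E X Y y z \<and> z \<noteq> v"
proof -
  obtain z where z: "private_nbr E X Y y z" using has_private[OF y] by blast
  show ?thesis
  proof (cases "z = v")
    case False
    then show ?thesis using z by blast
  next
    case True
    have vXY: "v \<notin> X" "v \<notin> Y" and yv: "{y, v} \<in> E" and vu: "\<forall>y'\<in>Y. {y', v} \<in> E \<longrightarrow> y' = y"
      using z True by (auto simp: private_nbr_def)
    have vy: "{v, y} \<in> E" using yv by (simp add: insert_commute)
    then have c3: "O3_condition V E l v" using v vXY y set_C_iff by blast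
    have inF: "f \<notin> F" if "v \<in> f" for f using star_edge[of f] that vXY by blast
    moreover have "{v, y} \<inter> X = {}" "{v, y} \<inter> Y \<noteq> {}" using vXY y disjoint by blast+
    ultimately have "l {v, y} = L1" using label_L1[OF vy] by blast
    moreover have "{v, y} \<in> incident_edges E v" using vy by (simp add: incident_edges_def)
    ultimately have "(\<exists>f. leaf_edge E f \<and> edge_adjacent {v, y} f) \<or>
      (\<exists>w x t. is_path V E [v, w, x, t] \<and> {v, y} \<in> {{v, w}, {w, x}, {x, t}} \<and>
         l {v, w} = L1 \<and> l {w, x} = L1 \<and> l {x, t} = L2 \<and>
         (\<forall>g \<in> incident_edges E x - {{w, x}}. l g = L2))"
      using c3 unfolding O3_condition_def by (elim ballE[of _ _ "{v, y}"]) simp_all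
    then show ?thesis
    proof (elim disjE exE conjE)
      fix f assume 1: "leaf_edge E f" "edge_adjacent {v, y} f"
      have f: "f \<in> E" "f \<noteq> {v, y}" "f \<inter> {v, y} \<noteq> {}" 
        using 1 by (auto simp: leaf_edge_def edge_adjacent_def)
      obtain a where a: "a \<in> f" "is_leaf E a" using 1 by (auto simp: leaf_edge_def)
      have aXY: "a \<notin> X \<union> Y" using not_leaf a(2) by blast
      obtain d where d: "\<forall>w. {a, w} \<in> E \<longleftrightarrow> w = d" using a(2) is_leaf_iff[OF simple] by blast
      obtain b where b: "f = {a, b}" by (rule simple_graph_edgeE[OF simple f(1) a(1)])
      have bd: "b = d" using d b f(1) by blast
      have bXY: "b \<in> X \<union> Y" using cover[of a b] f(1) b aXY by blast
      have "a \<noteq> v"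
      proof
        assume "a = v"
        then have "y = d" using d vy by blast
        then show False using f(2) b bd \<open>a = v\<close> by simp
      qed
      have "b = y" using f(3) b \<open>a \<noteq> v\<close> aXY bXY vXY y by blast
      have "private_nbr E X Y y a"
        unfolding private_nbr_def
      proof (intro conjI ballI impI)
        show "a \<notin> X \<union> Y" by (rule aXY)
        show "{y, a} \<in> E" using f(1) b \<open>b = y\<close> by (simp add: insert_commute)
        fix y' assume "{y', a} \<in> E"
        then have "{a, y'} \<in> E" by (simp add: insert_commute)
        then show "y' = y" using d bd \<open>b = y\<close> by blast
      qed
      then show ?thesis using \<open>a \<noteq> v\<close> by blast
    next
      fix w x t assume 2: "is_path V E [v, w, x, t]" "{v, y} \<in> {{v, w}, {w, x}, {x, t}}"
         "l {v, w} = L1" "l {w, x} = L1" "\<forall>g \<in> incident_edges E x - {{w, x}}. l g = L2"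
      have e: "{v, w} \<in> E" "{w, x} \<in> E" and dist: "v \<noteq> x" "w \<noteq> x" "v \<noteq> w" "v \<noteq> t"
        using 2(1) by (auto simp: is_path_def is_walk_def)
      have "{v, y} = {v, w}" using 2(2) dist by (auto simp: doubleton_eq_iff)
      then have wy: "w = y" by (auto simp: doubleton_eq_iff)
      have lx: "l {x, b} = L2" if "{x, b} \<in> E" "b \<noteq> w" for b
        using 2(5) that dist by (auto simp: incident_edges_def doubleton_eq_iff)
      have wx: "{w, x} \<notin> F" using label_S[OF e(2)] 2(4) by simp
      have xX: "x \<notin> X"
      proof
        assume "x \<in> X"
        then obtain b where b: "{x, b} \<in> F" "b \<noteq> w" using rays by metis
        then show False using lx[of b] label_S[of "{x, b}"] stars_subset by auto
      qed
      have "x \<notin> Y" using independent[OF y] e(2) wy by blast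
      have "private_nbr E X Y y x"
        unfolding private_nbr_def
      proof (intro conjI ballI impI)
        show "x \<notin> X \<union> Y" using xX \<open>x \<notin> Y\<close> by blast
        show "{y, x} \<in> E" using e(2) wy by simp
        fix y' assume y': "y' \<in> Y" "{y', x} \<in> E"
        show "y' = y"
        proof (rule ccontr)
          assume "y' \<noteq> y"
          then have "l {x, y'} = L2" using lx[of y'] y'(2) wy by (simp add: insert_commute)
          moreover have xy': "{x, y'} \<in> E" using y'(2) by (simp add: insert_commute)
          ultimately have "{x, y'} \<notin> F" using label_S[OF xy'] by simp
          moreover have "{x, y'} \<inter> X = {}" "{x, y'} \<inter> Y \<noteq> {}" using xX y'(1) disjoint by blast+
          ultimately have "l {x, y'} = L1" using label_L1[OF xy'] by blast
          then show False using \<open>l {x, y'} = L2\<close> by simp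
        qed
      qed
      then show ?thesis using dist by blast
    qed
  qed
qed

lemma extend_O1:
  assumes "v \<in> set_A1 V E l \<union> set_A2 V E l" "u \<notin> V"
  shows "labelled_star_cover (E \<union> {{v, u}}) F X Y (V \<union> {u})
    (l({v, u} := if v \<in> set_A1 V E l then L1 else L2))"
proof -
  have v: "v \<in> X \<union> Y" "v \<in> V" "v \<noteq> u" using assms stars_in set_A1_eq set_A2_eq by auto
  have u: "u \<notin> X" "u \<notin> Y" using assms(2) stars_in by auto
  have "v \<in> Y \<or> v \<notin> Y \<and> v \<in> X" using v by blast
  then have "labelled_star_cover (E \<union> {{v, u}}) (F \<union> {}) (X \<union> {}) (Y \<union> {}) (V \<union> {u})
    (l({v, u} := if v \<in> set_A1 V E l then L1 else L2))"
    by (intro extend) (use assms v u has_private fresh_not_edge set_A1_eq in auto)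
  then show ?thesis by simp
qed

lemma extend_O2:
  assumes "v \<in> set_A2 V E l" "distinct [u1, u2]" "{u1, u2} \<inter> V = {}"
  shows "labelled_star_cover (E \<union> {{v, u1}, {u1, u2}}) (F \<union> {{v, u1}}) (X \<union> {}) (Y \<union> {u1}) (V \<union> {u1, u2})
    (l({v, u1} := S, {u1, u2} := L1))"
proof -
  have v: "v \<in> X" "v \<notin> Y" "v \<in> V" "v \<noteq> u1" "v \<noteq> u2" using assms stars_in set_A2_eq disjoint by auto
  have u: "u1 \<notin> X" "u1 \<notin> Y" "u2 \<notin> X" "u2 \<notin> Y" "u1 \<notin> V" "u2 \<notin> V" "u1 \<noteq> u2" using assms(2,3) stars_in by auto
  show ?thesis
  proof (rule extend)
    show "\<forall>y\<in>Y. \<exists>z. private_nbr E X Y y z \<and>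
        (\<forall>e\<in>{{v, u1}, {u1, u2}}. z \<in> e \<longrightarrow> e \<inter> {u1} = {})"
    proof (rule old_private[where v = v and U = "{u1, u2}"])
      show "\<exists>z. private_nbr E X Y y z \<and> z \<noteq> v" if "y \<in> Y" for y
        using has_private[OF that] v(1) unfolding private_nbr_def by blast
    qed (use assms in auto)
    show "\<forall>y\<in>{u1}. \<exists>z. z \<notin> X \<union> {} \<union> Y \<union> {u1} \<and> {y, z} \<in> {{v, u1}, {u1, u2}} \<and>
      (z \<in> V \<longrightarrow> (\<forall>y'\<in>Y. {z, y'} \<notin> E)) \<and>
      (\<forall>e\<in>{{v, u1}, {u1, u2}}. z \<in> e \<longrightarrow> e \<inter> (Y \<union> {u1}) \<subseteq> {y})"
      using u v by (auto intro!: exI[of _ u2])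
    show "\<forall>y\<in>{u1}. \<exists>x. {x, y} \<in> {{v, u1}} \<and> (\<forall>f\<in>{{v, u1}}. y \<in> f \<longrightarrow> f = {x, y})"
      by auto
  qed (use u v fresh_not_edge in \<open>auto simp: doubleton_eq_iff\<close>)
qed

lemma extend_O3:
  assumes v: "v \<in> V" "v \<notin> set_A1 V E l" "v \<in> set_C V E l \<longrightarrow> O3_condition V E l v"
    and u: "distinct [u1, u2, u3, u4, u5]" "{u1, u2, u3, u4, u5} \<inter> V = {}"
  shows "labelled_star_cover (E \<union> {{u1, u2}, {u2, u3}, {u3, u4}, {u4, u5}, {v, u2}})
    (F \<union> {{u2, u3}, {u3, u4}}) (X \<union> {u3}) (Y \<union> {u2, u4}) (V \<union> {u1, u2, u3, u4, u5})
    (l({u2, u3} := S, {u3, u4} := S, {v, u2} := L1, {u1, u2} := L1, {u4, u5} := L1))"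
proof -
  have vY: "v \<notin> Y" and vV: "v \<in> V" using v set_A1_eq by auto
  have ne: "v \<noteq> u1" "v \<noteq> u2" "v \<noteq> u3" "v \<noteq> u4" "v \<noteq> u5" using u v by auto
  have new: "u1 \<notin> V" "u2 \<notin> V" "u3 \<notin> V" "u4 \<notin> V" "u5 \<notin> V"
    "u1 \<notin> X \<union> Y" "u2 \<notin> X \<union> Y" "u3 \<notin> X \<union> Y" "u4 \<notin> X \<union> Y" "u5 \<notin> X \<union> Y" using u stars_in by auto
  show ?thesis
  proof (rule extend)
    show "\<forall>y\<in>Y. \<exists>z. private_nbr E X Y y z \<and>
        (\<forall>e\<in>{{u1, u2}, {u2, u3}, {u3, u4}, {u4, u5}, {v, u2}}. z \<in> e \<longrightarrow> e \<inter> {u2, u4} = {})"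
      by (rule old_private[where v = v, OF O3_private[OF v] u(2)]) auto
    show "\<forall>y\<in>{u2, u4}. \<exists>z. z \<notin> X \<union> {u3} \<union> Y \<union> {u2, u4} \<and>
      {y, z} \<in> {{u1, u2}, {u2, u3}, {u3, u4}, {u4, u5}, {v, u2}} \<and>
      (z \<in> V \<longrightarrow> (\<forall>y'\<in>Y. {z, y'} \<notin> E)) \<and>
      (\<forall>e\<in>{{u1, u2}, {u2, u3}, {u3, u4}, {u4, u5}, {v, u2}}. z \<in> e \<longrightarrow> e \<inter> (Y \<union> {u2, u4}) \<subseteq> {y})"
    proof (intro ballI)
      fix y assume "y \<in> {u2, u4}"
      then consider "y = u2" | "y = u4" by auto
      then show "\<exists>z. z \<notin> X \<union> {u3} \<union> Y \<union> {u2, u4} \<and>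
      {y, z} \<in> {{u1, u2}, {u2, u3}, {u3, u4}, {u4, u5}, {v, u2}} \<and>
      (z \<in> V \<longrightarrow> (\<forall>y'\<in>Y. {z, y'} \<notin> E)) \<and>
      (\<forall>e\<in>{{u1, u2}, {u2, u3}, {u3, u4}, {u4, u5}, {v, u2}}. z \<in> e \<longrightarrow> e \<inter> (Y \<union> {u2, u4}) \<subseteq> {y})"
      proof cases
        case 1
        then show ?thesis using u new ne by (intro exI[of _ u1]) auto
      next
        case 2
        then show ?thesis using u new ne by (intro exI[of _ u5]) auto
      qed
    qed
    show "\<forall>y\<in>{u2, u4}. \<exists>x. {x, y} \<in> {{u2, u3}, {u3, u4}} \<and> (\<forall>f\<in>{{u2, u3}, {u3, u4}}. y \<in> f \<longrightarrow> f = {x, y})"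
      using u by (auto intro!: exI[of _ u3])
    show "\<forall>x\<in>{u3}. \<exists>y y'. y \<noteq> y' \<and> {x, y} \<in> {{u2, u3}, {u3, u4}} \<and> {x, y'} \<in> {{u2, u3}, {u3, u4}}"
      using u(1) by - (rule ballI, rule exI[of _ u2], rule exI[of _ u4], simp add: insert_commute)
    show "\<forall>f\<in>{{u2, u3}, {u3, u4}}. \<exists>x\<in>X \<union> {u3}. \<exists>y\<in>{u2, u4}. f = {x, y}" by auto
    show "finite {u1, u2, u3, u4, u5}" by simp
    show "{u1, u2, u3, u4, u5} \<inter> V = {}" by (rule u(2))
    show "\<forall>e\<in>{{u1, u2}, {u2, u3}, {u3, u4}, {u4, u5}, {v, u2}}. card e = 2 \<and> e \<subseteq> V \<union> {u1, u2, u3, u4, u5} \<and> e \<inter> {u1, u2, u3, u4, u5} \<noteq> {}"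
      using u(1) ne vV by simp
    show "{{u2, u3}, {u3, u4}} \<subseteq> {{u1, u2}, {u2, u3}, {u3, u4}, {u4, u5}, {v, u2}}" by simp
    show "{u3} \<subseteq> {u1, u2, u3, u4, u5}" "{u2, u4} \<subseteq> {u1, u2, u3, u4, u5}" by simp_all
    show "{u3} \<inter> {u2, u4} = {}" using u(1) by auto
    show "\<forall>e\<in>{{u1, u2}, {u2, u3}, {u3, u4}, {u4, u5}, {v, u2}}. e \<inter> (X \<union> {u3} \<union> Y \<union> {u2, u4}) \<noteq> {}" by auto
    show "\<forall>e\<in>{{u1, u2}, {u2, u3}, {u3, u4}, {u4, u5}, {v, u2}}. \<not> e \<subseteq> Y \<union> {u2, u4}" using u(1) ne new vY by auto
    show "\<forall>e\<in>E. (l({u2, u3} := S, {u3, u4} := S, {v, u2} := L1, {u1, u2} := L1, {u4, u5} := L1)) e = l e"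
    proof
      fix e assume "e \<in> E"
      then have "e \<subseteq> V" using simple by (simp add: simple_graph_def)
      then have "u1 \<notin> e" "u2 \<notin> e" "u3 \<notin> e" "u4 \<notin> e" using new by blast+
      moreover have "a \<notin> e \<Longrightarrow> e \<noteq> {a, b}" "a \<notin> e \<Longrightarrow> e \<noteq> {b, a}" for a b by auto
      ultimately show "(l({u2, u3} := S, {u3, u4} := S, {v, u2} := L1, {u1, u2} := L1, {u4, u5} := L1)) e = l e" by simp
    qed
    show "\<forall>e\<in>{{u1, u2}, {u2, u3}, {u3, u4}, {u4, u5}, {v, u2}}. ((l({u2, u3} := S, {u3, u4} := S, {v, u2} := L1, {u1, u2} := L1, {u4, u5} := L1)) e = S \<longleftrightarrow> e \<in> {{u2, u3}, {u3, u4}}) \<and>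
      (e \<notin> {{u2, u3}, {u3, u4}} \<longrightarrow> e \<inter> (X \<union> {u3}) = {} \<or> e \<inter> (Y \<union> {u2, u4}) = {} \<longrightarrow>
        (l({u2, u3} := S, {u3, u4} := S, {v, u2} := L1, {u1, u2} := L1, {u4, u5} := L1)) e = (if e \<inter> (Y \<union> {u2, u4}) = {} then L2 else L1))"
      using u(1) ne new vY by (auto simp add: doubleton_eq_iff)
  qed
qed

text \<open>
  Here \<open>v\<close> itself becomes the private neighbour of \<open>u1\<close>. This is why \<open>v\<close> has to be in \<open>B\<close>: it must not
  have a neighbour in \<open>Y\<close>.
\<close>

lemma extend_O4:
  assumes v: "v \<in> set_B V E l"
    and u: "distinct [u1, u2, u3, u4]" "{u1, u2, u3, u4} \<inter> V = {}"
  shows "labelled_star_cover (E \<union> {{u1, u2}, {u2, u3}, {u3, u4}, {v, u1}})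
    (F \<union> {{u1, u2}, {u2, u3}}) (X \<union> {u2}) (Y \<union> {u1, u3}) (V \<union> {u1, u2, u3, u4})
    (l({v, u1} := L1, {u3, u4} := L1, {u1, u2} := S, {u2, u3} := S))"
proof -
  have vB: "v \<in> V" "v \<notin> X" "v \<notin> Y" "\<forall>y\<in>Y. {v, y} \<notin> E" using v set_B_iff by auto
  have vV: "v \<in> V" by (rule vB(1))
  have ne: "v \<noteq> u1" "v \<noteq> u2" "v \<noteq> u3" "v \<noteq> u4" using u vB by auto
  have new: "u1 \<notin> V" "u2 \<notin> V" "u3 \<notin> V" "u4 \<notin> V"
    "u1 \<notin> X \<union> Y" "u2 \<notin> X \<union> Y" "u3 \<notin> X \<union> Y" "u4 \<notin> X \<union> Y" using u stars_in by auto
  show ?thesis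
  proof (rule extend)
    show "\<forall>y\<in>Y. \<exists>z. private_nbr E X Y y z \<and>
        (\<forall>e\<in>{{u1, u2}, {u2, u3}, {u3, u4}, {v, u1}}. z \<in> e \<longrightarrow> e \<inter> {u1, u3} = {})"
    proof (rule old_private[where v = v, OF _ u(2)])
      show "\<exists>z. private_nbr E X Y y z \<and> z \<noteq> v" if y: "y \<in> Y" for y
      proof -
        obtain z where z: "private_nbr E X Y y z" using has_private[OF y] by blast
        then have "{z, y} \<in> E" by (simp add: private_nbr_def insert_commute)
        then show ?thesis using z vB(4) y by blast
      qed
    qed auto
    show "\<forall>y\<in>{u1, u3}. \<exists>z. z \<notin> X \<union> {u2} \<union> Y \<union> {u1, u3} \<and>
      {y, z} \<in> {{u1, u2}, {u2, u3}, {u3, u4}, {v, u1}} \<and>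
      (z \<in> V \<longrightarrow> (\<forall>y'\<in>Y. {z, y'} \<notin> E)) \<and>
      (\<forall>e\<in>{{u1, u2}, {u2, u3}, {u3, u4}, {v, u1}}. z \<in> e \<longrightarrow> e \<inter> (Y \<union> {u1, u3}) \<subseteq> {y})"
    proof (intro ballI)
      fix y assume "y \<in> {u1, u3}"
      then consider "y = u1" | "y = u3" by auto
      then show "\<exists>z. z \<notin> X \<union> {u2} \<union> Y \<union> {u1, u3} \<and>
      {y, z} \<in> {{u1, u2}, {u2, u3}, {u3, u4}, {v, u1}} \<and>
      (z \<in> V \<longrightarrow> (\<forall>y'\<in>Y. {z, y'} \<notin> E)) \<and>
      (\<forall>e\<in>{{u1, u2}, {u2, u3}, {u3, u4}, {v, u1}}. z \<in> e \<longrightarrow> e \<inter> (Y \<union> {u1, u3}) \<subseteq> {y})"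
      proof cases
        case 1
        then show ?thesis using u new ne vB by (intro exI[of _ v]) (auto simp: insert_commute)
      next
        case 2
        then show ?thesis using u new ne by (intro exI[of _ u4]) auto
      qed
    qed
    show "\<forall>y\<in>{u1, u3}. \<exists>x. {x, y} \<in> {{u1, u2}, {u2, u3}} \<and> (\<forall>f\<in>{{u1, u2}, {u2, u3}}. y \<in> f \<longrightarrow> f = {x, y})"
      using u by (auto intro!: exI[of _ u2])
    show "\<forall>x\<in>{u2}. \<exists>y y'. y \<noteq> y' \<and> {x, y} \<in> {{u1, u2}, {u2, u3}} \<and> {x, y'} \<in> {{u1, u2}, {u2, u3}}"
      using u(1) by - (rule ballI, rule exI[of _ u1], rule exI[of _ u3], simp add: insert_commute)
    show "\<forall>f\<in>{{u1, u2}, {u2, u3}}. \<exists>x\<in>X \<union> {u2}. \<exists>y\<in>{u1, u3}. f = {x, y}" by auto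
    show "finite {u1, u2, u3, u4}" by simp
    show "{u1, u2, u3, u4} \<inter> V = {}" by (rule u(2))
    show "\<forall>e\<in>{{u1, u2}, {u2, u3}, {u3, u4}, {v, u1}}. card e = 2 \<and> e \<subseteq> V \<union> {u1, u2, u3, u4} \<and> e \<inter> {u1, u2, u3, u4} \<noteq> {}"
      using u(1) ne vV by simp
    show "{{u1, u2}, {u2, u3}} \<subseteq> {{u1, u2}, {u2, u3}, {u3, u4}, {v, u1}}" by simp
    show "{u2} \<subseteq> {u1, u2, u3, u4}" "{u1, u3} \<subseteq> {u1, u2, u3, u4}" by simp_all
    show "{u2} \<inter> {u1, u3} = {}" using u(1) by auto
    show "\<forall>e\<in>{{u1, u2}, {u2, u3}, {u3, u4}, {v, u1}}. e \<inter> (X \<union> {u2} \<union> Y \<union> {u1, u3}) \<noteq> {}" by auto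
    show "\<forall>e\<in>{{u1, u2}, {u2, u3}, {u3, u4}, {v, u1}}. \<not> e \<subseteq> Y \<union> {u1, u3}" using u(1) ne new vB(1-3) by auto
    show "\<forall>e\<in>E. (l({v, u1} := L1, {u3, u4} := L1, {u1, u2} := S, {u2, u3} := S)) e = l e"
    proof
      fix e assume "e \<in> E"
      then have "e \<subseteq> V" using simple by (simp add: simple_graph_def)
      then have "u1 \<notin> e" "u2 \<notin> e" "u3 \<notin> e" "u4 \<notin> e" using new by blast+
      moreover have "a \<notin> e \<Longrightarrow> e \<noteq> {a, b}" "a \<notin> e \<Longrightarrow> e \<noteq> {b, a}" for a b by auto
      ultimately show "(l({v, u1} := L1, {u3, u4} := L1, {u1, u2} := S, {u2, u3} := S)) e = l e" by simp
    qed
    show "\<forall>e\<in>{{u1, u2}, {u2, u3}, {u3, u4}, {v, u1}}. ((l({v, u1} := L1, {u3, u4} := L1, {u1, u2} := S, {u2, u3} := S)) e = S \<longleftrightarrow> e \<in> {{u1, u2}, {u2, u3}}) \<and>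
      (e \<notin> {{u1, u2}, {u2, u3}} \<longrightarrow> e \<inter> (X \<union> {u2}) = {} \<or> e \<inter> (Y \<union> {u1, u3}) = {} \<longrightarrow>
        (l({v, u1} := L1, {u3, u4} := L1, {u1, u2} := S, {u2, u3} := S)) e = (if e \<inter> (Y \<union> {u1, u3}) = {} then L2 else L1))"
      using u(1) ne new vB(1-3) by (auto simp add: doubleton_eq_iff)
  qed
qed

lemma extend_O5:
  assumes v: "v \<in> V"
    and u: "distinct [u1, u2, u3, u4, u5]" "{u1, u2, u3, u4, u5} \<inter> V = {}"
  shows "labelled_star_cover (E \<union> {{u1, u2}, {u2, u3}, {u3, u4}, {u4, u5}, {v, u3}})
    (F \<union> {{u2, u3}, {u3, u4}}) (X \<union> {u3}) (Y \<union> {u2, u4}) (V \<union> {u1, u2, u3, u4, u5})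
    (l({v, u3} := L2, {u1, u2} := L1, {u4, u5} := L1, {u2, u3} := S, {u3, u4} := S))"
proof -
  have vV: "v \<in> V" by (rule v)
  have ne: "v \<noteq> u1" "v \<noteq> u2" "v \<noteq> u3" "v \<noteq> u4" "v \<noteq> u5" using u v by auto
  have new: "u1 \<notin> V" "u2 \<notin> V" "u3 \<notin> V" "u4 \<notin> V" "u5 \<notin> V"
    "u1 \<notin> X \<union> Y" "u2 \<notin> X \<union> Y" "u3 \<notin> X \<union> Y" "u4 \<notin> X \<union> Y" "u5 \<notin> X \<union> Y" using u stars_in by auto
  show ?thesis
  proof (rule extend)
    show "\<forall>y\<in>Y. \<exists>z. private_nbr E X Y y z \<and>
        (\<forall>e\<in>{{u1, u2}, {u2, u3}, {u3, u4}, {u4, u5}, {v, u3}}. z \<in> e \<longrightarrow> e \<inter> {u2, u4} = {})"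
    proof
      fix y assume "y \<in> Y"
      then obtain z where z: "private_nbr E X Y y z" using has_private by blast
      then have "{y, z} \<in> E" by (simp add: private_nbr_def)
      then have "z \<in> V" using simple_graph_edge[OF simple] by blast
      then have "z \<noteq> u1" "z \<noteq> u2" "z \<noteq> u3" "z \<noteq> u4" "z \<noteq> u5" using new by auto
      then have "\<forall>e\<in>{{u1, u2}, {u2, u3}, {u3, u4}, {u4, u5}, {v, u3}}. z \<in> e \<longrightarrow> e \<inter> {u2, u4} = {}" using u(1) ne by auto
      then show "\<exists>z. private_nbr E X Y y z \<and> (\<forall>e\<in>{{u1, u2}, {u2, u3}, {u3, u4}, {u4, u5}, {v, u3}}. z \<in> e \<longrightarrow> e \<inter> {u2, u4} = {})"
        using z by blast
    qed
    show "\<forall>y\<in>{u2, u4}. \<exists>z. z \<notin> X \<union> {u3} \<union> Y \<union> {u2, u4} \<and>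
      {y, z} \<in> {{u1, u2}, {u2, u3}, {u3, u4}, {u4, u5}, {v, u3}} \<and>
      (z \<in> V \<longrightarrow> (\<forall>y'\<in>Y. {z, y'} \<notin> E)) \<and>
      (\<forall>e\<in>{{u1, u2}, {u2, u3}, {u3, u4}, {u4, u5}, {v, u3}}. z \<in> e \<longrightarrow> e \<inter> (Y \<union> {u2, u4}) \<subseteq> {y})"
    proof (intro ballI)
      fix y assume "y \<in> {u2, u4}"
      then consider "y = u2" | "y = u4" by auto
      then show "\<exists>z. z \<notin> X \<union> {u3} \<union> Y \<union> {u2, u4} \<and>
      {y, z} \<in> {{u1, u2}, {u2, u3}, {u3, u4}, {u4, u5}, {v, u3}} \<and>
      (z \<in> V \<longrightarrow> (\<forall>y'\<in>Y. {z, y'} \<notin> E)) \<and>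
      (\<forall>e\<in>{{u1, u2}, {u2, u3}, {u3, u4}, {u4, u5}, {v, u3}}. z \<in> e \<longrightarrow> e \<inter> (Y \<union> {u2, u4}) \<subseteq> {y})"
      proof cases
        case 1
        then show ?thesis using u new ne by (intro exI[of _ u1]) auto
      next
        case 2
        then show ?thesis using u new ne by (intro exI[of _ u5]) auto
      qed
    qed
    show "\<forall>y\<in>{u2, u4}. \<exists>x. {x, y} \<in> {{u2, u3}, {u3, u4}} \<and> (\<forall>f\<in>{{u2, u3}, {u3, u4}}. y \<in> f \<longrightarrow> f = {x, y})"
      using u by (auto intro!: exI[of _ u3])
    show "\<forall>x\<in>{u3}. \<exists>y y'. y \<noteq> y' \<and> {x, y} \<in> {{u2, u3}, {u3, u4}} \<and> {x, y'} \<in> {{u2, u3}, {u3, u4}}"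
      using u(1) by - (rule ballI, rule exI[of _ u2], rule exI[of _ u4], simp add: insert_commute)
    show "\<forall>f\<in>{{u2, u3}, {u3, u4}}. \<exists>x\<in>X \<union> {u3}. \<exists>y\<in>{u2, u4}. f = {x, y}" by auto
    show "finite {u1, u2, u3, u4, u5}" by simp
    show "{u1, u2, u3, u4, u5} \<inter> V = {}" by (rule u(2))
    show "\<forall>e\<in>{{u1, u2}, {u2, u3}, {u3, u4}, {u4, u5}, {v, u3}}. card e = 2 \<and> e \<subseteq> V \<union> {u1, u2, u3, u4, u5} \<and> e \<inter> {u1, u2, u3, u4, u5} \<noteq> {}"
      using u(1) ne vV by simp
    show "{{u2, u3}, {u3, u4}} \<subseteq> {{u1, u2}, {u2, u3}, {u3, u4}, {u4, u5}, {v, u3}}" by simp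
    show "{u3} \<subseteq> {u1, u2, u3, u4, u5}" "{u2, u4} \<subseteq> {u1, u2, u3, u4, u5}" by simp_all
    show "{u3} \<inter> {u2, u4} = {}" using u(1) by auto
    show "\<forall>e\<in>{{u1, u2}, {u2, u3}, {u3, u4}, {u4, u5}, {v, u3}}. e \<inter> (X \<union> {u3} \<union> Y \<union> {u2, u4}) \<noteq> {}" by auto
    show "\<forall>e\<in>{{u1, u2}, {u2, u3}, {u3, u4}, {u4, u5}, {v, u3}}. \<not> e \<subseteq> Y \<union> {u2, u4}" using u(1) ne new by auto
    show "\<forall>e\<in>E. (l({v, u3} := L2, {u1, u2} := L1, {u4, u5} := L1, {u2, u3} := S, {u3, u4} := S)) e = l e"
    proof
      fix e assume "e \<in> E"
      then have "e \<subseteq> V" using simple by (simp add: simple_graph_def)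
      then have "u1 \<notin> e" "u2 \<notin> e" "u3 \<notin> e" "u4 \<notin> e" using new by blast+
      moreover have "a \<notin> e \<Longrightarrow> e \<noteq> {a, b}" "a \<notin> e \<Longrightarrow> e \<noteq> {b, a}" for a b by auto
      ultimately show "(l({v, u3} := L2, {u1, u2} := L1, {u4, u5} := L1, {u2, u3} := S, {u3, u4} := S)) e = l e" by simp
    qed
    show "\<forall>e\<in>{{u1, u2}, {u2, u3}, {u3, u4}, {u4, u5}, {v, u3}}. ((l({v, u3} := L2, {u1, u2} := L1, {u4, u5} := L1, {u2, u3} := S, {u3, u4} := S)) e = S \<longleftrightarrow> e \<in> {{u2, u3}, {u3, u4}}) \<and>
      (e \<notin> {{u2, u3}, {u3, u4}} \<longrightarrow> e \<inter> (X \<union> {u3}) = {} \<or> e \<inter> (Y \<union> {u2, u4}) = {} \<longrightarrow>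
        (l({v, u3} := L2, {u1, u2} := L1, {u4, u5} := L1, {u2, u3} := S, {u3, u4} := S)) e = (if e \<inter> (Y \<union> {u2, u4}) = {} then L2 else L1))"
      using u(1) ne new by (auto simp add: doubleton_eq_iff)
  qed
qed

end

text \<open>
  In a tree every path is a shortest walk between its ends, so no path is longer than the diameter.
\<close>

lemma path_length_le_diameter:
  assumes T: "is_tree V E" and p: "is_path V E p"
  shows "length p \<le> Suc (graph_diameter V E)"
proof -
  have V: "finite V" using T by (simp add: is_tree_def simple_graph_def)
  have ne: "p \<noteq> []" using p by (auto simp: is_path_def is_walk_def)
  then have ends: "hd p \<in> V" "last p \<in> V" using p by (auto simp: is_path_def is_walk_def)
  let ?P = "\<lambda>n. \<exists>q. is_walk V E q \<and> hd q = hd p \<and> last q = last p \<and> length q = Suc n"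
  have "?P (length p - 1)" using p ne by (intro exI[of _ p]) (simp add: is_path_def)
  then have "?P (graph_dist V E (hd p) (last p))" unfolding graph_dist_def by (rule LeastI)
  then obtain q where q: "is_walk V E q" "hd q = hd p" "last q = last p"
    "length q = Suc (graph_dist V E (hd p) (last p))" by blast
  have "length p \<le> length q" by (rule tree_path_shortest[OF T q(1) p]) (simp_all add: q)
  moreover have "{graph_dist V E u v | u v. u \<in> V \<and> v \<in> V} = (\<lambda>(u, v). graph_dist V E u v) ` (V \<times> V)"
    by auto
  then have "graph_dist V E (hd p) (last p) \<le> graph_diameter V E"
    unfolding graph_diameter_def using V ends by (intro Max_ge) auto
  ultimately show ?thesis using q(4) by simp
qed

lemma diameter_pathE:
  assumes T: "is_tree V E"
  obtains p where "is_path V E p" "length p = Suc (graph_diameter V E)"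
proof -
  have V: "finite V" "V \<noteq> {}" using T by (auto simp: is_tree_def simple_graph_def connected_graph_def)
  let ?D = "{graph_dist V E u v | u v. u \<in> V \<and> v \<in> V}"
  have "?D = (\<lambda>(u, v). graph_dist V E u v) ` (V \<times> V)" by auto
  then have "finite ?D" "?D \<noteq> {}" using V by auto
  then have "graph_diameter V E \<in> ?D" unfolding graph_diameter_def by (rule Max_in)
  then obtain u v where uv: "u \<in> V" "v \<in> V" "graph_diameter V E = graph_dist V E u v" by blast
  obtain p where p: "is_path V E p" "hd p = u" "last p = v" by (rule tree_pathE[OF T uv(1,2)])
  have "p \<noteq> []" using p by (auto simp: is_path_def is_walk_def)
  then have "Suc (length p - 1) = length p" by (cases p) auto
  then have "graph_dist V E u v \<le> length p - 1"
    unfolding graph_dist_def using p by (intro Least_le exI[of _ p]) (simp add: is_path_def)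
  then have "length p = Suc (graph_diameter V E)"
    using path_length_le_diameter[OF T p(1)] uv(3) \<open>p \<noteq> []\<close> by (cases p) auto
  then show ?thesis using that p(1) by blast
qed

lemma nonleaf_other_nbrE:
  assumes "simple_graph V E" "{a, b} \<in> E" "\<not> is_leaf E a"
  obtains a' where "{a, a'} \<in> E" "a' \<noteq> b"
proof -
  have "\<exists>a'. {a, a'} \<in> E \<and> a' \<noteq> b"
  proof (rule ccontr)
    assume "\<not> ?thesis"
    then have "\<forall>w. {a, w} \<in> E \<longleftrightarrow> w = b" using assms(2) by blast
    then show False using assms(3) is_leaf_iff[OF assms(1)] by blast
  qed
  then show ?thesis using that by blast
qed

lemma is_path_Cons:
  "is_path V E (a # b # p) \<longleftrightarrow> a \<in> V \<and> {a, b} \<in> E \<and> a \<notin> set (b # p) \<and> is_path V E (b # p)"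
  unfolding is_path_def is_walk_Cons by auto

text \<open>
  Let \<open>c\<close> be the middle of a path with five vertices. If a non-leaf edge avoided \<open>c\<close>, the path from \<open>c\<close> to
  it could be prolonged over the edge and one step further, because the ends of the edge are not
  leaves. It would then have at least three edges and start from \<open>c\<close> in a direction different from \<open>p1\<close> or from
  \<open>p3\<close>. Together with the half of the given path on that side it is a path with at least five edges, more than the diameter allows.
\<close>

lemma diameter4_nonleaf_edges:
  assumes T: "is_tree V E" and diam: "graph_diameter V E = 4"
    and p: "is_path V E [p0, p1, c, p3, p4]"
    and ab: "{a, b} \<in> E" "\<not> is_leaf E a" "\<not> is_leaf E b"
  shows "c = a \<or> c = b"
proof (rule ccontr)
  assume neg: "\<not> ?thesis"
  have sg: "simple_graph V E" using T by (simp add: is_tree_def)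
  have aV: "a \<in> V" using simple_graph_edge[OF sg ab(1)] by blast
  have cV: "c \<in> V" using p by (simp add: is_path_Cons)
  have ba: "{b, a} \<in> E" using ab(1) by (simp add: insert_commute)
  obtain q where q: "is_path V E q" "hd q = a" "last q = c" by (rule tree_pathE[OF T aV cV])
  obtain x q' where qq: "q = a # x # q'"
  proof (cases q)
    case Nil
    then show ?thesis using q by (simp add: is_path_def is_walk_def)
  next
    case (Cons a1 q1)
    then show ?thesis using q neg that by (cases q1) auto
  qed
  have "\<exists>r. is_path V E r \<and> 4 \<le> length r \<and> last r = c"
  proof (cases "x = b")
    case True
    obtain a' where a': "{a, a'} \<in> E" "a' \<noteq> b" by (rule nonleaf_other_nbrE[OF sg ab(1,2)])
    then have "{a', a} \<in> E" by (simp add: insert_commute)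
    then have "is_path V E (a' # a # b # q')"
      using path_extend[OF T, of a b q' a'] q(1) qq True a'(2) by simp
    moreover have "q' \<noteq> []" using q(3) qq True neg by auto
    then have "4 \<le> length (a' # a # b # q')" by (cases q') auto
    moreover have "last (a' # a # b # q') = c" using q(3) qq True by simp
    ultimately show ?thesis by blast
  next
    case False
    have 1: "is_path V E (b # a # x # q')"
      using path_extend[OF T, of a x q' b] q(1) qq ba False by simp
    obtain b' where b': "{b, b'} \<in> E" "b' \<noteq> a" by (rule nonleaf_other_nbrE[OF sg ba ab(3)])
    then have "{b', b} \<in> E" by (simp add: insert_commute)
    then have "is_path V E (b' # b # a # x # q')"
      using path_extend[OF T 1, of b'] b'(2) by simp
    moreover have "last (b' # b # a # x # q') = c" using q(3) qq by simp
    ultimately show ?thesis by (intro exI[of _ "b' # b # a # x # q'"]) simp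
  qed
  then obtain r where r: "is_path V E r" "4 \<le> length r" "last r = c" by blast
  have "is_path V E (rev r)" using r(1) by (rule is_path_rev)
  moreover have "hd (rev r) = c" using r(3) by (simp add: hd_rev)
  moreover have "4 \<le> length (rev r)" using r(2) by simp
  ultimately obtain q1 q2 where q1: "is_path V E (c # q1 # q2)" "2 \<le> length q2"
    by (cases "rev r"; cases "tl (rev r)") auto
  have "\<exists>d d'. {d, c} \<in> E \<and> {d', d} \<in> E \<and> d \<noteq> q1 \<and> d' \<noteq> c"
  proof (cases "p1 = q1")
    case True
    have "{p3, c} \<in> E" "{p4, p3} \<in> E" "p3 \<noteq> p1" "p4 \<noteq> c"
      using p by (auto simp: is_path_Cons insert_commute)
    then show ?thesis using True by blast
  next
    case False
    have "{p1, c} \<in> E" "{p0, p1} \<in> E" "p0 \<noteq> c" using p by (auto simp: is_path_Cons)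
    then show ?thesis using False by blast
  qed
  then obtain d d' where d: "{d, c} \<in> E" "{d', d} \<in> E" "d \<noteq> q1" "d' \<noteq> c" by blast
  have "is_path V E (d # c # q1 # q2)" by (rule path_extend[OF T q1(1) d(1,3)])
  then have "is_path V E (d' # d # c # q1 # q2)" using d(2,4) by (rule path_extend[OF T])
  from path_length_le_diameter[OF T this] show False using diam q1(2) by simp
qed

text \<open>
  The non-leaf edges form one star whose centre is the middle vertex \<open>c\<close> of a longest path. Its outer ends
  are not leaves, so each has a further neighbour, which must be a leaf and hence is private.
\<close>

lemma initial_labelled_star_cover:
  assumes "initial_labelled_tree V E l"
  shows "\<exists>F X Y. labelled_star_cover E F X Y V l"
proof -
  have T: "is_tree V E" and diam: "graph_diameter V E = 4"
    and l: "\<And>e. e \<in> E \<Longrightarrow> l e = (if \<not> leaf_edge E e then S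
        else if card {f \<in> E. \<not> leaf_edge E f \<and> edge_adjacent e f} \<ge> 2 then L2 else L1)"
    using assms by (auto simp: initial_labelled_tree_def)
  have sg: "simple_graph V E" using T by (simp add: is_tree_def)
  obtain p where p: "is_path V E p" "length p = 5" using diameter_pathE[OF T] diam by auto
  then obtain p0 p1 c p3 p4 where "p = [p0, p1, c, p3, p4]"
    by (auto simp: length_Suc_conv numeral_eq_Suc)
  then have p: "is_path V E [p0, p1, c, p3, p4]" using p by simp
  have sym: "{a, b} \<in> E \<longleftrightarrow> {b, a} \<in> E" for a b by (simp add: insert_commute)
  have nl: "\<not> is_leaf E a" if "{a, b} \<in> E" "{a, b'} \<in> E" "b \<noteq> b'" for a b b'
    using that is_leaf_iff[OF sg, of a] by metis
  define N where "N = {e \<in> E. \<not> leaf_edge E e}"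
  have N_iff: "{a, b} \<in> N \<longleftrightarrow> {a, b} \<in> E \<and> \<not> is_leaf E a \<and> \<not> is_leaf E b" for a b
    by (auto simp: N_def leaf_edge_def)
  have centre_N: "c = a \<or> c = b" if "{a, b} \<in> N" for a b
    using diameter4_nonleaf_edges[OF T diam p] that N_iff by blast
  have pe: "{c, p1} \<in> E" "{c, p3} \<in> E" "{p1, p0} \<in> E" "{p3, p4} \<in> E" "p0 \<noteq> c" "p4 \<noteq> c" "p1 \<noteq> p3"
    using p by (auto simp: is_path_Cons insert_commute)
  have cl: "\<not> is_leaf E c" by (rule nl[OF pe(1,2,7)])
  have "\<not> is_leaf E p1" "\<not> is_leaf E p3"
    using nl[of p1 p0 c] nl[of p3 p4 c] pe sym[of c p1] sym[of c p3] by simp_all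
  then have N13: "{c, p1} \<in> N" "{c, p3} \<in> N" using cl pe N_iff by simp_all
  define Y where "Y = {y. {c, y} \<in> N}"
  have NE: "N \<subseteq> E" by (auto simp: N_def)
  have cY: "c \<notin> Y" using simple_graph_edge(1)[OF sg, of c c] NE by (auto simp: Y_def)
  have Ye: "{c, y} \<in> N" "{c, y} \<in> E" "\<not> is_leaf E y" if "y \<in> Y" for y
    using that N_iff by (auto simp: Y_def)
  have Nform: "\<exists>y\<in>Y. e = {c, y}" if e: "e \<in> N" for e
  proof -
    have eE: "e \<in> E" using e NE by blast
    then obtain a b where ab: "e = {a, b}" using sg unfolding simple_graph_def by (auto simp: card_2_iff)
    then have "c \<in> e" using centre_N e by blast
    then obtain y where "e = {c, y}" by (rule simple_graph_edgeE[OF sg eE])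
    then show ?thesis using e by (auto simp: Y_def)
  qed
  have indep: "{y, y'} \<notin> E" if y: "y \<in> Y" "y' \<in> Y" for y y'
  proof
    assume "{y, y'} \<in> E"
    then have "{y, y'} \<in> N" using Ye y N_iff by blast
    then show False using centre_N cY y by blast
  qed
  have leaf_cover: "b = c \<or> b \<in> Y" if ab: "{a, b} \<in> E" "is_leaf E a" for a b
  proof (rule ccontr)
    assume neg: "\<not> ?thesis"
    have only: "w = b" if "{a, w} \<in> E" for w using ab that is_leaf_iff[OF sg, of a] by metis
    have V: "a \<in> V" "c \<in> V" using simple_graph_edge[OF sg ab(1)] simple_graph_edge[OF sg pe(1)] by auto
    obtain q where q: "is_path V E q" "hd q = a" "last q = c" by (rule tree_pathE[OF T V])
    have "a \<noteq> c" using ab(2) cl by blast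
    obtain x q' where qq: "q = a # b # x # q'"
    proof (cases q)
      case Nil
      then show ?thesis using q by (simp add: is_path_def is_walk_def)
    next
      case (Cons a1 q1)
      then obtain b1 q2 where q1: "q1 = b1 # q2" using q \<open>a \<noteq> c\<close> by (cases q1) auto
      have "b1 = b" using only q Cons q1 by (auto simp: is_path_Cons)
      then show ?thesis using q neg that Cons q1 by (cases q2) auto
    qed
    have bx: "{b, x} \<in> E" "x \<noteq> a" using q(1) qq by (auto simp: is_path_Cons)
    have bl: "\<not> is_leaf E b" using nl[of b a x] bx ab(1) sym[of a b] by simp
    have "\<not> is_leaf E x"
    proof (cases q')
      case Nil
      then show ?thesis using q(3) qq cl by simp
    next
      case (Cons x2 q2)
      then have "{x, x2} \<in> E" "x2 \<noteq> b" using q(1) qq by (auto simp: is_path_Cons)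
      then show ?thesis using nl[of x b x2] bx(1) sym[of b x] by simp
    qed
    then have "{b, x} \<in> N" using N_iff bx bl by blast
    moreover have "x = c" using centre_N[OF calculation] neg by blast
    ultimately have "{c, b} \<in> N" by (simp add: insert_commute)
    then show False using neg by (simp add: Y_def)
  qed
  have cover: "a = c \<or> a \<in> Y \<or> b = c \<or> b \<in> Y" if ab: "{a, b} \<in> E" for a b
  proof (cases "{a, b} \<in> N")
    case True
    then show ?thesis using centre_N by blast
  next
    case False
    then have "is_leaf E a \<or> is_leaf E b" using ab N_iff by blast
    then show ?thesis using leaf_cover ab sym by blast
  qed
  have "labelled_star_cover E N {c} Y V l"
  proof
    show "{c} \<inter> Y = {}" using cY by simp
    show "N \<subseteq> E" by (rule NE)
    show "\<exists>x\<in>{c}. \<exists>y\<in>Y. f = {x, y}" if "f \<in> N" for f using Nform[OF that] by simp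
    show "\<exists>!x. {x, y} \<in> N" if y: "y \<in> Y" for y
    proof (rule ex1I[of _ c])
      show "{c, y} \<in> N" by (rule Ye[OF y])
      show "x = c" if "{x, y} \<in> N" for x using centre_N[OF that] y cY by blast
    qed
    show "\<exists>y y'. y \<noteq> y' \<and> {x, y} \<in> N \<and> {x, y'} \<in> N" if "x \<in> {c}" for x
      using that N13 pe(7) by blast
    show "a \<in> {c} \<or> a \<in> Y \<or> b \<in> {c} \<or> b \<in> Y" if "{a, b} \<in> E" for a b
      using cover[OF that] by blast
    show "{y, y'} \<notin> E" if "y \<in> Y" "y' \<in> Y" for y y' by (rule indep[OF that])
    show "\<exists>z. private_nbr E {c} Y y z" if y: "y \<in> Y" for y
    proof -
      have yc: "{y, c} \<in> E" using Ye(2)[OF y] sym by blast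
      obtain z where z: "{y, z} \<in> E" "z \<noteq> c" by (rule nonleaf_other_nbrE[OF sg yc Ye(3)[OF y]])
      have "z \<notin> Y" using indep[OF y] z(1) by blast
      have "{y, z} \<notin> N" using centre_N[of y z] z(2) y cY by blast
      then have "is_leaf E z" using N_iff z(1) Ye(3)[OF y] by blast
      then obtain d where d: "\<forall>w. {z, w} \<in> E \<longleftrightarrow> w = d" using is_leaf_iff[OF sg] by blast
      have "y' = y" if "{y', z} \<in> E" for y' using d that z(1) sym by metis
      then show ?thesis using z \<open>z \<notin> Y\<close> unfolding private_nbr_def by blast
    qed
    show "simple_graph V E" by (rule sg)
    show "l e = S \<longleftrightarrow> e \<in> N" if "e \<in> E" for e using l[OF that] that by (simp add: N_def)
    show "l e = (if e \<inter> Y = {} then L2 else L1)"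
      if e: "e \<in> E" "e \<notin> N" "e \<inter> {c} = {} \<or> e \<inter> Y = {}" for e
    proof -
      let ?A = "{f \<in> E. \<not> leaf_edge E f \<and> edge_adjacent e f}"
      have A: "?A = {f \<in> N. edge_adjacent e f}" by (auto simp: N_def)
      have le: "l e = (if card ?A \<ge> 2 then L2 else L1)" using l[OF e(1)] e(1,2) by (simp add: N_def)
      obtain a b where ab: "e = {a, b}" using e(1) sg unfolding simple_graph_def by (auto simp: card_2_iff)
      show ?thesis
      proof (cases "e \<inter> Y = {}")
        case True
        then have ce: "c \<in> e" using cover[of a b] e(1) ab by blast
        have "{{c, p1}, {c, p3}} \<subseteq> ?A"
          unfolding A using N13 ce e(2) by (auto simp: edge_adjacent_def)
        moreover have "card {{c, p1}, {c, p3}} = 2" using pe(7) by (simp add: doubleton_eq_iff)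
        moreover have "finite ?A" using finite_edges[OF sg] by simp
        ultimately have "2 \<le> card ?A" using card_mono[of ?A "{{c, p1}, {c, p3}}"] by simp
        then show ?thesis using le True by simp
      next
        case False
        then have ce: "c \<notin> e" using e(3) by blast
        obtain y where y: "y \<in> e" "y \<in> Y" using False by blast
        obtain z where z: "e = {y, z}" by (rule simple_graph_edgeE[OF sg e(1) y(1)])
        have zY: "z \<notin> Y" using indep[OF y(2)] e(1) z by blast
        have "?A \<subseteq> {{c, y}}"
        proof
          fix f assume "f \<in> ?A"
          then have f: "f \<in> N" "e \<inter> f \<noteq> {}" unfolding A by (auto simp: edge_adjacent_def)
          obtain w where w: "w \<in> Y" "f = {c, w}" using Nform[OF f(1)] by blast
          then have "w = y" using f(2) ce z zY by blast
          then show "f \<in> {{c, y}}" using w by simp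
        qed
        then have "card ?A \<le> 1" using card_mono[of "{{c, y}}" ?A] by simp
        then show ?thesis using le False by simp
      qed
    qed
  qed
  then show ?thesis by blast
qed

lemma family_labelled_star_cover:
  "family_Tt V E l \<Longrightarrow> \<exists>F X Y. labelled_star_cover E F X Y V l"
proof (induction rule: family_Tt.induct)
  case (init V E l)
  then show ?case by (rule initial_labelled_star_cover)
next
  case (O1 V E l v u)
  then obtain F X Y where "labelled_star_cover E F X Y V l" by blast
  from labelled_star_cover.extend_O1[OF this O1(2,3)] show ?case by blast
next
  case (O2 V E l v u1 u2)
  then obtain F X Y where "labelled_star_cover E F X Y V l" by blast
  from labelled_star_cover.extend_O2[OF this O2(2-4)] show ?case by blast
next
  case (O3 V E l v u1 u2 u3 u4 u5)
  then obtain F X Y where "labelled_star_cover E F X Y V l" by blast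
  from labelled_star_cover.extend_O3[OF this O3(2-6)] show ?case by blast
next
  case (O4 V E l v u1 u2 u3 u4)
  then obtain F X Y where "labelled_star_cover E F X Y V l" by blast
  from labelled_star_cover.extend_O4[OF this O4(2-4)] show ?case by blast
next
  case (O5 V E l v u1 u2 u3 u4 u5)
  then obtain F X Y where "labelled_star_cover E F X Y V l" by blast
  from labelled_star_cover.extend_O5[OF this O5(2-4)] show ?case by blast
qed

section \<open>Taking a tree with a star cover apart\<close>

text \<open>
  The converse of \<open>O3_private\<close>: if \<open>z \<noteq> v\<close> is a private neighbour of \<open>w\<close>, then either \<open>z\<close> is a leaf, and
  \<open>{w, z}\<close> is a leaf edge, or it has another neighbour \<open>t\<close>, which then is a centre, and \<open>v w z t\<close> is the
  required path.
\<close>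

lemma (in labelled_star_cover) O3_condition_if_private:
  assumes v: "v \<notin> X" "v \<notin> Y"
    and alt: "\<And>y. y \<in> Y \<Longrightarrow> {v, y} \<in> E \<Longrightarrow> \<exists>z. private_nbr E X Y y z \<and> z \<noteq> v"
  shows "O3_condition V E l v"
  unfolding O3_condition_def
proof (intro ballI impI)
  fix e assume "e \<in> incident_edges E v" and le: "l e = L1"
  then have e: "e \<in> E" "v \<in> e" by (auto simp: incident_edges_def)
  obtain w where w: "e = {v, w}" by (rule simple_graph_edgeE[OF simple e])
  have nF: "f \<notin> F" if "a \<in> f" "a \<notin> X" "a \<notin> Y" for f a using star_edge[of f] that by blast
  have "w \<in> Y"
  proof (rule ccontr)
    assume "w \<notin> Y"
    then have "e \<inter> Y = {}" using v w by blast
    then show False using label_L2[OF e(1) nF[OF e(2) v]] le by simp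
  qed
  then obtain z where z: "private_nbr E X Y w z" "z \<noteq> v" using alt e w by blast
  then have zXY: "z \<notin> X" "z \<notin> Y" and wz: "{w, z} \<in> E" and zu: "\<And>y. y \<in> Y \<Longrightarrow> {y, z} \<in> E \<Longrightarrow> y = w"
    by (auto simp: private_nbr_def)
  have zw: "{z, w} \<in> E" using wz by (simp add: insert_commute)
  have ne: "w \<noteq> z" "v \<noteq> w" using simple_graph_edge(1)[OF simple] wz e w by blast+
  show "(\<exists>f. leaf_edge E f \<and> edge_adjacent e f) \<or>
    (\<exists>w x y. is_path V E [v, w, x, y] \<and> e \<in> {{v, w}, {w, x}, {x, y}} \<and>
       l {v, w} = L1 \<and> l {w, x} = L1 \<and> l {x, y} = L2 \<and>
       (\<forall>f \<in> incident_edges E x - {{w, x}}. l f = L2))"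
  proof (cases "is_leaf E z")
    case True
    then have "leaf_edge E {w, z}" using wz by (auto simp: leaf_edge_def)
    moreover have "e \<noteq> {w, z}" using w ne z(2) by (auto simp: doubleton_eq_iff)
    then have "edge_adjacent e {w, z}" using w by (simp add: edge_adjacent_def)
    ultimately show ?thesis by blast
  next
    case False
    obtain t where t: "{z, t} \<in> E" "t \<noteq> w" by (rule nonleaf_other_nbrE[OF simple zw False])
    have L2: "l f = L2" if f: "f \<in> E" "z \<in> f" "f \<noteq> {w, z}" for f
    proof -
      obtain b where b: "f = {z, b}" by (rule simple_graph_edgeE[OF simple f(1,2)])
      then have "{b, z} \<in> E" "b \<noteq> w" using f by (auto simp: insert_commute)
      then have "f \<inter> Y = {}" using b zXY zu by blast
      then show ?thesis by (rule label_L2[OF f(1) nF[OF f(2) zXY]])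
    qed
    have "t \<in> X \<or> t \<in> Y" using cover[OF t(1)] zXY by blast
    then have "t \<noteq> v" using v by blast
    have "is_path V E [v, w, z, t]"
      using e w wz t z(2) ne \<open>t \<noteq> v\<close> simple_graph_edge[OF simple t(1)] simple_graph_edge[OF simple wz]
        simple_graph_edge[OF simple, of v w]
      by (auto simp: is_path_def is_walk_def)
    moreover have "l {w, z} = L1"
    proof (rule label_L1[OF wz])
      show "{w, z} \<notin> F" by (rule nF[OF _ zXY]) simp
      show "{w, z} \<inter> X = {}" "{w, z} \<inter> Y \<noteq> {}" using \<open>w \<in> Y\<close> zXY disjoint by blast+
    qed
    moreover have "l {z, t} = L2"
      using L2[OF t(1)] t(2) ne by (auto simp: doubleton_eq_iff)
    moreover have "\<forall>f \<in> incident_edges E z - {{w, z}}. l f = L2"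
      using L2 by (auto simp: incident_edges_def)
    ultimately show ?thesis using le w
      by (intro disjI2) (rule exI[of _ w], rule exI[of _ z], rule exI[of _ t], simp)
  qed
qed

abbreviation avoiding :: "'a set \<Rightarrow> 'a set set \<Rightarrow> 'a set set" where
  "avoiding U E \<equiv> {e \<in> E. e \<inter> U = {}}"

lemma avoiding_Un:
  assumes "simple_graph V E" "\<forall>e\<in>E2. e \<in> E \<and> e \<inter> U \<noteq> {}" "\<forall>u\<in>U. \<forall>w. {u, w} \<in> E \<longrightarrow> {u, w} \<in> E2"
  shows "avoiding U E \<union> E2 = E"
proof -
  have "e \<in> E2" if e: "e \<in> E" "e \<inter> U \<noteq> {}" for e
  proof -
    obtain u where u: "u \<in> e" "u \<in> U" using e(2) by blast
    obtain w where "e = {u, w}" by (rule simple_graph_edgeE[OF assms(1) e(1) u(1)])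
    then show ?thesis using assms(3) u e(1) by blast
  qed
  then show ?thesis using assms(2) by blast
qed

lemma private_nbr_avoiding:
  "private_nbr E X Y y z \<Longrightarrow> y \<notin> U \<Longrightarrow> z \<notin> U \<Longrightarrow> private_nbr (avoiding U E) (X - U) (Y - U) y z"
  by (simp add: private_nbr_def)

lemma (in star_cover) star_cover_avoiding:
  assumes ray_kept: "\<And>x y. y \<in> Y - U \<Longrightarrow> {x, y} \<in> F \<Longrightarrow> x \<notin> U"
    and rays_kept: "\<And>x. x \<in> X - U \<Longrightarrow> \<exists>y y'. y \<noteq> y' \<and> {x, y} \<in> F \<and> {x, y'} \<in> F \<and> y \<notin> U \<and> y' \<notin> U"
    and private_kept: "\<And>y. y \<in> Y - U \<Longrightarrow> \<exists>z. private_nbr E X Y y z \<and> z \<notin> U"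
  shows "star_cover (avoiding U E) (avoiding U F) (X - U) (Y - U)"
proof
  show "(X - U) \<inter> (Y - U) = {}" using disjoint by blast
  show "avoiding U F \<subseteq> avoiding U E" using stars_subset by blast
  show "\<exists>x\<in>X - U. \<exists>y\<in>Y - U. f = {x, y}" if "f \<in> avoiding U F" for f
  proof -
    have "f \<in> F" "f \<inter> U = {}" using that by auto
    then obtain x y where "x \<in> X" "y \<in> Y" "f = {x, y}" using star_edge by blast
    then show ?thesis using \<open>f \<inter> U = {}\<close> by blast
  qed
  show "\<exists>!x. {x, y} \<in> avoiding U F" if y: "y \<in> Y - U" for y
  proof -
    obtain x where x: "{x, y} \<in> F" using centre y by blast
    then have "{x, y} \<in> avoiding U F" using ray_kept[OF y x] y by simp
    moreover have "x' = x" if "{x', y} \<in> avoiding U F" for x'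
      using centre_unique[of y x x'] that x y by simp
    ultimately show ?thesis by (rule ex1I)
  qed
  show "\<exists>y y'. y \<noteq> y' \<and> {x, y} \<in> avoiding U F \<and> {x, y'} \<in> avoiding U F" if x: "x \<in> X - U" for x
  proof -
    obtain y y' where "y \<noteq> y'" "{x, y} \<in> F" "{x, y'} \<in> F" "y \<notin> U" "y' \<notin> U"
      using rays_kept[OF x] by blast
    then have "{x, y} \<in> avoiding U F" "{x, y'} \<in> avoiding U F" using x by simp_all
    then show ?thesis using \<open>y \<noteq> y'\<close> by blast
  qed
  show "a \<in> X - U \<or> a \<in> Y - U \<or> b \<in> X - U \<or> b \<in> Y - U" if "{a, b} \<in> avoiding U E" for a b
  proof -
    have "{a, b} \<in> E" "a \<notin> U" "b \<notin> U" using that by auto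
    then show ?thesis using cover by blast
  qed
  show "{y, y'} \<notin> avoiding U E" if "y \<in> Y - U" "y' \<in> Y - U" for y y'
    using independent[of y y'] that by simp
  show "\<exists>z. private_nbr (avoiding U E) (X - U) (Y - U) y z" if y: "y \<in> Y - U" for y
  proof -
    obtain z where "private_nbr E X Y y z" "z \<notin> U" using private_kept[OF y] by blast
    then have "private_nbr (avoiding U E) (X - U) (Y - U) y z" using y by (intro private_nbr_avoiding) simp_all
    then show ?thesis by blast
  qed
qed

text \<open>
  The labelling is existentially quantified because \<open>F\<close>, \<open>X\<close> and \<open>Y\<close> do not determine it. The star cover
  is a parameter because it tells which vertices of the smaller tree lie in \<open>A\<^sub>1\<close> and \<open>A\<^sub>2\<close>.
\<close>

definition constructible :: "'a set \<Rightarrow> 'a set set \<Rightarrow> 'a set set \<Rightarrow> 'a set \<Rightarrow> 'a set \<Rightarrow> bool" where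
  "constructible V E F X Y \<longleftrightarrow> (\<exists>l. family_Tt V E l \<and> labelled_star_cover E F X Y V l)"

text \<open>
  The assumption \<open>smaller\<close> is the induction hypothesis: whatever can be cut off from the tree so that a
  tree with a star cover remains, the rest is constructible.
\<close>

locale reducible_star_cover = graph_star_cover +
  assumes tree: "is_tree V E"
    and smaller: "U \<inter> V \<noteq> {} \<Longrightarrow> is_tree (V - U) (avoiding U E) \<Longrightarrow> avoiding U E \<noteq> {} \<Longrightarrow>
      star_cover (avoiding U E) (avoiding U F) (X - U) (Y - U) \<Longrightarrow>
      constructible (V - U) (avoiding U E) (avoiding U F) (X - U) (Y - U)"
begin

lemma edge_sym: "{a, b} \<in> E \<longleftrightarrow> {b, a} \<in> E"
  by (simp add: insert_commute)

lemma F_nbr: "{a, b} \<in> F \<Longrightarrow> {a, b} \<in> E \<and> {b, a} \<in> E"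
  using stars_subset by (auto simp: insert_commute)

lemma simple_F: "simple_graph V F"
  using simple stars_subset unfolding simple_graph_def by blast

lemma X_ray: "x \<in> X \<Longrightarrow> {x, y} \<in> F \<Longrightarrow> y \<in> Y"
  using star_edge_cases[of x y] disjoint by blast

lemma Y_centre: "y \<in> Y \<Longrightarrow> {x, y} \<in> F \<Longrightarrow> x \<in> X"
  using star_edge_cases[of x y] disjoint by blast

lemma not_F:
  assumes "a \<notin> X" "a \<notin> Y"
  shows "{a, b} \<notin> F"
proof
  assume "{a, b} \<in> F"
  then show False by (rule star_edge_cases) (use assms in blast)+
qed

text \<open>
  Removing a set \<open>U\<close> that contains exactly one star, with two rays, and adding the star again changes
  nothing.
\<close>

lemma star_restored:
  assumes c: "c \<in> X" and ab: "{a, c} \<in> F" "{c, b} \<in> F" and only: "\<forall>w. {c, w} \<in> F \<longrightarrow> w = a \<or> w = b"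
    and U: "U \<inter> (X \<union> Y) = {c, a, b}"
  shows "avoiding U F \<union> {{a, c}, {c, b}} = F" "X - U \<union> {c} = X" "Y - U \<union> {a, b} = Y"
proof -
  have ca: "{c, a} \<in> F" using ab(1) by (simp add: insert_commute)
  have Y: "a \<in> Y" "b \<in> Y" using X_ray[OF c ca] X_ray[OF c ab(2)] .
  show "X - U \<union> {c} = X" using c Y U disjoint by blast
  show "Y - U \<union> {a, b} = Y" using c Y U disjoint by blast
  show "avoiding U F \<union> {{a, c}, {c, b}} = F"
  proof (rule avoiding_Un[OF simple_F])
    show "\<forall>e\<in>{{a, c}, {c, b}}. e \<in> F \<and> e \<inter> U \<noteq> {}" using ab U by blast
    show "\<forall>u\<in>U. \<forall>w. {u, w} \<in> F \<longrightarrow> {u, w} \<in> {{a, c}, {c, b}}"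
    proof (intro ballI allI impI)
      fix u w assume u: "u \<in> U" and uw: "{u, w} \<in> F"
      have wu: "{w, u} \<in> F" using uw by (simp add: insert_commute)
      have "u \<in> X \<union> Y" using not_F uw by blast
      then consider "u = c" | "u = a" | "u = b" using u U by blast
      then show "{u, w} \<in> {{a, c}, {c, b}}"
      proof cases
        case 1
        then have "w = a \<or> w = b" using only uw by blast
        then show ?thesis using 1 by (auto simp: insert_commute)
      next
        case 2
        then have "w = c" using centre_unique[OF Y(1) ca] wu by blast
        then show ?thesis using 2 by simp
      next
        case 3
        then have "w = c" using centre_unique[OF Y(2) ab(2)] wu by blast
        then show ?thesis using 3 by (simp add: insert_commute)
      qed
    qed
  qed
qed

text \<open>
  A part \<open>U\<close> that is attached to the rest by one edge \<open>{a, v}\<close> outside \<open>F\<close> can be cut off if \<open>a\<close> lies on a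
  star: no star is cut, and no vertex of \<open>U\<close> is a private neighbour of a vertex outside \<open>U\<close>. The edge
  \<open>{v, r}\<close> ensures that an edge remains.
\<close>

lemma link_deletion:
  assumes closed: "\<And>u w. u \<in> U \<Longrightarrow> {u, w} \<in> E \<Longrightarrow> w \<in> U \<or> u = a \<and> w = v"
    and a: "a \<in> X \<union> Y" "a \<in> U" and v: "v \<notin> U" "{a, v} \<in> E" "{a, v} \<notin> F"
    and r: "{v, r} \<in> E" "r \<noteq> a"
  shows "constructible (V - U) (avoiding U E) (avoiding U F) (X - U) (Y - U)"
proof (rule smaller)
  have vV: "v \<in> V" "a \<in> V" using simple_graph_edge[OF simple v(2)] by auto
  show "U \<inter> V \<noteq> {}" using a(2) vV by blast
  show "is_tree (V - U) (avoiding U E)"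
    by (rule tree_delete[OF tree vV(1) v(1)]) (use closed in blast)
  have "r \<notin> U" using closed[of r v] r v(1) edge_sym by blast
  then have "{v, r} \<in> avoiding U E" using r(1) v(1) by simp
  then show "avoiding U E \<noteq> {}" by blast
  show "star_cover (avoiding U E) (avoiding U F) (X - U) (Y - U)"
  proof (rule star_cover_avoiding)
    show "x \<notin> U" if "y \<in> Y - U" "{x, y} \<in> F" for x y
      using closed[of x y] F_nbr[OF that(2)] that v(3) by blast
    show "\<exists>y y'. y \<noteq> y' \<and> {x, y} \<in> F \<and> {x, y'} \<in> F \<and> y \<notin> U \<and> y' \<notin> U" if x: "x \<in> X - U" for x
    proof -
      have "y \<notin> U" if y: "{x, y} \<in> F" for y
      proof
        assume "y \<in> U"
        then have "y = a \<and> x = v" using closed[of y x] F_nbr[OF y] x by blast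
        then show False using y v(3) by (simp add: insert_commute)
      qed
      then show ?thesis using rays[of x] x by blast
    qed
    show "\<exists>z. private_nbr E X Y y z \<and> z \<notin> U" if y: "y \<in> Y - U" for y
    proof -
      obtain z where z: "private_nbr E X Y y z" using has_private y by blast
      then have "{z, y} \<in> E" "z \<notin> X \<union> Y" by (auto simp: private_nbr_def insert_commute)
      then have "z \<notin> U" using closed[of z y] y a(1) by blast
      then show ?thesis using z by blast
    qed
  qed
qed

lemma constructible_O1:
  assumes v: "v \<in> X \<union> Y" and u: "\<And>w. {u, w} \<in> E \<longleftrightarrow> w = v" and uXY: "u \<notin> X \<union> Y"
    and alt: "\<And>y. y \<in> Y \<Longrightarrow> \<exists>z. private_nbr E X Y y z \<and> z \<noteq> u"
  shows "constructible V E F X Y"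
proof -
  let ?U = "{u}"
  have uv: "{u, v} \<in> E" using u by blast
  then have V: "u \<in> V" "v \<in> V" "u \<noteq> v" using simple_graph_edge[OF simple] by auto
  have nbr: "w \<noteq> u" if "{x, w} \<in> F" for x w using not_F[of u x] uXY that by (auto simp: insert_commute)
  have Fu: "f \<inter> ?U = {}" if "f \<in> F" for f using star_edge[OF that] uXY by blast
  have "constructible (V - ?U) (avoiding ?U E) (avoiding ?U F) (X - ?U) (Y - ?U)"
  proof (rule smaller)
    show "?U \<inter> V \<noteq> {}" using V by blast
    show "is_tree (V - ?U) (avoiding ?U E)"
      by (rule tree_delete[OF tree V(2)]) (use u V in auto)
    have "F \<noteq> {}" using v rays[of v] centre[of v] by blast
    then show "avoiding ?U E \<noteq> {}" using Fu stars_subset by blast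
    show "star_cover (avoiding ?U E) (avoiding ?U F) (X - ?U) (Y - ?U)"
    proof (rule star_cover_avoiding)
      show "x \<notin> ?U" if "y \<in> Y - ?U" "{x, y} \<in> F" for x y using Fu[OF that(2)] by blast
      show "\<exists>y y'. y \<noteq> y' \<and> {x, y} \<in> F \<and> {x, y'} \<in> F \<and> y \<notin> ?U \<and> y' \<notin> ?U" if "x \<in> X - ?U" for x
        using rays[of x] that nbr by blast
      show "\<exists>z. private_nbr E X Y y z \<and> z \<notin> ?U" if "y \<in> Y - ?U" for y using alt that by blast
    qed
  qed
  moreover have "avoiding ?U F = F" using Fu by blast
  moreover have "X - ?U = X" "Y - ?U = Y" using uXY by auto
  ultimately obtain l where l: "family_Tt (V - ?U) (avoiding ?U E) l"
    "labelled_star_cover (avoiding ?U E) F X Y (V - ?U) l"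
    unfolding constructible_def by auto
  interpret T: labelled_star_cover "avoiding ?U E" F X Y "V - ?U" l by (rule l(2))
  have vA: "v \<in> set_A1 (V - ?U) (avoiding ?U E) l \<union> set_A2 (V - ?U) (avoiding ?U E) l"
    using v T.set_A1_eq T.set_A2_eq by blast
  have "avoiding ?U E \<union> {{v, u}} = E"
  proof (rule avoiding_Un[OF simple])
    show "\<forall>e\<in>{{v, u}}. e \<in> E \<and> e \<inter> ?U \<noteq> {}" using uv by (simp add: insert_commute)
    show "\<forall>a\<in>?U. \<forall>w. {a, w} \<in> E \<longrightarrow> {a, w} \<in> {{v, u}}" using u by (simp add: insert_commute)
  qed
  moreover have "V - ?U \<union> {u} = V" using V by blast
  ultimately show ?thesis
    using family_Tt.O1[OF l(1) vA, of u] T.extend_O1[OF vA, of u] unfolding constructible_def by auto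
qed

lemma constructible_O2:
  assumes x: "x \<in> X" and y: "{x, y} \<in> F" and Ny: "\<And>w. {y, w} \<in> E \<longleftrightarrow> w = x \<or> w = z"
    and Nz: "\<And>w. {z, w} \<in> E \<longleftrightarrow> w = y"
    and rays2: "\<exists>y1 y2. y1 \<noteq> y2 \<and> {x, y1} \<in> F \<and> {x, y2} \<in> F \<and> y1 \<noteq> y \<and> y2 \<noteq> y"
  shows "constructible V E F X Y"
proof -
  let ?U = "{y, z}"
  have yY: "y \<in> Y" by (rule X_ray[OF x y])
  have yx: "{y, x} \<in> E" "{x, y} \<in> E" using F_nbr[OF y] by auto
  have yz: "{y, z} \<in> E" using Ny by blast
  have V: "x \<in> V" "y \<in> V" "z \<in> V" "y \<noteq> z" "x \<noteq> y"
    using simple_graph_edge[OF simple yx(2)] simple_graph_edge[OF simple yz] by auto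
  have xz: "x \<noteq> z"
  proof
    assume "x = z"
    then show False using rays2 F_nbr Nz by blast
  qed
  have zXY: "z \<notin> X \<union> Y"
  proof
    assume "z \<in> X \<union> Y"
    then have "\<not> is_leaf E z" by (rule not_leaf)
    then show False using Nz is_leaf_iff[OF simple] by blast
  qed
  have FU: "a = x \<and> b = y" if "{a, b} \<in> F" "b \<in> ?U" for a b
  proof -
    have "b \<noteq> z" using not_F[of z a] zXY that(1) by (auto simp: insert_commute)
    then have "b = y" using that(2) by blast
    then show ?thesis using centre_unique[OF yY y] that(1) by blast
  qed
  have con: "constructible (V - ?U) (avoiding ?U E) (avoiding ?U F) (X - ?U) (Y - ?U)"
  proof (rule smaller)
    show "?U \<inter> V \<noteq> {}" using V by blast
    show "is_tree (V - ?U) (avoiding ?U E)"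
      by (rule tree_delete[OF tree V(1)]) (use Ny Nz V xz in auto)
    obtain y1 where "{x, y1} \<in> F" "y1 \<noteq> y" using rays2 by blast
    then have "{x, y1} \<in> avoiding ?U E" using F_nbr[of x y1] FU[of x y1] V xz by auto
    then show "avoiding ?U E \<noteq> {}" by blast
    show "star_cover (avoiding ?U E) (avoiding ?U F) (X - ?U) (Y - ?U)"
    proof (rule star_cover_avoiding)
      show "a \<notin> ?U" if b: "b \<in> Y - ?U" "{a, b} \<in> F" for a b
      proof
        assume "a \<in> ?U"
        then have "b = x" using FU[of b a] b(2) by (simp add: insert_commute)
        then show False using b(1) x disjoint by blast
      qed
      show "\<exists>b b'. b \<noteq> b' \<and> {a, b} \<in> F \<and> {a, b'} \<in> F \<and> b \<notin> ?U \<and> b' \<notin> ?U" if a: "a \<in> X - ?U" for a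
      proof (cases "a = x")
        case True
        obtain y1 y2 where "y1 \<noteq> y2" "{x, y1} \<in> F" "{x, y2} \<in> F" "y1 \<noteq> y" "y2 \<noteq> y" using rays2 by blast
        moreover have "y1 \<notin> ?U" "y2 \<notin> ?U" using calculation FU by blast+
        ultimately show ?thesis using True by blast
      next
        case False
        then have "b \<notin> ?U" if "{a, b} \<in> F" for b using FU that by blast
        then show ?thesis using rays[of a] a by blast
      qed
      show "\<exists>c. private_nbr E X Y b c \<and> c \<notin> ?U" if b: "b \<in> Y - ?U" for b
      proof -
        obtain c where c: "private_nbr E X Y b c" using has_private b by blast
        then have "{c, b} \<in> E" "c \<notin> X \<union> Y" by (auto simp: private_nbr_def insert_commute)
        then have "c \<notin> ?U" using Nz yY b by blast
        then show ?thesis using c by blast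
      qed
    qed
  qed
  then obtain l where l: "family_Tt (V - ?U) (avoiding ?U E) l"
    "labelled_star_cover (avoiding ?U E) (avoiding ?U F) (X - ?U) (Y - ?U) (V - ?U) l"
    unfolding constructible_def by auto
  interpret T: labelled_star_cover "avoiding ?U E" "avoiding ?U F" "X - ?U" "Y - ?U" "V - ?U" l by (rule l(2))
  have xA: "x \<in> set_A2 (V - ?U) (avoiding ?U E) l" using x V xz T.set_A2_eq by blast
  have d: "distinct [y, z]" "{y, z} \<inter> (V - ?U) = {}" using V by auto
  have E: "avoiding ?U E \<union> {{x, y}, {y, z}} = E"
  proof (rule avoiding_Un[OF simple])
    show "\<forall>e\<in>{{x, y}, {y, z}}. e \<in> E \<and> e \<inter> ?U \<noteq> {}" using yx yz by simp
    show "\<forall>a\<in>?U. \<forall>w. {a, w} \<in> E \<longrightarrow> {a, w} \<in> {{x, y}, {y, z}}"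
      using Ny Nz by (simp add: insert_commute)
  qed
  have F: "avoiding ?U F \<union> {{x, y}} = F"
  proof (rule avoiding_Un[OF simple_F])
    show "\<forall>e\<in>{{x, y}}. e \<in> F \<and> e \<inter> ?U \<noteq> {}" using y by simp
    show "\<forall>a\<in>?U. \<forall>w. {a, w} \<in> F \<longrightarrow> {a, w} \<in> {{x, y}}"
    proof (intro ballI allI impI)
      fix a w assume "a \<in> ?U" "{a, w} \<in> F"
      then have "w = x \<and> a = y" using FU[of w a] by (simp add: insert_commute)
      then show "{a, w} \<in> {{x, y}}" by (simp add: insert_commute)
    qed
  qed
  have sets: "V - ?U \<union> {y, z} = V" "X - ?U \<union> {} = X" "Y - ?U \<union> {y} = Y"
    using V zXY yY disjoint by auto
  show ?thesis
    using family_Tt.O2[OF l(1) xA d] T.extend_O2[OF xA d] unfolding constructible_def E F sets by blast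
qed

lemma constructible_O3:
  assumes u3: "u3 \<in> X" and F: "{u2, u3} \<in> F" "{u3, u4} \<in> F" and v: "{v, u2} \<notin> F"
    and N: "\<And>w. {u1, w} \<in> E \<longleftrightarrow> w = u2" "\<And>w. {u2, w} \<in> E \<longleftrightarrow> w = u1 \<or> w = u3 \<or> w = v"
      "\<And>w. {u3, w} \<in> E \<longleftrightarrow> w = u2 \<or> w = u4" "\<And>w. {u4, w} \<in> E \<longleftrightarrow> w = u3 \<or> w = u5"
      "\<And>w. {u5, w} \<in> E \<longleftrightarrow> w = u4"
    and d: "distinct [u1, u2, u3, u4, u5]" and vU: "v \<notin> {u1, u2, u3, u4, u5}"
    and r: "{v, r} \<in> E" "r \<noteq> u2"
  shows "constructible V E F X Y"
proof -
  let ?U = "{u1, u2, u3, u4, u5}"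
  have F': "{u3, u2} \<in> F" "{u4, u3} \<in> F" using F by (simp_all add: insert_commute)
  have Y: "u2 \<in> Y" "u4 \<in> Y" using X_ray[OF u3] F F' by auto
  have e: "{u1, u2} \<in> E" "{u2, u3} \<in> E" "{u3, u4} \<in> E" "{u4, u5} \<in> E" "{u2, v} \<in> E" "{v, u2} \<in> E"
    using N edge_sym by blast+
  have V: "?U \<subseteq> V" "v \<in> V"
    using simple_graph_edge[OF simple e(1)] simple_graph_edge[OF simple e(2)] simple_graph_edge[OF simple e(3)]
      simple_graph_edge[OF simple e(4)] simple_graph_edge[OF simple e(5)] by auto
  have out: "u1 \<notin> X \<union> Y" "u5 \<notin> X \<union> Y"
    using not_leaf[of u1] not_leaf[of u5] is_leaf_iff[OF simple] N(1,5) by blast+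
  have "constructible (V - ?U) (avoiding ?U E) (avoiding ?U F) (X - ?U) (Y - ?U)"
  proof (rule link_deletion[where a = u2 and v = v])
    show "w \<in> ?U \<or> u = u2 \<and> w = v" if "u \<in> ?U" "{u, w} \<in> E" for u w
      using that N by auto
  qed (use Y vU e v r in \<open>auto simp: insert_commute\<close>)
  then obtain l where l: "family_Tt (V - ?U) (avoiding ?U E) l"
    "labelled_star_cover (avoiding ?U E) (avoiding ?U F) (X - ?U) (Y - ?U) (V - ?U) l"
    unfolding constructible_def by auto
  interpret T: labelled_star_cover "avoiding ?U E" "avoiding ?U F" "X - ?U" "Y - ?U" "V - ?U" l by (rule l(2))
  have vY: "v \<notin> Y" using independent[OF _ Y(1)] e(6) by blast
  have v1: "v \<in> V - ?U" "v \<notin> set_A1 (V - ?U) (avoiding ?U E) l"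
    using V vU vY T.set_A1_eq by auto
  have v2: "v \<in> set_C (V - ?U) (avoiding ?U E) l \<longrightarrow> O3_condition (V - ?U) (avoiding ?U E) l v"
  proof
    assume "v \<in> set_C (V - ?U) (avoiding ?U E) l"
    then have vX: "v \<notin> X - ?U" "v \<notin> Y - ?U" using T.set_C_iff by blast+
    show "O3_condition (V - ?U) (avoiding ?U E) l v"
    proof (rule T.O3_condition_if_private[OF vX])
      fix y assume y: "y \<in> Y - ?U"
      obtain z where z: "private_nbr (avoiding ?U E) (X - ?U) (Y - ?U) y z" "z \<noteq> v"
      proof -
        obtain z where z: "private_nbr E X Y y z" using has_private y by blast
        then have zy: "{z, y} \<in> E" "{y, z} \<in> E" "z \<notin> X \<union> Y" and zu: "\<And>y'. y' \<in> Y \<Longrightarrow> {y', z} \<in> E \<Longrightarrow> y' = y"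
          by (auto simp: private_nbr_def insert_commute)
        have "z \<noteq> v" using zu[OF Y(1)] e(5) y by blast
        have "z \<notin> ?U" using N zy(1,3) Y u3 y vY by blast
        with z have "private_nbr (avoiding ?U E) (X - ?U) (Y - ?U) y z"
          using y by (intro private_nbr_avoiding) blast+
        then show ?thesis using that \<open>z \<noteq> v\<close> by blast
      qed
      then show "\<exists>z. private_nbr (avoiding ?U E) (X - ?U) (Y - ?U) y z \<and> z \<noteq> v" by blast
    qed
  qed
  have dU: "?U \<inter> (V - ?U) = {}" by blast
  have E: "avoiding ?U E \<union> {{u1, u2}, {u2, u3}, {u3, u4}, {u4, u5}, {v, u2}} = E"
  proof (rule avoiding_Un[OF simple])
    show "\<forall>e\<in>{{u1, u2}, {u2, u3}, {u3, u4}, {u4, u5}, {v, u2}}. e \<in> E \<and> e \<inter> ?U \<noteq> {}" using e by simp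
    show "\<forall>a\<in>?U. \<forall>w. {a, w} \<in> E \<longrightarrow> {a, w} \<in> {{u1, u2}, {u2, u3}, {u3, u4}, {u4, u5}, {v, u2}}"
      using N by (auto simp: insert_commute)
  qed
  have only: "\<forall>w. {u3, w} \<in> F \<longrightarrow> w = u2 \<or> w = u4" using F_nbr N(3) by blast
  have UXY: "?U \<inter> (X \<union> Y) = {u3, u2, u4}" using out Y u3 by auto
  note R = star_restored[OF u3 F only UXY]
  have V': "V - ?U \<union> ?U = V" using V by blast
  show ?thesis
    using family_Tt.O3[OF l(1) v1 v2 d dU] T.extend_O3[OF v1 v2 d dU]
    unfolding constructible_def E R V' by (intro exI conjI)
qed

lemma constructible_O4:
  assumes u2: "u2 \<in> X" and F: "{u1, u2} \<in> F" "{u2, u3} \<in> F" and v: "private_nbr E X Y u1 v"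
    and N: "\<And>w. {u1, w} \<in> E \<longleftrightarrow> w = u2 \<or> w = v" "\<And>w. {u2, w} \<in> E \<longleftrightarrow> w = u1 \<or> w = u3"
      "\<And>w. {u3, w} \<in> E \<longleftrightarrow> w = u2 \<or> w = u4" "\<And>w. {u4, w} \<in> E \<longleftrightarrow> w = u3"
    and d: "distinct [u1, u2, u3, u4]" and vU: "v \<notin> {u1, u2, u3, u4}"
    and r: "{v, r} \<in> E" "r \<noteq> u1"
  shows "constructible V E F X Y"
proof -
  let ?U = "{u1, u2, u3, u4}"
  have F': "{u2, u1} \<in> F" "{u3, u2} \<in> F" using F by (simp_all add: insert_commute)
  have Y: "u1 \<in> Y" "u3 \<in> Y" using X_ray[OF u2] F F' by auto
  have e: "{u1, u2} \<in> E" "{u2, u3} \<in> E" "{u3, u4} \<in> E" "{u1, v} \<in> E" "{v, u1} \<in> E"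
    using N edge_sym by blast+
  have V: "?U \<subseteq> V" "v \<in> V"
    using simple_graph_edge[OF simple e(1)] simple_graph_edge[OF simple e(2)] simple_graph_edge[OF simple e(3)]
      simple_graph_edge[OF simple e(4)] by auto
  have out: "u4 \<notin> X \<union> Y" using not_leaf[of u4] is_leaf_iff[OF simple] N(4) by blast
  have vXY: "v \<notin> X" "v \<notin> Y" and vu: "\<And>y. y \<in> Y \<Longrightarrow> {y, v} \<in> E \<Longrightarrow> y = u1"
    using v by (auto simp: private_nbr_def)
  have vF: "{u1, v} \<notin> F" using not_F[OF vXY, of u1] by (simp add: insert_commute)
  have "constructible (V - ?U) (avoiding ?U E) (avoiding ?U F) (X - ?U) (Y - ?U)"
  proof (rule link_deletion[where a = u1 and v = v])
    show "w \<in> ?U \<or> u = u1 \<and> w = v" if "u \<in> ?U" "{u, w} \<in> E" for u w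
      using that N by auto
  qed (use Y vU e vF r in \<open>auto simp: insert_commute\<close>)
  then obtain l where l: "family_Tt (V - ?U) (avoiding ?U E) l"
    "labelled_star_cover (avoiding ?U E) (avoiding ?U F) (X - ?U) (Y - ?U) (V - ?U) l"
    unfolding constructible_def by auto
  interpret T: labelled_star_cover "avoiding ?U E" "avoiding ?U F" "X - ?U" "Y - ?U" "V - ?U" l by (rule l(2))
  have "{v, y} \<notin> avoiding ?U E" if y: "y \<in> Y - ?U" for y
  proof
    assume "{v, y} \<in> avoiding ?U E"
    then have "{y, v} \<in> E" by (simp add: insert_commute)
    then show False using vu y by blast
  qed
  then have v1: "v \<in> set_B (V - ?U) (avoiding ?U E) l" using T.set_B_iff V vU vXY by blast
  have dU: "?U \<inter> (V - ?U) = {}" by blast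
  have E: "avoiding ?U E \<union> {{u1, u2}, {u2, u3}, {u3, u4}, {v, u1}} = E"
  proof (rule avoiding_Un[OF simple])
    show "\<forall>e\<in>{{u1, u2}, {u2, u3}, {u3, u4}, {v, u1}}. e \<in> E \<and> e \<inter> ?U \<noteq> {}" using e by simp
    show "\<forall>a\<in>?U. \<forall>w. {a, w} \<in> E \<longrightarrow> {a, w} \<in> {{u1, u2}, {u2, u3}, {u3, u4}, {v, u1}}"
      using N by (auto simp: insert_commute)
  qed
  have only: "\<forall>w. {u2, w} \<in> F \<longrightarrow> w = u1 \<or> w = u3" using F_nbr N(2) by blast
  have UXY: "?U \<inter> (X \<union> Y) = {u2, u1, u3}" using out Y u2 by auto
  note R = star_restored[OF u2 F only UXY]
  have V': "V - ?U \<union> ?U = V" using V by blast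
  show ?thesis
    using family_Tt.O4[OF l(1) v1 d dU] T.extend_O4[OF v1 d dU]
    unfolding constructible_def E R V' by (intro exI conjI)
qed

lemma constructible_O5:
  assumes u3: "u3 \<in> X" and F: "{u2, u3} \<in> F" "{u3, u4} \<in> F" and v: "{u3, v} \<notin> F"
    and N: "\<And>w. {u1, w} \<in> E \<longleftrightarrow> w = u2" "\<And>w. {u2, w} \<in> E \<longleftrightarrow> w = u1 \<or> w = u3"
      "\<And>w. {u3, w} \<in> E \<longleftrightarrow> w = u2 \<or> w = u4 \<or> w = v" "\<And>w. {u4, w} \<in> E \<longleftrightarrow> w = u3 \<or> w = u5"
      "\<And>w. {u5, w} \<in> E \<longleftrightarrow> w = u4"
    and d: "distinct [u1, u2, u3, u4, u5]" and vU: "v \<notin> {u1, u2, u3, u4, u5}"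
    and r: "{v, r} \<in> E" "r \<noteq> u3"
  shows "constructible V E F X Y"
proof -
  let ?U = "{u1, u2, u3, u4, u5}"
  have F': "{u3, u2} \<in> F" "{u4, u3} \<in> F" using F by (simp_all add: insert_commute)
  have Y: "u2 \<in> Y" "u4 \<in> Y" using X_ray[OF u3] F F' by auto
  have e: "{u1, u2} \<in> E" "{u2, u3} \<in> E" "{u3, u4} \<in> E" "{u4, u5} \<in> E" "{u3, v} \<in> E" "{v, u3} \<in> E"
    using N edge_sym by blast+
  have V: "?U \<subseteq> V" "v \<in> V"
    using simple_graph_edge[OF simple e(1)] simple_graph_edge[OF simple e(2)] simple_graph_edge[OF simple e(3)]
      simple_graph_edge[OF simple e(4)] simple_graph_edge[OF simple e(5)] by auto
  have out: "u1 \<notin> X \<union> Y" "u5 \<notin> X \<union> Y"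
    using not_leaf[of u1] not_leaf[of u5] is_leaf_iff[OF simple] N(1,5) by blast+
  have "constructible (V - ?U) (avoiding ?U E) (avoiding ?U F) (X - ?U) (Y - ?U)"
  proof (rule link_deletion[where a = u3 and v = v])
    show "w \<in> ?U \<or> u = u3 \<and> w = v" if "u \<in> ?U" "{u, w} \<in> E" for u w
      using that N by auto
  qed (use u3 vU e v r in \<open>auto simp: insert_commute\<close>)
  then obtain l where l: "family_Tt (V - ?U) (avoiding ?U E) l"
    "labelled_star_cover (avoiding ?U E) (avoiding ?U F) (X - ?U) (Y - ?U) (V - ?U) l"
    unfolding constructible_def by auto
  interpret T: labelled_star_cover "avoiding ?U E" "avoiding ?U F" "X - ?U" "Y - ?U" "V - ?U" l by (rule l(2))
  have v1: "v \<in> V - ?U" using V vU by blast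
  have dU: "?U \<inter> (V - ?U) = {}" by blast
  have E: "avoiding ?U E \<union> {{u1, u2}, {u2, u3}, {u3, u4}, {u4, u5}, {v, u3}} = E"
  proof (rule avoiding_Un[OF simple])
    show "\<forall>e\<in>{{u1, u2}, {u2, u3}, {u3, u4}, {u4, u5}, {v, u3}}. e \<in> E \<and> e \<inter> ?U \<noteq> {}" using e by simp
    show "\<forall>a\<in>?U. \<forall>w. {a, w} \<in> E \<longrightarrow> {a, w} \<in> {{u1, u2}, {u2, u3}, {u3, u4}, {u4, u5}, {v, u3}}"
      using N by (auto simp: insert_commute)
  qed
  have only: "\<forall>w. {u3, w} \<in> F \<longrightarrow> w = u2 \<or> w = u4" using F_nbr N(3) v by blast
  have UXY: "?U \<inter> (X \<union> Y) = {u3, u2, u4}" using out Y u3 by auto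
  note R = star_restored[OF u3 F only UXY]
  have V': "V - ?U \<union> ?U = V" using V by blast
  show ?thesis
    using family_Tt.O5[OF l(1) v1 d dU] T.extend_O5[OF v1 d dU]
    unfolding constructible_def E R V' by (intro exI conjI)
qed

text \<open>
  A path with five vertices is an initial tree.
\<close>

lemma constructible_P5:
  assumes x: "x \<in> X" and F: "{x, y1} \<in> F" "{x, y2} \<in> F"
    and N: "\<And>w. {z1, w} \<in> E \<longleftrightarrow> w = y1" "\<And>w. {y1, w} \<in> E \<longleftrightarrow> w = x \<or> w = z1"
      "\<And>w. {x, w} \<in> E \<longleftrightarrow> w = y1 \<or> w = y2" "\<And>w. {y2, w} \<in> E \<longleftrightarrow> w = x \<or> w = z2"
      "\<And>w. {z2, w} \<in> E \<longleftrightarrow> w = y2"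
    and d: "distinct [z1, y1, x, y2, z2]"
  shows "constructible V E F X Y"
proof -
  let ?U = "{z1, y1, x, y2, z2}"
  have Y: "y1 \<in> Y" "y2 \<in> Y" using X_ray[OF x] F by auto
  have e: "{z1, y1} \<in> E" "{y1, x} \<in> E" "{x, y2} \<in> E" "{y2, z2} \<in> E" using N edge_sym by blast+
  have sub: "?U \<subseteq> V"
    using simple_graph_edge[OF simple e(1)] simple_graph_edge[OF simple e(2)] simple_graph_edge[OF simple e(3)]
      simple_graph_edge[OF simple e(4)] by auto
  have V: "?U = V"
  proof (rule tree_closed_set[OF tree sub, of x])
    show "x \<in> ?U" by simp
    show "w \<in> ?U" if "u \<in> ?U" "{u, w} \<in> E" for u w using that N by auto
  qed
  have leaf: "is_leaf E z1" "is_leaf E z2" using is_leaf_iff[OF simple] N(1,5) by blast+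
  have nonleaf: "\<not> is_leaf E y1" "\<not> is_leaf E y2" "\<not> is_leaf E x" using not_leaf x Y by blast+
  have out: "z1 \<notin> X \<union> Y" "z2 \<notin> X \<union> Y" using not_leaf leaf by blast+
  have UXY: "?U \<inter> (X \<union> Y) = {x, y1, y2}" using out Y x by auto
  have only: "\<forall>w. {x, w} \<in> F \<longrightarrow> w = y1 \<or> w = y2" using F_nbr N(3) by blast
  have F1: "{y1, x} \<in> F" using F(1) by (simp add: insert_commute)
  note R = star_restored[OF x F1 F(2) only UXY]
  have "avoiding ?U F = {}"
  proof -
    have "f \<inter> ?U \<noteq> {}" if "f \<in> F" for f using star_edge[OF that] stars_in V by blast
    then show ?thesis by blast
  qed
  then have Feq: "F = {{y1, x}, {x, y2}}" using R(1) by (simp only: Un_empty_left)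
  have "avoiding ?U E \<union> {{z1, y1}, {y1, x}, {x, y2}, {y2, z2}} = E"
  proof (rule avoiding_Un[OF simple])
    show "\<forall>e\<in>{{z1, y1}, {y1, x}, {x, y2}, {y2, z2}}. e \<in> E \<and> e \<inter> ?U \<noteq> {}" using e by simp
    show "\<forall>a\<in>?U. \<forall>w. {a, w} \<in> E \<longrightarrow> {a, w} \<in> {{z1, y1}, {y1, x}, {x, y2}, {y2, z2}}"
      using N by (auto simp: insert_commute)
  qed
  moreover have "avoiding ?U E = {}"
  proof -
    have "f \<inter> ?U \<noteq> {}" if "f \<in> E" for f
      using simple that unfolding V simple_graph_def by (metis card.empty inf.absorb1 zero_neq_numeral)
    then show ?thesis by blast
  qed
  ultimately have Eeq: "E = {{z1, y1}, {y1, x}, {x, y2}, {y2, z2}}" by (simp only: Un_empty_left)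
  have nl: "{f \<in> E. \<not> leaf_edge E f} = F"
  proof -
    have "leaf_edge E {z1, y1}" "leaf_edge E {y2, z2}" using leaf e by (auto simp: leaf_edge_def)
    have "\<not> leaf_edge E {y1, x}" "\<not> leaf_edge E {x, y2}" using nonleaf by (auto simp: leaf_edge_def)
    then have "\<not> leaf_edge E f" if "f \<in> F" for f using that Feq by blast
    moreover have "f = {z1, y1} \<or> f \<in> F \<or> f = {y2, z2}" if "f \<in> E" for f
      using that Eeq Feq by blast
    then have "f \<in> F" if "f \<in> E" "\<not> leaf_edge E f" for f
      using that \<open>leaf_edge E {z1, y1}\<close> \<open>leaf_edge E {y2, z2}\<close> by metis
    ultimately show ?thesis using stars_subset by blast
  qed
  have diam: "graph_diameter V E = 4"
  proof (rule antisym)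
    have "is_path V E [z1, y1, x, y2, z2]"
      using sub e d by (auto simp: is_path_def is_walk_def)
    from path_length_le_diameter[OF tree this] show "4 \<le> graph_diameter V E" by simp
    obtain p where p: "is_path V E p" "length p = Suc (graph_diameter V E)"
      by (rule diameter_pathE[OF tree])
    have "finite V" using simple by (simp add: simple_graph_def)
    from path_length_le[OF this p(1)] have "Suc (graph_diameter V E) \<le> card ?U" using p(2) V by simp
    also have "card ?U = 5" using d by simp
    finally show "graph_diameter V E \<le> 4" by simp
  qed
  define l where "l = (\<lambda>e. if \<not> leaf_edge E e then S
        else if card {f \<in> E. \<not> leaf_edge E f \<and> edge_adjacent e f} \<ge> 2 then L2 else L1)"
  have "initial_labelled_tree V E l"
    unfolding initial_labelled_tree_def l_def using tree diam by simp
  then have "family_Tt V E l" by (rule family_Tt.init)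
  moreover have "labelled_star_cover E F X Y V l"
  proof (intro labelled_star_cover.intro labelled_star_cover_axioms.intro)
    show "graph_star_cover E F X Y V" by (rule graph_star_cover_axioms)
    show "l e = S \<longleftrightarrow> e \<in> F" if "e \<in> E" for e using nl that unfolding l_def by auto
    show "l e = (if e \<inter> Y = {} then L2 else L1)" if e': "e \<in> E" "e \<notin> F" for e
    proof -
      have A: "{f \<in> E. \<not> leaf_edge E f \<and> edge_adjacent e f} = {f \<in> F. edge_adjacent e f}"
        using nl by blast
      have le: "leaf_edge E e" using nl e' by blast
      have "e = {z1, y1} \<or> e = {y2, z2}" using e' Eeq Feq by blast
      then have adj: "(\<exists>f. {f \<in> F. edge_adjacent e f} \<subseteq> {f}) \<and> e \<inter> Y \<noteq> {}"
      proof (elim disjE)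
        assume z: "e = {z1, y1}"
        have "\<not> edge_adjacent e {x, y2}" using d z by (simp add: edge_adjacent_def)
        then have "{f \<in> F. edge_adjacent e f} \<subseteq> {{y1, x}}" using Feq by blast
        then show ?thesis using z Y by blast
      next
        assume z: "e = {y2, z2}"
        have "\<not> edge_adjacent e {y1, x}" using d z by (simp add: edge_adjacent_def)
        then have "{f \<in> F. edge_adjacent e f} \<subseteq> {{x, y2}}" using Feq by blast
        then show ?thesis using z Y by blast
      qed
      then obtain f where "{f \<in> F. edge_adjacent e f} \<subseteq> {f}" by blast
      then have "card {f \<in> F. edge_adjacent e f} \<le> 1" using card_mono[of "{f}"] by fastforce
      then show ?thesis using adj le unfolding l_def A by simp
    qed
  qed
  ultimately show ?thesis unfolding constructible_def by blast
qed

text \<open>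
  The private neighbour of \<open>y\<close> is among the leaves at \<open>y\<close>, and by \<open>one\<close> it is the only one.
\<close>

lemma pendant_ray:
  assumes y: "y \<in> Y" and x: "{x, y} \<in> F"
    and leaves: "\<And>w. {y, w} \<in> E \<Longrightarrow> w \<noteq> x \<Longrightarrow> is_leaf E w"
    and one: "\<And>u z. {y, u} \<in> E \<Longrightarrow> is_leaf E u \<Longrightarrow> private_nbr E X Y y z \<Longrightarrow> z = u"
  shows "\<exists>z. is_leaf E z \<and> (\<forall>w. {y, w} \<in> E \<longleftrightarrow> w = x \<or> w = z)"
proof -
  obtain z where z: "private_nbr E X Y y z" using has_private[OF y] by blast
  then have yz: "{y, z} \<in> E" "z \<notin> X" by (auto simp: private_nbr_def)
  then have "is_leaf E z" using leaves Y_centre[OF y x] by blast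
  moreover have "w = x \<or> w = z" if "{y, w} \<in> E" for w
    using leaves[OF that] one[OF that _ z] by blast
  moreover have "{y, x} \<in> E" using F_nbr[OF x] by blast
  ultimately show ?thesis using yz(1) by blast
qed

text \<open>
  Suppose the tree is not constructible. Then no leaf is superfluous: there is none at a centre, and a
  leaf at \<open>y \<in> Y\<close> is the only private neighbour of \<open>y\<close>. Call the ray from \<open>x\<close> to \<open>y\<close> pendant if \<open>y\<close> has
  degree two and its other neighbour is a leaf; then \<open>x\<close> has at most one other ray.
  
  The tree of contracted stars is represented by the set \<open>G\<close> of those edges that are neither leaf edges
  nor part of an end star, that is, neither pendant rays nor the second ray of a star whose other ray
  is pendant and whose centre has no further neighbours. If \<open>G\<close> is empty, the tree is a path with five
  vertices. Otherwise a vertex \<open>p\<close> with a single edge \<open>{p, q}\<close> in \<open>G\<close> must lie on a star that is attached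
  to the rest by \<open>{p, q}\<close> only. If \<open>p\<close> is its centre, the fifth operation applies. If \<open>p\<close> is an outer end,
  the third one applies when \<open>p\<close> has a leaf; when it has none, \<open>q\<close> is its private neighbour and the fourth
  one applies.
\<close>

lemma constructible_if_nonempty: 
  assumes ne: "E \<noteq> {}"
  shows "constructible V E F X Y"
proof (rule ccontr)
  assume neg: "\<not> ?thesis"
  have leafE: "\<exists>v. \<forall>w. {u, w} \<in> E \<longleftrightarrow> w = v" if "is_leaf E u" for u
    using that is_leaf_iff[OF simple] by blast
  have leaf_nbr: "{u, w} \<in> E \<longleftrightarrow> w = v" if "is_leaf E u" "{v, u} \<in> E" for u v w
    using leafE[OF that(1)] that(2) edge_sym by metis
  have leaf_out: "u \<notin> X \<union> Y" if "is_leaf E u" for u using not_leaf that by blast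
  have no_X_leaf: False if x: "x \<in> X" "{x, u} \<in> E" "is_leaf E u" for x u
  proof -
    have "constructible V E F X Y"
    proof (rule constructible_O1[of x u])
      show "x \<in> X \<union> Y" using x by blast
      show "{u, w} \<in> E \<longleftrightarrow> w = x" for w by (rule leaf_nbr[OF x(3,2)])
      show "u \<notin> X \<union> Y" by (rule leaf_out[OF x(3)])
      show "\<exists>z. private_nbr E X Y y z \<and> z \<noteq> u" if y: "y \<in> Y" for y
      proof -
        obtain z where z: "private_nbr E X Y y z" using has_private[OF y] by blast
        then have "{z, y} \<in> E" by (simp add: private_nbr_def insert_commute)
        then have "z = u \<Longrightarrow> y = x" using leaf_nbr[OF x(3,2), of y] by simp
        then have "z \<noteq> u" using x(1) y disjoint by blast
        then show ?thesis using z by blast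
      qed
    qed
    then show False using neg by blast
  qed
  have one: "z = u" if y: "y \<in> Y" and u: "{y, u} \<in> E" "is_leaf E u" and z: "private_nbr E X Y y z" for y u z
  proof (rule ccontr)
    assume zu: "z \<noteq> u"
    have "constructible V E F X Y"
    proof (rule constructible_O1[of y u])
      show "y \<in> X \<union> Y" using y by blast
      show "{u, w} \<in> E \<longleftrightarrow> w = y" for w by (rule leaf_nbr[OF u(2,1)])
      show "u \<notin> X \<union> Y" by (rule leaf_out[OF u(2)])
      show "\<exists>z. private_nbr E X Y y' z \<and> z \<noteq> u" if y': "y' \<in> Y" for y'
      proof (cases "y' = y")
        case True
        then show ?thesis using z zu by blast
      next
        case False
        obtain z' where z': "private_nbr E X Y y' z'" using has_private[OF y'] by blast
        then have "{z', y'} \<in> E" by (simp add: private_nbr_def insert_commute)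
        then have "z' \<noteq> u" using leaf_nbr[OF u(2,1)] False by blast
        then show ?thesis using z' by blast
      qed
    qed
    then show False using neg by blast
  qed
  \<comment> \<open>\<open>pend y x\<close>: the ray from \<open>x\<close> to \<open>y\<close> is pendant.\<close>
  define pend where "pend = (\<lambda>y x. y \<in> Y \<and> {x, y} \<in> F \<and> (\<exists>z. is_leaf E z \<and> (\<forall>w. {y, w} \<in> E \<longleftrightarrow> w = x \<or> w = z)))"
  have pendI: "pend y x" if "y \<in> Y" "{x, y} \<in> F" "\<And>w. {y, w} \<in> E \<Longrightarrow> w \<noteq> x \<Longrightarrow> is_leaf E w" for x y
    unfolding pend_def using pendant_ray[OF that] one[OF that(1)] that by blast
  have pendD: "\<exists>z. is_leaf E z \<and> {y, z} \<in> E \<and> (\<forall>w. {y, w} \<in> E \<longleftrightarrow> w = x \<or> w = z) \<and> (\<forall>w. {z, w} \<in> E \<longleftrightarrow> w = y)"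
    if "pend y x" for x y
  proof -
    obtain z where z: "is_leaf E z" "\<forall>w. {y, w} \<in> E \<longleftrightarrow> w = x \<or> w = z" using \<open>pend y x\<close> by (auto simp: pend_def)
    then have yz: "{y, z} \<in> E" by blast
    then show ?thesis using z leaf_nbr[OF z(1) yz] by blast
  qed
  have two: "a = b" if y: "pend y x" and ab: "{x, a} \<in> F" "{x, b} \<in> F" "a \<noteq> y" "b \<noteq> y" for x y a b
  proof (rule ccontr)
    assume "a \<noteq> b"
    have xy: "{x, y} \<in> F" "y \<in> Y" using y by (simp_all add: pend_def)
    obtain z where z: "\<forall>w. {y, w} \<in> E \<longleftrightarrow> w = x \<or> w = z" "\<forall>w. {z, w} \<in> E \<longleftrightarrow> w = y" using pendD[OF y] by blast
    have "constructible V E F X Y"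
      by (rule constructible_O2[OF Y_centre[OF xy(2,1)] xy(1), of z]) (use z ab \<open>a \<noteq> b\<close> in blast)+
    then show False using neg by blast
  qed
  \<comment> \<open>\<open>bare x y\<close>: the only neighbours of the centre \<open>x\<close> are \<open>y\<close> and the end of a pendant ray.\<close>
  define bare where "bare = (\<lambda>x y. \<exists>y2. {x, y} \<in> F \<and> x \<in> X \<and> pend y2 x \<and> (\<forall>w. {x, w} \<in> E \<longleftrightarrow> w = y \<or> w = y2))"
  define G where "G = {e \<in> E. \<not> leaf_edge E e \<and> (\<forall>x y. e = {x, y} \<longrightarrow> \<not> pend y x \<and> \<not> bare x y)}"
  have GE: "G \<subseteq> E" by (auto simp: G_def)
  have G_D: "{a, b} \<in> E" "\<not> is_leaf E a" "\<not> is_leaf E b" "\<not> pend b a" "\<not> pend a b" "\<not> bare a b" "\<not> bare b a"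
    if "{a, b} \<in> G" for a b
  proof -
    note G = CollectD[OF that[unfolded G_def]]
    note g = G[THEN conjunct1] G[THEN conjunct2, THEN conjunct1] G[THEN conjunct2, THEN conjunct2]
    show "{a, b} \<in> E" by (rule g)
    show "\<not> is_leaf E a" "\<not> is_leaf E b" using g(1,2) by (auto simp: leaf_edge_def)
    show "\<not> pend b a" "\<not> bare a b" using g(3) by blast+
    have "{a, b} = {b, a}" by (rule insert_commute)
    then show "\<not> pend a b" "\<not> bare b a" using g(3) by blast+
  qed
  have not_G: "is_leaf E a \<or> is_leaf E b \<or> pend b a \<or> bare a b \<or> pend a b \<or> bare b a"
    if "{a, b} \<in> E" "{a, b} \<notin> G" for a b
  proof (rule ccontr)
    assume n: "\<not> ?thesis"
    have "\<not> leaf_edge E {a, b}" using n by (auto simp: leaf_edge_def)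
    moreover have "\<not> pend y x \<and> \<not> bare x y" if "{a, b} = {x, y}" for x y
    proof -
      have "a = x \<and> b = y \<or> a = y \<and> b = x" using that by (simp add: doubleton_eq_iff)
      then show ?thesis using n by blast
    qed
    ultimately have "{a, b} \<in> G" using \<open>{a, b} \<in> E\<close> by (simp add: G_def)
    then show False using \<open>{a, b} \<notin> G\<close> by blast
  qed
  have pendF: "{a, b} \<in> F" "{b, a} \<in> F" if "pend b a \<or> bare a b" for a b
    using that by (auto simp: pend_def bare_def insert_commute)
  have not_G_F: "is_leaf E a \<or> is_leaf E b \<or> {a, b} \<in> F" if "{a, b} \<in> E" "{a, b} \<notin> G" for a b
    using not_G[OF that] pendF by blast
  show False
  proof (cases "G = {}")
    case True
    obtain e where "e \<in> E" using ne by blast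
    then obtain a b where "{a, b} \<in> E" using simple unfolding simple_graph_def by (metis card_2_iff)
    then obtain x where x: "x \<in> X" using cover Y_centre centre by metis
    have all_pend: "pend y x" if y: "{x, y} \<in> F" for y
    proof (rule pendI)
      show yY: "y \<in> Y" by (rule X_ray[OF x y])
      show "is_leaf E w" if w: "{y, w} \<in> E" "w \<noteq> x" for w
      proof -
        have "{y, w} \<notin> F" using centre_unique[OF yY y, of w] w(2) by (auto simp: insert_commute)
        then show ?thesis using not_G_F[OF w(1)] True leaf_out yY by blast
      qed
    qed (rule y)
    obtain y1 y2 where y: "y1 \<noteq> y2" "{x, y1} \<in> F" "{x, y2} \<in> F" using rays[OF x] by blast
    obtain z1 where z1: "is_leaf E z1" "\<forall>w. {y1, w} \<in> E \<longleftrightarrow> w = x \<or> w = z1" "\<forall>w. {z1, w} \<in> E \<longleftrightarrow> w = y1"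
      using pendD[OF all_pend[OF y(2)]] by blast
    obtain z2 where z2: "is_leaf E z2" "\<forall>w. {y2, w} \<in> E \<longleftrightarrow> w = x \<or> w = z2" "\<forall>w. {z2, w} \<in> E \<longleftrightarrow> w = y2"
      using pendD[OF all_pend[OF y(3)]] by blast
    have Nx: "{x, w} \<in> E \<longleftrightarrow> w = y1 \<or> w = y2" for w
    proof
      assume w: "{x, w} \<in> E"
      have "{x, w} \<in> F" using not_G_F[OF w] True no_X_leaf[OF x w] leaf_out x by blast
      then show "w = y1 \<or> w = y2" using two[OF all_pend[OF y(2)] y(3), of w] y(1) by blast
    qed (use F_nbr y in blast)
    have Y: "y1 \<in> Y" "y2 \<in> Y" using X_ray[OF x] y by auto
    have "z1 \<noteq> z2" using z1(3) z2(3) y(1) by blast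
    then have "distinct [z1, y1, x, y2, z2]"
      using leaf_out z1(1) z2(1) Y x y(1) disjoint by auto
    then have "constructible V E F X Y"
      by (intro constructible_P5[OF x y(2,3), of z1 z2]) (use z1 z2 Nx in blast)+
    then show False using neg by blast
  next
    case False
    obtain p q where pq: "{p, q} \<in> G" and single': "\<forall>r. {p, r} \<in> G \<longrightarrow> r = q"
      using tree_subset_end_vertex[OF tree GE False] by metis
    have single: "r = q" if "{p, r} \<in> G" for r using single' that by blast
    note g = G_D[OF pq]
    have qp: "{q, p} \<in> E" using g(1) edge_sym by blast
    have other: "is_leaf E r \<or> {p, r} \<in> F" if "{p, r} \<in> E" "r \<noteq> q" for r
      using not_G_F[OF that(1)] single that(2) g(2) by blast
    obtain r where r: "{q, r} \<in> E" "r \<noteq> p" by (rule nonleaf_other_nbrE[OF simple qp g(3)])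
    consider "p \<notin> X \<union> Y" | "p \<in> X" | "p \<in> Y" by blast
    then show False
    proof cases
      case 1
      obtain r where r: "{p, r} \<in> E" "r \<noteq> q" by (rule nonleaf_other_nbrE[OF simple g(1,2)])
      have "r \<in> X \<union> Y" using cover[OF r(1)] 1 by blast
      then show False using other[OF r] leaf_out not_F 1 by blast
    next
      case 2
      have nb: "{p, s} \<in> F" if "{p, s} \<in> E" "s \<noteq> q" for s
        using other[OF that] no_X_leaf[OF 2 that(1)] by blast
      have pend: "pend s p" if s: "{p, s} \<in> F" "s \<noteq> q" for s
      proof -
        have sY: "s \<in> Y" by (rule X_ray[OF 2 s(1)])
        have "{p, s} \<in> E" using F_nbr[OF s(1)] by blast
        then have "pend s p \<or> bare p s \<or> pend p s \<or> bare s p"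
          using not_G[of p s] single[of s] s(2) g(2) leaf_out sY by blast
        moreover have "\<not> pend p s" "\<not> bare s p" using sY 2 disjoint by (auto simp: pend_def bare_def)
        moreover have "\<not> bare p s"
        proof
          assume "bare p s"
          then obtain y2 where "pend y2 p" "\<forall>w. {p, w} \<in> E \<longleftrightarrow> w = s \<or> w = y2" by (auto simp: bare_def)
          moreover from this have "q = s \<or> q = y2" using g(1) by simp
          ultimately have "pend q p" using s(2) by simp
          then show False using g(4) by blast
        qed
        ultimately show ?thesis by blast
      qed
      show False
      proof (cases "{p, q} \<in> F")
        case True
        obtain s where s: "{p, s} \<in> F" "s \<noteq> q" using rays[OF 2] by metis
        have "w = q \<or> w = s" if "{p, w} \<in> E" for w
          using two[OF pend[OF s] True, of w] nb[OF that] s(2) by blast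
        then have "bare p q" unfolding bare_def using True 2 pend[OF s] g(1) F_nbr[OF s(1)] by blast
        then show False using g(6) by blast
      next
        case notF: False
        obtain y1 y2 where y: "y1 \<noteq> y2" "{p, y1} \<in> F" "{p, y2} \<in> F" using rays[OF 2] by blast
        have yq: "y1 \<noteq> q" "y2 \<noteq> q" using y notF by blast+
        obtain z1 where z1: "is_leaf E z1" "\<forall>w. {y1, w} \<in> E \<longleftrightarrow> w = p \<or> w = z1" "\<forall>w. {z1, w} \<in> E \<longleftrightarrow> w = y1"
          using pendD[OF pend[OF y(2) yq(1)]] by blast
        obtain z2 where z2: "is_leaf E z2" "\<forall>w. {y2, w} \<in> E \<longleftrightarrow> w = p \<or> w = z2" "\<forall>w. {z2, w} \<in> E \<longleftrightarrow> w = y2"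
          using pendD[OF pend[OF y(3) yq(2)]] by blast
        have Np: "{p, w} \<in> E \<longleftrightarrow> w = y1 \<or> w = y2 \<or> w = q" for w
        proof
          assume w: "{p, w} \<in> E"
          show "w = y1 \<or> w = y2 \<or> w = q"
            using two[OF pend[OF y(2) yq(1)] y(3), of w] nb[OF w] y(1) by blast
        qed (use F_nbr y g(1) in blast)
        have Y: "y1 \<in> Y" "y2 \<in> Y" using X_ray[OF 2] y by auto
        have zz: "z1 \<noteq> z2" using z1(3) z2(3) y(1) by blast
        have "p \<noteq> q" by (rule simple_graph_edge(1)[OF simple g(1)])
        have "constructible V E F X Y"
        proof (rule constructible_O5[of p y1 y2 q z1 z2 r])
          show "{y1, p} \<in> F" using y(2) by (simp add: insert_commute)
          show "distinct [z1, y1, p, y2, z2]"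
            using zz leaf_out z1(1) z2(1) Y 2 y(1) disjoint by auto
          show "q \<notin> {z1, y1, p, y2, z2}" using g(3) z1(1) z2(1) yq \<open>p \<noteq> q\<close> by blast
        qed (use 2 y notF z1 z2 Np r in blast)+
        then show False using neg by blast
      qed
    next
      case 3
      obtain x where x: "{x, p} \<in> F" using centre[OF 3] by blast
      have xX: "x \<in> X" by (rule Y_centre[OF 3 x])
      have px: "{p, x} \<in> E" "{x, p} \<in> E" using F_nbr[OF x] by auto
      have other': "is_leaf E s" if "{p, s} \<in> E" "s \<noteq> q" "s \<noteq> x" for s
        using other[OF that(1,2)] centre_unique[OF 3 x, of s] that(3) by (auto simp: insert_commute)
      show False
      proof (cases "q = x")
        case True
        have "pend p x" by (rule pendI[OF 3 x]) (use other' True in blast)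
        then show False using g(5) True by blast
      next
        case qx: False
        have pqF: "{q, p} \<notin> F" using centre_unique[OF 3 x, of q] qx by blast
        have "x \<notin> Y" using xX disjoint by blast
        have "pend p x \<or> bare x p"
        proof -
          have "pend x p \<or> bare p x \<or> pend p x \<or> bare x p"
            using not_G[OF px(1)] single[of x] qx g(2) leaf_out xX by blast
          moreover have "\<not> pend x p" "\<not> bare p x" using \<open>x \<notin> Y\<close> 3 disjoint by (auto simp: pend_def bare_def)
          ultimately show ?thesis by blast
        qed
        moreover have "\<not> pend p x"
        proof
          assume "pend p x"
          then obtain z where "is_leaf E z" "\<forall>w. {p, w} \<in> E \<longleftrightarrow> w = x \<or> w = z" by (auto simp: pend_def)
          then show False using g(1,3) qx by blast
        qed
        ultimately obtain y2 where y2: "pend y2 x" and Nx: "\<forall>w. {x, w} \<in> E \<longleftrightarrow> w = p \<or> w = y2"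
          unfolding bare_def by blast
        have y2F: "{x, y2} \<in> F" "y2 \<in> Y" using y2 by (auto simp: pend_def)
        obtain z2 where z2: "is_leaf E z2" "\<forall>w. {y2, w} \<in> E \<longleftrightarrow> w = x \<or> w = z2" "\<forall>w. {z2, w} \<in> E \<longleftrightarrow> w = y2"
          using pendD[OF y2] by blast
        have "p \<noteq> y2" using \<open>\<not> pend p x\<close> y2 by blast
        have "q \<noteq> y2" using independent[OF 3 y2F(2)] g(1) by blast
        have "q \<noteq> z2" using g(3) z2(1) by blast
        have "p \<noteq> q" by (rule simple_graph_edge(1)[OF simple g(1)])
        have pxF: "{p, x} \<in> F" using x by (simp add: insert_commute)
        show False
        proof (cases "\<exists>z1. {p, z1} \<in> E \<and> is_leaf E z1")
          case True
          then obtain z1 where z1: "{p, z1} \<in> E" "is_leaf E z1" by blast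
          obtain z where z: "private_nbr E X Y p z" using has_private[OF 3] by blast
          have uniq: "s = z1" if "{p, s} \<in> E" "is_leaf E s" for s
            using one[OF 3 that z] one[OF 3 z1 z] by simp
          have Np: "{p, w} \<in> E \<longleftrightarrow> w = z1 \<or> w = x \<or> w = q" for w
            using other'[of w] uniq[of w] z1(1) px(1) g(1) by blast
          have Nz1: "{z1, w} \<in> E \<longleftrightarrow> w = p" for w by (rule leaf_nbr[OF z1(2,1)])
          have zz: "z1 \<noteq> z2" using Nz1 z2(3) \<open>p \<noteq> y2\<close> by blast
          have "constructible V E F X Y"
          proof (rule constructible_O3[of x p y2 q z1 z2 r])
            show "distinct [z1, p, x, y2, z2]"
              using zz leaf_out z1(2) z2(1) 3 y2F(2) xX \<open>p \<noteq> y2\<close> disjoint by auto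
            show "q \<notin> {z1, p, x, y2, z2}"
              using g(3) z1(2) \<open>q \<noteq> z2\<close> \<open>q \<noteq> y2\<close> qx \<open>p \<noteq> q\<close> by blast
          qed (use xX pxF y2F pqF Nz1 Np Nx z2 r in blast)+
          then show False using neg by blast
        next
          case False
          obtain z where z: "private_nbr E X Y p z" using has_private[OF 3] by blast
          then have "{p, z} \<in> E" "z \<notin> X" by (auto simp: private_nbr_def)
          then have "z = q" using other'[of z] False xX by blast
          have Np: "{p, w} \<in> E \<longleftrightarrow> w = x \<or> w = q" for w
            using other'[of w] False px(1) g(1) by blast
          have "constructible V E F X Y"
          proof (rule constructible_O4[of x p y2 q z2 r])
            show "distinct [p, x, y2, z2]"
              using leaf_out z2(1) 3 y2F(2) xX \<open>p \<noteq> y2\<close> disjoint by auto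
            show "q \<notin> {p, x, y2, z2}"
              using \<open>q \<noteq> z2\<close> \<open>q \<noteq> y2\<close> qx \<open>p \<noteq> q\<close> by blast
            show "private_nbr E X Y p q" using z \<open>z = q\<close> by simp
          qed (use xX pxF y2F Np Nx z2 r in blast)+
          then show False using neg by blast
        qed
      qed
    qed
  qed
qed

end

lemma star_cover_constructible:
  assumes "is_tree V E" "E \<noteq> {}" "star_cover E F X Y"
  shows "constructible V E F X Y"
  using assms
proof (induction "card V" arbitrary: V E F X Y rule: less_induct)
  case less
  have simple: "simple_graph V E" using less.prems(1) by (simp add: is_tree_def)
  then have "finite V" by (simp add: simple_graph_def)
  interpret star_cover E F X Y by (rule less.prems(3))
  interpret reducible_star_cover E F X Y V
  proof
    show "simple_graph V E" by (rule simple)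
    show "is_tree V E" by (rule less.prems(1))
    fix U assume U: "U \<inter> V \<noteq> {}" "is_tree (V - U) (avoiding U E)" "avoiding U E \<noteq> {}"
      "star_cover (avoiding U E) (avoiding U F) (X - U) (Y - U)"
    have "card (V - U) < card V" using \<open>finite V\<close> U(1) by (intro psubset_card_mono) auto
    then show "constructible (V - U) (avoiding U E) (avoiding U F) (X - U) (Y - U)"
      using less.hyps U(2-4) by blast
  qed
  show ?case by (rule constructible_if_nonempty[OF less.prems(2)])
qed

theorem theorem4p3:
  fixes V :: "'a set" and E :: "'a set set"
  assumes "is_tree V E" and "E \<noteq> {}"
  shows "total_edge_domination_number E = edge_domination_number E
    \<longleftrightarrow> (\<exists>l. family_Tt V E l)"
proof -
  have "star_cover E F X Y" if "labelled_star_cover E F X Y V l" for F X Y l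
    using that by (simp add: labelled_star_cover_def graph_star_cover_def)
  then have "(\<exists>l. family_Tt V E l) \<longleftrightarrow> (\<exists>F X Y. star_cover E F X Y)"
    using family_labelled_star_cover star_cover_constructible[OF assms]
    unfolding constructible_def by metis
  then show ?thesis using tree_equal_iff_star_cover[OF assms(1)] by simp
qed

end
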